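(* For every integer $k\ge 2$, the number of $k$-SAT functions on $n$ Boolean variables is at most $2^{(\pi(\vec T_k,\log_2 3)+o(1))\binom nk}$ as $n\to\infty$.
   Context: $k$-SAT setting: variables $x_1,\dots,x_n$; literals $x_i,\overline{x_i}$; a clause is a conjunction of $k$ literals on $k$ distinct variables; a formula is a set of clauses and represents the OR of its clauses; a $k$-SAT function is a function $\{0,1\}^n\to\{0,1\}$ represented by some $k$-SAT formula. A partially directed $k$-graph ($k$-PDG) on a vertex set $V$ specifies for each $k$-subset $S\subseteq V$ exactly one of: no edge on $S$; an undirected edge on $S$; or a directed edge on $S$ directed toward a chosen vertex of $S$. For an $n$-vertex $k$-PDG $\vec H$, $\alpha(\vec H)=e_u(\vec H)/\binom nk$ and $\beta(\vec H)=e_d(\vec H)/\binom nk$ where $e_u,e_d$ count undirected and directed edges. $\vec F$ is a subgraph of $\vec H$ if a $k$-PDG isomorphic to $\vec F$ can be obtained from $\vec H$ by deleting edges, deleting vertices and forgetting directions of edges; $\vec H$ is $\vec F$-free if $\vec F$ is not a subgraph. $\vec T_k$ is the $k$-PDG on $\{1,\dots,k+1\}$ with undirected edges $\{1,\dots,k\}$, $\{2,\dots,k+1\}$ and the edge $\{1,\dots,k-1,k+1\}$ directed toward $k+1$. $\pi(\vec F,\theta)$ is the smallest real number such that every $n$-vertex $\vec F$-free $k$-PDG $\vec H$ satisfies $\alpha(\vec H)+\theta\beta(\vec H)\le\pi(\vec F,\theta)+o_{n\to\infty}(1)$. *)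

theory Defs
  imports Complex_Main "HOL-Library.FuncSet"
begin

text \<open>The literal \<open>(i, True)\<close> is $x_i$ and \<open>(i, False)\<close> is its negation.\<close>

type_synonym literal = "nat \<times> bool"
type_synonym clause = "literal set"
type_synonym sat_formula = "clause set"
type_synonym assignment = "nat \<Rightarrow> bool"

definition clauses :: "nat \<Rightarrow> nat \<Rightarrow> clause set" where
  "clauses k n = {C. C \<subseteq> {1..n} \<times> UNIV \<and> card C = k \<and> inj_on fst C}"

definition assignments :: "nat \<Rightarrow> assignment set" where
  "assignments n = {1..n} \<rightarrow>\<^sub>E UNIV"

definition literal_true :: "assignment \<Rightarrow> literal \<Rightarrow> bool" where
  "literal_true a l \<longleftrightarrow> a (fst l) = snd l"

definition formula_true :: "sat_formula \<Rightarrow> assignment \<Rightarrow> bool" where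
  "formula_true \<Phi> a \<longleftrightarrow> (\<exists>C\<in>\<Phi>. \<forall>l\<in>C. literal_true a l)"

definition ksat_functions :: "nat \<Rightarrow> nat \<Rightarrow> (assignment \<Rightarrow> bool) set" where
  "ksat_functions k n =
     {f \<in> assignments n \<rightarrow>\<^sub>E UNIV.
        \<exists>\<Phi> \<subseteq> clauses k n. \<forall>a \<in> assignments n. f a = formula_true \<Phi> a}"

datatype 'a edge_status = No_Edge | Undirected | Directed 'a

record 'a pdg =
  verts :: "'a set"
  edge :: "'a set \<Rightarrow> 'a edge_status"

text \<open>Sets that are not \<open>k\<close>-subsets of the vertex set carry the status \<open>No_Edge\<close>.\<close>

definition is_kpdg :: "nat \<Rightarrow> 'a pdg \<Rightarrow> bool" where
  "is_kpdg k H \<longleftrightarrow>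
     finite (verts H) \<and>
     (\<forall>S. edge H S \<noteq> No_Edge \<longrightarrow> S \<subseteq> verts H \<and> card S = k) \<and>
     (\<forall>S v. edge H S = Directed v \<longrightarrow> v \<in> S)"

definition undirected_density :: "nat \<Rightarrow> 'a pdg \<Rightarrow> real" where
  "undirected_density k H =
     real (card {S. edge H S = Undirected}) / real (card (verts H) choose k)"

definition directed_density :: "nat \<Rightarrow> 'a pdg \<Rightarrow> real" where
  "directed_density k H =
     real (card {S. \<exists>v. edge H S = Directed v}) / real (card (verts H) choose k)"

inductive obtainable_from :: "'a pdg \<Rightarrow> 'a pdg \<Rightarrow> bool" for H :: "'a pdg" where
  refl: "obtainable_from H H"
| delete_edge:
    "obtainable_from H G \<Longrightarrow> obtainable_from H (G\<lparr>edge := (edge G)(S := No_Edge)\<rparr>)"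
| delete_vertex:
    "obtainable_from H G \<Longrightarrow>
     obtainable_from H
       \<lparr>verts = verts G - {v}, edge = (\<lambda>S. if v \<in> S then No_Edge else edge G S)\<rparr>"
| forget_direction:
    "obtainable_from H G \<Longrightarrow> edge G S = Directed v \<Longrightarrow>
     obtainable_from H (G\<lparr>edge := (edge G)(S := Undirected)\<rparr>)"

definition pdg_isomorphic :: "'a pdg \<Rightarrow> 'b pdg \<Rightarrow> bool" where
  "pdg_isomorphic F G \<longleftrightarrow>
     (\<exists>f. bij_betw f (verts F) (verts G) \<and>
          (\<forall>S \<subseteq> verts F. edge G (f ` S) = map_edge_status f (edge F S)))"

definition pdg_subgraph :: "'a pdg \<Rightarrow> 'b pdg \<Rightarrow> bool" where
  "pdg_subgraph F H \<longleftrightarrow> (\<exists>G. obtainable_from H G \<and> pdg_isomorphic F G)"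

text \<open>The vertices of the competing \<open>k\<close>-PDGs range over arbitrary finite sets of naturals,
  which covers every finite \<open>k\<close>-PDG up to isomorphism.\<close>

definition turan_bound :: "nat \<Rightarrow> 'a pdg \<Rightarrow> real \<Rightarrow> real \<Rightarrow> bool" where
  "turan_bound k F \<theta> c \<longleftrightarrow>
     (\<exists>\<epsilon> :: nat \<Rightarrow> real. \<epsilon> \<longlonglongrightarrow> 0 \<and>
       (\<forall>n. \<forall>H :: nat pdg. is_kpdg k H \<and> card (verts H) = n \<and> \<not> pdg_subgraph F H \<longrightarrow>
          undirected_density k H + \<theta> * directed_density k H \<le> c + \<epsilon> n))"

definition turan_density :: "nat \<Rightarrow> 'a pdg \<Rightarrow> real \<Rightarrow> real" where
  "turan_density k F \<theta> = (LEAST c. turan_bound k F \<theta> c)"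

definition T_pdg :: "nat \<Rightarrow> nat pdg" where
  "T_pdg k =
     \<lparr>verts = {1..k+1},
      edge = (\<lambda>S. if S = {1..k} \<or> S = {2..k+1} then Undirected
                  else if S = insert (k+1) {1..k-1} then Directed (k+1)
                  else No_Edge)\<rparr>"

end

theory Submission
  imports Defs "HOL-Library.Ramsey"
begin

text \<open>
  Every \<open>k\<close>-SAT function has an irredundant formula, one in which each clause has a private
  satisfying assignment, so it suffices to count these. Draw one uniformly at random. There is a
  set \<open>U\<close> of boundedly many variables such that, after conditioning on all clauses that touch
  \<open>U\<close> (which costs only \<open>O(n\<^bsup>k-1\<^esup>)\<close> bits), the parts of the formula on the \<open>k\<close>-subsets of a
  typical bounded set \<open>R\<close> of variables are almost independent: two distinct \<open>k\<close>-subsets \<open>e\<close>, \<open>e'\<close>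
  of \<open>R\<close> satisfy that \<open>e'\<close> meets \<open>R - e\<close>, so any dependence would lower the conditional entropy
  noticeably when \<open>R - e\<close> is added to \<open>U\<close>. Consequently all parts of non-negligible probability
  can be combined freely inside \<open>R\<close>. Since irredundancy is inherited by subformulas, few
  \<open>k\<close>-subsets of \<open>R\<close> then allow two clauses that differ in two variables or occur together. The
  other ones form a \<open>k\<close>-PDG (one possible clause: undirected; two clauses differing at \<open>v\<close>:
  directed to \<open>v\<close>) in which a \<open>2\<close>-fold blow-up of \<open>T_pdg k\<close> would produce a redundant formula, and
  by supersaturation its weight is at most \<open>\<pi> + o(1)\<close>.
\<close>

section \<open>Conditional entropy of coordinates\<close>

text \<open>With matching signs, one copy of \<open>T_pdg k\<close> is already redundant: the clause
  on \<open>{1..k}\<close> is the resolvent of the other two at the vertex \<open>k + 1\<close>. The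
  obstacle is that the signs need not match. Doubling the vertices repairs this. If a clause and all
  its one-variable swaps are present, a private witness of it takes opposite values on the two
  copies of every variable, so any prescribed sign is met by the right copy. The variable
  \<open>k + 1\<close> lies outside the clause and stays undetermined, which is why the third edge
  must offer both signs there. The clauses of such a configuration come from different formulas and
  must be brought into a single one. Entropy serves this purpose: a combination of frequent values
  that never occurs costs a fixed amount of total correlation. Conditioning on all coordinates that
  touch \<open>U\<close> suits it, because the other \<open>k\<close>-subsets of \<open>R\<close>
  are among the coordinates touching \<open>R - e\<close>; one potential depending on
  \<open>U\<close> alone then controls all pairs \<open>(R, e)\<close> at once. A good
  \<open>k\<close>-set has at most 1, 2 or 3 possible states if it carries no edge, an undirected
  edge or a directed edge. The logarithms 0, 1 and \<open>log 2 3\<close> are the weights in the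
  Turan density.\<close>

definition cell :: "('i \<Rightarrow> 's) set \<Rightarrow> 'i set \<Rightarrow> ('i \<Rightarrow> 's) \<Rightarrow> ('i \<Rightarrow> 's) set" where
  "cell \<Omega> A x = {y \<in> \<Omega>. \<forall>i\<in>A. y i = x i}"

text \<open>\<open>card \<Omega>\<close> times the conditional Shannon entropy of the coordinates in \<open>A\<close> given those in \<open>Z\<close>,
  for a uniformly random element of \<open>\<Omega>\<close>.\<close>

definition cond_entropy :: "('i \<Rightarrow> 's) set \<Rightarrow> 'i set \<Rightarrow> 'i set \<Rightarrow> real" where
  "cond_entropy \<Omega> A Z =
     (\<Sum>x\<in>\<Omega>. log 2 (real (card (cell \<Omega> Z x)) / real (card (cell \<Omega> (A \<union> Z) x))))"

lemma cell_subset: "cell \<Omega> A x \<subseteq> \<Omega>"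
  by (auto simp: cell_def)

lemma cell_empty [simp]: "cell \<Omega> {} x = \<Omega>"
  by (auto simp: cell_def)

lemma self_in_cell: "x \<in> \<Omega> \<Longrightarrow> x \<in> cell \<Omega> A x"
  by (auto simp: cell_def)

lemma cell_antimono: "A \<subseteq> B \<Longrightarrow> cell \<Omega> B x \<subseteq> cell \<Omega> A x"
  by (auto simp: cell_def)

lemma cell_eq: "y \<in> cell \<Omega> A x \<Longrightarrow> cell \<Omega> A y = cell \<Omega> A x"
  by (auto simp: cell_def)

lemma finite_cell: "finite \<Omega> \<Longrightarrow> finite (cell \<Omega> A x)"
  by (rule finite_subset[OF cell_subset])

lemma card_cell_pos: "finite \<Omega> \<Longrightarrow> x \<in> \<Omega> \<Longrightarrow> 0 < card (cell \<Omega> A x)"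
  using self_in_cell[of x \<Omega> A] finite_cell[of \<Omega> A x] by (auto simp: card_gt_0_iff)

text \<open>Tangent bound behind the three relative-entropy arguments below: a sum of logarithms of
  likelihood ratios is controlled as soon as the ratios themselves can be summed.\<close>

lemma log2_le_diff: "0 < t \<Longrightarrow> log 2 t \<le> (t - 1) / ln 2"
  using ln_le_minus_one[of t] by (simp add: log_def divide_right_mono)

lemma cond_entropy_nonneg:
  assumes "finite \<Omega>"
  shows "0 \<le> cond_entropy \<Omega> A Z"
  unfolding cond_entropy_def
proof (rule sum_nonneg)
  fix x assume x: "x \<in> \<Omega>"
  have "card (cell \<Omega> (A \<union> Z) x) \<le> card (cell \<Omega> Z x)"
    by (intro card_mono finite_cell assms cell_antimono) auto
  then show "0 \<le> log 2 (real (card (cell \<Omega> Z x)) / real (card (cell \<Omega> (A \<union> Z) x)))"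
    using card_cell_pos[OF assms x, of "A \<union> Z"] by (simp add: field_simps)
qed

lemma cond_entropy_chain:
  assumes "finite \<Omega>"
  shows "cond_entropy \<Omega> (A \<union> B) Z = cond_entropy \<Omega> A Z + cond_entropy \<Omega> B (A \<union> Z)"
  unfolding cond_entropy_def sum.distrib[symmetric]
proof (rule sum.cong[OF HOL.refl])
  fix x assume x: "x \<in> \<Omega>"
  note pos = card_cell_pos[OF assms x]
  have *: "B \<union> (A \<union> Z) = A \<union> B \<union> Z" by auto
  show "log 2 (real (card (cell \<Omega> Z x)) / real (card (cell \<Omega> (A \<union> B \<union> Z) x))) =
        log 2 (real (card (cell \<Omega> Z x)) / real (card (cell \<Omega> (A \<union> Z) x))) +
        log 2 (real (card (cell \<Omega> (A \<union> Z) x)) / real (card (cell \<Omega> (B \<union> (A \<union> Z)) x)))"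
    unfolding * using pos[of Z] pos[of "A \<union> Z"] pos[of "A \<union> B \<union> Z"]
    by (simp add: log_divide)
qed

text \<open>\<open>X\<close> lies inside a single \<open>B\<close>-cell, so all summands share one
  denominator, which is at least \<open>card X\<close>.\<close>

lemma sum_inverse_cell_le_1:
  assumes fin: "finite \<Omega>" and X: "X \<subseteq> \<Omega>"
    and agree: "\<And>x y i. x \<in> X \<Longrightarrow> y \<in> X \<Longrightarrow> i \<in> B \<Longrightarrow> y i = x i"
  shows "(\<Sum>x\<in>X. 1 / real (card (cell \<Omega> B x))) \<le> 1"
proof (cases "X = {}")
  case False
  then obtain z where z: "z \<in> X" by blast
  have sub: "X \<subseteq> cell \<Omega> B z" using agree[OF z] X by (auto simp: cell_def)
  have "(\<Sum>x\<in>X. 1 / real (card (cell \<Omega> B x))) = (\<Sum>x\<in>X. 1 / real (card (cell \<Omega> B z)))"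
    using sub by (intro sum.cong HOL.refl) (metis cell_eq subsetD)
  also have "\<dots> = real (card X) / real (card (cell \<Omega> B z))" by simp
  also have "\<dots> \<le> 1"
    using card_mono[OF finite_cell[OF fin] sub] card_cell_pos[OF fin, of z B] z X by (auto simp: divide_le_eq_1)
  finally show ?thesis .
qed auto

text \<open>The difference of the two entropies is the sum of \<open>log 2 (?t x)\<close>, where
  \<open>?t\<close> is the likelihood ratio of conditional mutual information. By the tangent bound
  it suffices that \<open>?t\<close> sums to at most \<open>card \<Omega>\<close>.\<close>

lemma cond_entropy_antimono:
  assumes fin: "finite \<Omega>" and sub: "Z \<subseteq> Z'"
  shows "cond_entropy \<Omega> A Z' \<le> cond_entropy \<Omega> A Z"
proof -
  let ?n = "\<lambda>B x. real (card (cell \<Omega> B x))"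
  let ?t = "\<lambda>x. ?n Z' x * ?n (A \<union> Z) x / (?n (A \<union> Z') x * ?n Z x)"
  have pos: "0 < ?n B x" if "x \<in> \<Omega>" for B x
    using card_cell_pos[OF fin that] by simp
  have ind: "?n B x = (\<Sum>u\<in>\<Omega>. if u \<in> cell \<Omega> B x then 1 else 0)" for B x
  proof -
    have "\<Omega> \<inter> cell \<Omega> B x = cell \<Omega> B x" using cell_subset by blast
    then show ?thesis using fin by (simp add: sum.If_cases)
  qed
  \<comment> \<open>The product of cell sizes in the numerator is turned into a count of pairs
    \<open>(u, v)\<close>, so that \<open>x\<close> can be summed first for fixed \<open>u\<close>
    and \<open>v\<close>.\<close>
  have "(\<Sum>x\<in>\<Omega>. ?t x) = (\<Sum>x\<in>\<Omega>. \<Sum>u\<in>\<Omega>. \<Sum>v\<in>\<Omega>.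
      (if u \<in> cell \<Omega> Z' x \<and> v \<in> cell \<Omega> (A \<union> Z) x then 1 / (?n (A \<union> Z') x * ?n Z x) else 0))"
  proof (rule sum.cong[OF HOL.refl])
    fix x
    have "?n Z' x * ?n (A \<union> Z) x =
      (\<Sum>u\<in>\<Omega>. \<Sum>v\<in>\<Omega>. if u \<in> cell \<Omega> Z' x \<and> v \<in> cell \<Omega> (A \<union> Z) x then 1 else 0)"
      unfolding ind[of Z'] ind[of "A \<union> Z"] sum_product by (intro sum.cong HOL.refl) auto
    then show "?t x = (\<Sum>u\<in>\<Omega>. \<Sum>v\<in>\<Omega>. (if u \<in> cell \<Omega> Z' x \<and> v \<in> cell \<Omega> (A \<union> Z) x
        then 1 / (?n (A \<union> Z') x * ?n Z x) else 0))"
      by (simp only: sum_divide_distrib) (intro sum.cong HOL.refl, auto)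
  qed
  also have "\<dots> = (\<Sum>u\<in>\<Omega>. \<Sum>v\<in>\<Omega>. \<Sum>x\<in>\<Omega>.
      (if u \<in> cell \<Omega> Z' x \<and> v \<in> cell \<Omega> (A \<union> Z) x then 1 / (?n (A \<union> Z') x * ?n Z x) else 0))"
    by (subst sum.swap, rule sum.cong[OF HOL.refl], subst sum.swap, rule HOL.refl)
  also have "\<dots> \<le> (\<Sum>u\<in>\<Omega>. \<Sum>v\<in>\<Omega>. if v \<in> cell \<Omega> Z u then 1 / ?n Z u else 0)"
  proof (intro sum_mono)
    fix u v assume u: "u \<in> \<Omega>" and v: "v \<in> \<Omega>"
    \<comment> \<open>On \<open>X\<close> the coordinates in \<open>Z'\<close> are fixed by
      \<open>u\<close> and those in \<open>A\<close> by \<open>v\<close>, so \<open>X\<close> lies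
      in one cell of \<open>A \<union> Z'\<close>. It is empty unless \<open>u\<close> and
      \<open>v\<close> agree on \<open>Z\<close>.\<close>
    define X where "X = {x \<in> \<Omega>. u \<in> cell \<Omega> Z' x \<and> v \<in> cell \<Omega> (A \<union> Z) x}"
    have "(\<Sum>x\<in>\<Omega>. (if u \<in> cell \<Omega> Z' x \<and> v \<in> cell \<Omega> (A \<union> Z) x
        then 1 / (?n (A \<union> Z') x * ?n Z x) else 0)) = (\<Sum>x\<in>X. 1 / (?n (A \<union> Z') x * ?n Z x))"
      unfolding X_def using fin by (simp add: sum.inter_filter)
    also have "\<dots> = (\<Sum>x\<in>X. 1 / ?n (A \<union> Z') x) * (1 / ?n Z u)"
    proof -
      have "?n Z x = ?n Z u" if "x \<in> X" for x
      proof -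
        have "u \<in> cell \<Omega> Z x" using that sub by (auto simp: X_def cell_def)
        then show ?thesis by (simp add: cell_eq)
      qed
      then show ?thesis by (simp add: sum_divide_distrib divide_divide_eq_left)
    qed
    also have "\<dots> \<le> (if v \<in> cell \<Omega> Z u then 1 / ?n Z u else 0)"
    proof (cases "v \<in> cell \<Omega> Z u")
      case True
      have "(\<Sum>x\<in>X. 1 / ?n (A \<union> Z') x) \<le> 1"
        by (rule sum_inverse_cell_le_1[OF fin]) (auto simp: X_def cell_def)
      then show ?thesis using True pos[OF u, of Z] by (simp add: divide_right_mono)
    next
      case False
      have "X = {}" using False sub u v by (fastforce simp: X_def cell_def)
      then show ?thesis using False by simp
    qed
    finally show "(\<Sum>x\<in>\<Omega>. (if u \<in> cell \<Omega> Z' x \<and> v \<in> cell \<Omega> (A \<union> Z) x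
        then 1 / (?n (A \<union> Z') x * ?n Z x) else 0)) \<le> (if v \<in> cell \<Omega> Z u then 1 / ?n Z u else 0)" .
  qed
  also have "\<dots> = (\<Sum>u\<in>\<Omega>. 1)"
  proof (rule sum.cong[OF HOL.refl])
    fix u assume u: "u \<in> \<Omega>"
    have "(\<Sum>v\<in>\<Omega>. if v \<in> cell \<Omega> Z u then 1 / ?n Z u else 0) = ?n Z u / ?n Z u"
      unfolding ind[of Z u] sum_divide_distrib by (intro sum.cong HOL.refl) auto
    then show "(\<Sum>v\<in>\<Omega>. if v \<in> cell \<Omega> Z u then 1 / ?n Z u else 0) = 1"
      using pos[OF u, of Z] by simp
  qed
  finally have S: "(\<Sum>x\<in>\<Omega>. ?t x) \<le> real (card \<Omega>)" by simp
  have "cond_entropy \<Omega> A Z' - cond_entropy \<Omega> A Z = (\<Sum>x\<in>\<Omega>. log 2 (?t x))"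
    unfolding cond_entropy_def sum_subtractf[symmetric]
  proof (rule sum.cong[OF HOL.refl])
    fix x assume x: "x \<in> \<Omega>"
    show "log 2 (?n Z' x / ?n (A \<union> Z') x) - log 2 (?n Z x / ?n (A \<union> Z) x) = log 2 (?t x)"
      using pos[OF x, of Z] pos[OF x, of Z'] pos[OF x, of "A \<union> Z"] pos[OF x, of "A \<union> Z'"]
      by (simp add: log_divide log_mult)
  qed
  also have "\<dots> \<le> (\<Sum>x\<in>\<Omega>. (?t x - 1) / ln 2)"
    using pos by (intro sum_mono log2_le_diff) auto
  also have "\<dots> = ((\<Sum>x\<in>\<Omega>. ?t x) - real (card \<Omega>)) / ln 2"
    by (simp add: sum_divide_distrib[symmetric] sum_subtractf)
  also have "\<dots> \<le> 0" using S by (simp add: divide_le_0_iff)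
  finally show ?thesis by simp
qed

lemma cond_entropy_insert:
  assumes "finite \<Omega>"
  shows "cond_entropy \<Omega> (insert e E) Z = cond_entropy \<Omega> E Z + cond_entropy \<Omega> {e} (E \<union> Z)"
proof -
  have "insert e E = E \<union> {e}" by simp
  then show ?thesis using cond_entropy_chain[OF assms, of E "{e}" Z] by metis
qed

lemma cond_entropy_empty:
  assumes "finite \<Omega>"
  shows "cond_entropy \<Omega> {} Z = 0"
  unfolding cond_entropy_def
proof (intro sum.neutral ballI)
  fix x assume "x \<in> \<Omega>"
  then show "log 2 (real (card (cell \<Omega> Z x)) / real (card (cell \<Omega> ({} \<union> Z) x))) = 0"
    using card_cell_pos[OF assms, of x Z] by simp
qed

lemma cond_entropy_le_sum:
  assumes fin: "finite \<Omega>" and "finite E"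
  shows "cond_entropy \<Omega> E Z \<le> (\<Sum>e\<in>E. cond_entropy \<Omega> {e} Z)"
  using \<open>finite E\<close>
proof induction
  case empty
  then show ?case by (simp add: cond_entropy_empty[OF fin])
next
  case (insert e E)
  have "cond_entropy \<Omega> {e} (E \<union> Z) \<le> cond_entropy \<Omega> {e} Z"
    by (rule cond_entropy_antimono[OF fin]) auto
  then show ?case using insert cond_entropy_insert[OF fin, of e E Z] by simp
qed

text \<open>Companion of \<open>cond_entropy_le_sum\<close>: together they bound the total
  correlation of \<open>E\<close> by what its coordinates lose when each is conditioned on all the
  others. In the induction, a new coordinate enters by the chain rule and only lowers the earlier
  summands.\<close>

lemma cond_entropy_ge_sum:
  assumes fin: "finite \<Omega>" and "finite E"
  shows "(\<Sum>e\<in>E. cond_entropy \<Omega> {e} (E - {e} \<union> Z)) \<le> cond_entropy \<Omega> E Z"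
  using \<open>finite E\<close>
proof induction
  case empty
  then show ?case by (simp add: cond_entropy_empty[OF fin])
next
  case (insert e E)
  have "(\<Sum>e'\<in>E. cond_entropy \<Omega> {e'} (insert e E - {e'} \<union> Z))
      \<le> (\<Sum>e'\<in>E. cond_entropy \<Omega> {e'} (E - {e'} \<union> Z))"
    by (intro sum_mono cond_entropy_antimono[OF fin]) auto
  moreover have "insert e E - {e} \<union> Z = E \<union> Z" using insert.hyps by auto
  ultimately show ?case using insert cond_entropy_insert[OF fin, of e E Z] by simp
qed

section \<open>Decomposition of conditional entropy into cells\<close>

lemma cond_entropy_cells:
  assumes fin: "finite \<Omega>"
  shows "cond_entropy \<Omega> A Z = (\<Sum>c\<in>cell \<Omega> Z ` \<Omega>. cond_entropy c A {})"
proof -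
  let ?g = "\<lambda>x. log 2 (real (card (cell \<Omega> Z x)) / real (card (cell \<Omega> (A \<union> Z) x)))"
  have "cond_entropy \<Omega> A Z = (\<Sum>c\<in>cell \<Omega> Z ` \<Omega>. \<Sum>x\<in>{x \<in> \<Omega>. cell \<Omega> Z x = c}. ?g x)"
    unfolding cond_entropy_def by (rule sum.image_gen[OF fin])
  also have "\<dots> = (\<Sum>c\<in>cell \<Omega> Z ` \<Omega>. cond_entropy c A {})"
  proof (rule sum.cong[OF HOL.refl])
    fix c assume "c \<in> cell \<Omega> Z ` \<Omega>"
    then obtain z where z: "z \<in> \<Omega>" and c: "c = cell \<Omega> Z z" by blast
    have eq: "{x \<in> \<Omega>. cell \<Omega> Z x = c} = c"
      unfolding c by (auto simp: cell_def)
    show "(\<Sum>x\<in>{x \<in> \<Omega>. cell \<Omega> Z x = c}. ?g x) = cond_entropy c A {}"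
      unfolding eq unfolding cond_entropy_def
    proof (rule sum.cong[OF HOL.refl])
      fix x assume x: "x \<in> c"
      have "cell \<Omega> Z x = c" using x c cell_eq by blast
      moreover have "cell c A x = cell \<Omega> (A \<union> Z) x"
        using x c by (auto simp: cell_def)
      ultimately show "?g x = log 2 (real (card (cell c {} x)) / real (card (cell c (A \<union> {}) x)))"
        by simp
    qed
  qed
  finally show ?thesis .
qed

lemma sum_card_cells:
  assumes fin: "finite \<Omega>"
  shows "(\<Sum>c\<in>cell \<Omega> Z ` \<Omega>. card c) = card \<Omega>"
proof -
  have "card \<Omega> = (\<Sum>c\<in>cell \<Omega> Z ` \<Omega>. \<Sum>x\<in>{x \<in> \<Omega>. cell \<Omega> Z x = c}. 1)"
    using sum.image_gen[OF fin, of "\<lambda>_. 1::nat" "cell \<Omega> Z"] by simp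
  also have "\<dots> = (\<Sum>c\<in>cell \<Omega> Z ` \<Omega>. card c)"
  proof (rule sum.cong[OF HOL.refl])
    fix c assume "c \<in> cell \<Omega> Z ` \<Omega>"
    then have "{x \<in> \<Omega>. cell \<Omega> Z x = c} = c"
      by (auto simp: cell_def)
    then show "(\<Sum>x\<in>{x \<in> \<Omega>. cell \<Omega> Z x = c}. 1) = card c" by simp
  qed
  finally show ?thesis by simp
qed

section \<open>Entropy and the number of values\<close>

lemma entropy_full:
  assumes fin: "finite \<Omega>" and inj: "\<And>x y. x \<in> \<Omega> \<Longrightarrow> y \<in> \<Omega> \<Longrightarrow> \<forall>i\<in>I. y i = x i \<Longrightarrow> y = x"
  shows "cond_entropy \<Omega> I {} = real (card \<Omega>) * log 2 (real (card \<Omega>))"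
proof -
  have "cell \<Omega> I x = {x}" if "x \<in> \<Omega>" for x
    using inj that by (auto simp: cell_def)
  then show ?thesis by (simp add: cond_entropy_def)
qed

text \<open>Cross-entropy bound with a freely chosen subprobability \<open>Q\<close>. It is applied
  below to the uniform law and to a law tilted towards the frequent values.\<close>

lemma gibbs_inequality:
  fixes Q :: "'s \<Rightarrow> real"
  assumes fin: "finite \<Omega>" and S: "finite S" "\<And>x. x \<in> \<Omega> \<Longrightarrow> x i \<in> S"
    and Q: "\<And>s. s \<in> S \<Longrightarrow> 0 < Q s" "(\<Sum>s\<in>S. Q s) \<le> 1"
  shows "cond_entropy \<Omega> {i} {} \<le> (\<Sum>x\<in>\<Omega>. log 2 (1 / Q (x i)))"
proof -
  let ?N = "real (card \<Omega>)" and ?c = "\<lambda>x. real (card (cell \<Omega> {i} x))"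
  have pos: "0 < ?c x" "0 < ?N" "0 < Q (x i)" if "x \<in> \<Omega>" for x
    using card_cell_pos[OF fin that] Q(1) S(2) fin that by (auto simp: card_gt_0_iff)
  have "(\<Sum>x\<in>\<Omega>. Q (x i) / ?c x) = (\<Sum>s\<in>S. \<Sum>x\<in>{x \<in> \<Omega>. x i = s}. Q (x i) / ?c x)"
    using S fin by (intro sum.group[symmetric]) auto
  also have "\<dots> \<le> (\<Sum>s\<in>S. Q s * 1)"
  proof (rule sum_mono)
    fix s assume s: "s \<in> S"
    have "(\<Sum>x\<in>{x \<in> \<Omega>. x i = s}. Q (x i) / ?c x) = Q s * (\<Sum>x\<in>{x \<in> \<Omega>. x i = s}. 1 / ?c x)"
      by (simp add: sum_distrib_left)
    also have "\<dots> \<le> Q s * 1"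
      using Q(1)[OF s] by (intro mult_left_mono sum_inverse_cell_le_1[OF fin]) auto
    finally show "(\<Sum>x\<in>{x \<in> \<Omega>. x i = s}. Q (x i) / ?c x) \<le> Q s * 1" .
  qed
  finally have le1: "(\<Sum>x\<in>\<Omega>. Q (x i) / ?c x) \<le> 1" using Q(2) by simp
  have "cond_entropy \<Omega> {i} {} - (\<Sum>x\<in>\<Omega>. log 2 (1 / Q (x i))) = (\<Sum>x\<in>\<Omega>. log 2 (?N * (Q (x i) / ?c x)))"
    unfolding cond_entropy_def sum_subtractf[symmetric]
  proof (rule sum.cong[OF HOL.refl])
    fix x assume "x \<in> \<Omega>"
    note p = pos[OF this]
    then show "log 2 (real (card (cell \<Omega> {} x)) / real (card (cell \<Omega> ({i} \<union> {}) x))) - log 2 (1 / Q (x i)) =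
         log 2 (?N * (Q (x i) / ?c x))"
      using p by (simp add: log_divide log_mult)
  qed
  also have "\<dots> \<le> (\<Sum>x\<in>\<Omega>. (?N * (Q (x i) / ?c x) - 1) / ln 2)"
    using pos by (intro sum_mono log2_le_diff) (meson divide_pos_pos mult_pos_pos)
  also have "\<dots> = ?N * ((\<Sum>x\<in>\<Omega>. Q (x i) / ?c x) - 1) / ln 2"
    by (simp add: sum_divide_distrib[symmetric] sum_subtractf sum_distrib_left[symmetric] algebra_simps
        del: times_divide_eq_right)
  also have "\<dots> \<le> 0"
    using le1 by (simp add: divide_le_0_iff mult_le_0_iff)
  finally show ?thesis by simp
qed

lemma entropy_le_log_card:
  assumes fin: "finite \<Omega>" and S: "finite S" "\<And>x. x \<in> \<Omega> \<Longrightarrow> x i \<in> S"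
  shows "cond_entropy \<Omega> {i} {} \<le> real (card \<Omega>) * log 2 (real (card S))"
proof (cases "\<Omega> = {}")
  case False
  then have "S \<noteq> {}" using S by blast
  then have p: "0 < card S" using S(1) by (simp add: card_gt_0_iff)
  have "cond_entropy \<Omega> {i} {} \<le> (\<Sum>x\<in>\<Omega>. log 2 (1 / (1 / real (card S))))"
    by (rule gibbs_inequality[OF fin S, where Q = "\<lambda>_. 1 / real (card S)"]) (use p in auto)
  then show ?thesis by simp
qed (simp add: cond_entropy_def)

definition frequent :: "real \<Rightarrow> ('i \<Rightarrow> 's) set \<Rightarrow> 'i \<Rightarrow> 's set" where
  "frequent \<delta> \<Omega> i = {s. \<delta> * real (card \<Omega>) \<le> real (card {x \<in> \<Omega>. x i = s}) \<and> (\<exists>x\<in>\<Omega>. x i = s)}"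

text \<open>Rare values have small total probability, hence contribute little even at a high cost
  per occurrence. What matters later is that \<delta> depends only on \<epsilon> and
  \<open>s\<close>, so that one threshold serves all cells and all coordinates.\<close>

lemma entropy_le_log_frequent:
  fixes s :: nat and \<epsilon> :: real
  assumes "0 < \<epsilon>"
  shows "\<exists>\<delta>>0. \<forall>(\<Omega> :: ('i \<Rightarrow> 's) set) S i. finite \<Omega> \<and> \<Omega> \<noteq> {} \<and> finite S \<and> card S \<le> s \<and> (\<forall>x\<in>\<Omega>. x i \<in> S) \<longrightarrow>
     frequent \<delta> \<Omega> i \<noteq> {} \<and>
     cond_entropy \<Omega> {i} {} \<le> real (card \<Omega>) * (log 2 (real (card (frequent \<delta> \<Omega> i))) + \<epsilon>)"
proof -
  define s' where "s' = real s + 1"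
  have s': "s' \<ge> 1" by (simp add: s'_def)
  \<comment> \<open>Mass that \<open>Q\<close> reserves for the rare values, chosen so that each
    frequent value pays a surcharge of exactly \<open>\<epsilon> / 2\<close>.\<close>
  define \<gamma> :: real where "\<gamma> = 1 - 2 powr (- \<epsilon> / 2)"
  have g: "0 < \<gamma>" "\<gamma> < 1" using assms by (auto simp: \<gamma>_def powr_less_one)
  have lg: "log 2 (1 / (1 - \<gamma>)) = \<epsilon> / 2" by (simp add: \<gamma>_def log_divide)
  have lsg: "0 < log 2 (s' / \<gamma>)" using g s' by simp
  \<comment> \<open>The first term of the minimum leaves some value frequent; the second keeps the
    contribution of the rare values below \<open>\<epsilon> / 2\<close>.\<close>
  define \<delta> where "\<delta> = min (1 / (2 * s')) (\<epsilon> / (2 * s' * log 2 (s' / \<gamma>)))"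
  have d: "0 < \<delta>" using assms s' lsg by (simp add: \<delta>_def)
  have d1: "s' * \<delta> < 1"
  proof -
    have "s' * \<delta> \<le> s' * (1 / (2 * s'))" using s' by (intro mult_left_mono) (auto simp: \<delta>_def)
    then show ?thesis using s' by simp
  qed
  have d2: "s' * \<delta> * log 2 (s' / \<gamma>) \<le> \<epsilon> / 2"
  proof -
    have "s' * \<delta> * log 2 (s' / \<gamma>) \<le> s' * (\<epsilon> / (2 * s' * log 2 (s' / \<gamma>))) * log 2 (s' / \<gamma>)"
      using s' lsg by (intro mult_left_mono mult_right_mono) (auto simp: \<delta>_def)
    then show ?thesis using s' lsg by simp
  qed
  show ?thesis
  proof (intro exI[of _ \<delta>] conjI d allI impI; elim conjE)
    fix \<Omega> :: "('i \<Rightarrow> 's) set" and S i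
    assume fin: "finite \<Omega>" and ne: "\<Omega> \<noteq> {}" and S: "finite S" "card S \<le> s" "\<forall>x\<in>\<Omega>. x i \<in> S"
    define F where "F = frequent \<delta> \<Omega> i"
    have FS: "F \<subseteq> S" using S(3) by (auto simp: F_def frequent_def)
    have finF: "finite F" using FS S(1) finite_subset by blast
    let ?N = "real (card \<Omega>)"
    have N: "?N > 0" using fin ne by (simp add: card_gt_0_iff)
    define B where "B = {x \<in> \<Omega>. x i \<notin> F}"
    have "real (card B) = (\<Sum>t\<in>S - F. real (card {x \<in> B. x i = t}))"
    proof -
      have "(\<Sum>t\<in>S - F. \<Sum>x\<in>{x \<in> B. x i = t}. 1) = (\<Sum>x\<in>B. 1::nat)"
        by (rule sum.group) (use fin S in \<open>auto simp: B_def\<close>)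
      then show ?thesis by (simp flip: of_nat_sum)
    qed
    also have "\<dots> \<le> (\<Sum>t\<in>S - F. \<delta> * ?N)"
    proof (rule sum_mono)
      fix t assume t: "t \<in> S - F"
      show "real (card {x \<in> B. x i = t}) \<le> \<delta> * ?N"
      proof (cases "\<exists>x\<in>\<Omega>. x i = t")
        case True
        then have "real (card {x \<in> \<Omega>. x i = t}) < \<delta> * ?N"
          using t by (auto simp: F_def frequent_def)
        moreover have "card {x \<in> B. x i = t} \<le> card {x \<in> \<Omega>. x i = t}"
          using fin by (intro card_mono) (auto simp: B_def)
        ultimately show ?thesis by linarith
      next
        case False
        then have none: "{x \<in> B. x i = t} = {}" by (auto simp: B_def)
        show ?thesis unfolding none using d N by simp
      qed
    qed
    also have "\<dots> = real (card (S - F)) * (\<delta> * ?N)" by simp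
    also have "\<dots> \<le> s' * (\<delta> * ?N)"
    proof -
      have "card (S - F) \<le> s" using S card_mono[of S "S - F"] by auto
      then show ?thesis using d N by (intro mult_right_mono) (auto simp: s'_def)
    qed
    finally have cB: "real (card B) \<le> s' * \<delta> * ?N" by simp
    have Fne: "F \<noteq> {}"
    proof
      assume "F = {}"
      then have "B = \<Omega>" by (auto simp: B_def)
      then have "?N \<le> s' * \<delta> * ?N" using cB by simp
      then show False using d1 N by (simp add: mult_le_cancel_right1)
    qed
    then have F1: "real (card F) \<ge> 1" using finF by (simp add: Suc_leI card_gt_0_iff)
    define Q where "Q = (\<lambda>t. if t \<in> F then (1 - \<gamma>) / real (card F) else \<gamma> / s')"
    have Qpos: "0 < Q t" for t using F1 g s' by (auto simp: Q_def)
    have "(\<Sum>t\<in>S. Q t) = (\<Sum>t\<in>F. Q t) + (\<Sum>t\<in>S - F. Q t)"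
      using FS S(1) by (metis sum.subset_diff add.commute)
    also have "(\<Sum>t\<in>F. Q t) = 1 - \<gamma>" using F1 by (simp add: Q_def)
    also have "(\<Sum>t\<in>S - F. Q t) = real (card (S - F)) * (\<gamma> / s')" by (simp add: Q_def)
    also have "\<dots> \<le> \<gamma>"
    proof -
      have "card (S - F) \<le> s" using S card_mono[of S "S - F"] by auto
      then have "real (card (S - F)) * (\<gamma> / s') \<le> s' * (\<gamma> / s')"
        using g s' by (intro mult_right_mono) (auto simp: s'_def)
      then show ?thesis using s' by simp
    qed
    finally have Q1: "(\<Sum>t\<in>S. Q t) \<le> 1" by simp
    have "cond_entropy \<Omega> {i} {} \<le> (\<Sum>x\<in>\<Omega>. log 2 (1 / Q (x i)))"
      using S Q1 Qpos by (intro gibbs_inequality[OF fin, of S]) auto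
    also have "\<dots> \<le> (\<Sum>x\<in>\<Omega>. (log 2 (real (card F)) + \<epsilon> / 2) + (if x \<in> B then log 2 (s' / \<gamma>) else 0))"
    proof (rule sum_mono)
      fix x assume x: "x \<in> \<Omega>"
      show "log 2 (1 / Q (x i)) \<le> (log 2 (real (card F)) + \<epsilon> / 2) + (if x \<in> B then log 2 (s' / \<gamma>) else 0)"
      proof (cases "x i \<in> F")
        case True
        have "log 2 (1 / Q (x i)) = log 2 (real (card F)) + log 2 (1 / (1 - \<gamma>))"
          using True F1 g by (simp add: Q_def log_divide)
        then show ?thesis using lg True by (simp add: B_def)
      next
        case False
        then show ?thesis using x F1 assms by (simp add: Q_def B_def)
      qed
    qed
    also have "\<dots> = ?N * (log 2 (real (card F)) + \<epsilon> / 2) + real (card B) * log 2 (s' / \<gamma>)"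
    proof -
      have "\<Omega> \<inter> B = B" by (auto simp: B_def)
      then show ?thesis using fin by (simp add: sum.distrib sum.If_cases)
    qed
    also have "real (card B) * log 2 (s' / \<gamma>) \<le> s' * \<delta> * ?N * log 2 (s' / \<gamma>)"
      using cB lsg by (intro mult_right_mono) auto
    also have "\<dots> = (s' * \<delta> * log 2 (s' / \<gamma>)) * ?N" by simp
    also have "\<dots> \<le> \<epsilon> / 2 * ?N" using d2 N by (intro mult_right_mono) auto
    finally have "cond_entropy \<Omega> {i} {} \<le> ?N * (log 2 (real (card F)) + \<epsilon>)"
      by (simp add: algebra_simps)
    then show "frequent \<delta> \<Omega> i \<noteq> {}"
      and "cond_entropy \<Omega> {i} {} \<le> ?N * (log 2 (real (card (frequent \<delta> \<Omega> i))) + \<epsilon>)"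
      using Fne by (auto simp: F_def)
  qed
qed

text \<open>A combination of frequent values that never occurs would have probability at least
  \<open>\<delta> ^ card E\<close> under the product of the marginals, forcing a large relative entropy.\<close>

lemma total_correlation_realizes:
  fixes \<Omega> :: "('i \<Rightarrow> 's) set"
  assumes fin: "finite \<Omega>" and ne: "\<Omega> \<noteq> {}" and finE: "finite E" and d: "0 < \<delta>"
    and t: "\<And>e. e \<in> E \<Longrightarrow> t e \<in> frequent \<delta> \<Omega> e"
    and tc: "(\<Sum>e\<in>E. cond_entropy \<Omega> {e} {}) - cond_entropy \<Omega> E {} < real (card \<Omega>) * \<delta> ^ card E / ln 2"
  shows "\<exists>x\<in>\<Omega>. \<forall>e\<in>E. x e = t e"
proof (rule ccontr)
  assume no: "\<not> ?thesis"
  let ?N = "real (card \<Omega>)"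
  have N: "?N > 0" using fin ne by (simp add: card_gt_0_iff)
  define p where "p = (\<lambda>e s. real (card {x \<in> \<Omega>. x e = s}) / ?N)"
  have cell1: "cell \<Omega> {e} x = {y \<in> \<Omega>. y e = x e}" for e x by (auto simp: cell_def)
  have p_pos: "0 < p e (x e)" if "x \<in> \<Omega>" for e x
    using card_cell_pos[OF fin that, of "{e}"] N by (simp add: p_def cell1)
  have p_nn: "0 \<le> p e s" for e s using N by (simp add: p_def)
  define T where "T = (\<Pi>\<^sub>E e\<in>E. (\<lambda>x. x e) ` \<Omega>)"
  have finT: "finite T" unfolding T_def using finE fin by (intro finite_PiE) auto
  have p_sum: "(\<Sum>s\<in>(\<lambda>x. x e) ` \<Omega>. p e s) = 1" for e
  proof -
    have "?N = (\<Sum>s\<in>(\<lambda>x. x e) ` \<Omega>. real (card {x \<in> \<Omega>. x e = s}))"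
      using sum.image_gen[OF fin, of "\<lambda>_. 1::real" "\<lambda>x. x e"] by simp
    then show ?thesis using N by (simp add: p_def sum_divide_distrib[symmetric])
  qed
  have total: "(\<Sum>f\<in>T. \<Prod>e\<in>E. p e (f e)) = 1"
    unfolding T_def using finE fin p_sum by (subst prod_sum_PiE[symmetric]) auto
  define t0 where "t0 = restrict t E"
  have "t e \<in> (\<lambda>x. x e) ` \<Omega>" if "e \<in> E" for e
    using t[OF that] by (simp add: frequent_def image_iff) metis
  then have t0T: "t0 \<in> T" by (auto simp: t0_def T_def)
  have t0p: "\<delta> ^ card E \<le> (\<Prod>e\<in>E. p e (t0 e))"
  proof -
    have "(\<Prod>e\<in>E. \<delta>) \<le> (\<Prod>e\<in>E. p e (t0 e))"
    proof (rule prod_mono, intro conjI)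
      fix e assume e: "e \<in> E"
      have "\<delta> * ?N \<le> real (card {x \<in> \<Omega>. x e = t e})" using t[OF e] by (simp add: frequent_def)
      then show "\<delta> \<le> p e (t0 e)" using N e by (simp add: p_def t0_def field_simps)
    qed (use d in auto)
    then show ?thesis by simp
  qed
  let ?c = "\<lambda>x. real (card (cell \<Omega> E x))"
  let ?P = "\<lambda>x. \<Prod>e\<in>E. p e (x e)"
  have cpos: "0 < ?c x" if "x \<in> \<Omega>" for x using card_cell_pos[OF fin that] by simp
  have Ppos: "0 < ?P x" if "x \<in> \<Omega>" for x using p_pos[OF that] by (intro prod_pos) auto
  \<comment> \<open>Grouping by the restriction to \<open>E\<close> counts the product mass of every
    realized tuple at most once. The tuple \<open>t0\<close> is missing, and this is the loss
    \<open>\<delta> ^ card E\<close>.\<close>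
  have "(\<Sum>x\<in>\<Omega>. ?P x / ?c x) = (\<Sum>f\<in>T - {t0}. \<Sum>x\<in>{x \<in> \<Omega>. restrict x E = f}. ?P x / ?c x)"
  proof (rule sum.group[symmetric, OF fin])
    show "(\<lambda>x. restrict x E) ` \<Omega> \<subseteq> T - {t0}"
      using no by (auto simp: T_def t0_def) (metis restrict_apply')
  qed (use finT in auto)
  also have "\<dots> \<le> (\<Sum>f\<in>T - {t0}. (\<Prod>e\<in>E. p e (f e)) * 1)"
  proof (rule sum_mono)
    fix f assume "f \<in> T - {t0}"
    let ?X = "{x \<in> \<Omega>. restrict x E = f}"
    have eq: "x e = f e" if "x \<in> ?X" "e \<in> E" for x e using that by auto
    have "(\<Sum>x\<in>?X. ?P x / ?c x) = (\<Sum>x\<in>?X. (\<Prod>e\<in>E. p e (f e)) * (1 / ?c x))"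
    proof (rule sum.cong[OF HOL.refl])
      fix x assume "x \<in> ?X"
      then have "?P x = (\<Prod>e\<in>E. p e (f e))" using eq by (intro prod.cong) auto
      then show "?P x / ?c x = (\<Prod>e\<in>E. p e (f e)) * (1 / ?c x)" by simp
    qed
    also have "\<dots> = (\<Prod>e\<in>E. p e (f e)) * (\<Sum>x\<in>?X. 1 / ?c x)" by (simp add: sum_distrib_left)
    also have "\<dots> \<le> (\<Prod>e\<in>E. p e (f e)) * 1"
    proof (rule mult_left_mono)
      show "(\<Sum>x\<in>?X. 1 / ?c x) \<le> 1"
      proof (rule sum_inverse_cell_le_1[OF fin])
        show "y e = x e" if "x \<in> ?X" "y \<in> ?X" "e \<in> E" for x y e
          using eq[OF that(1,3)] eq[OF that(2,3)] by simp
      qed blast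
    qed (intro prod_nonneg p_nn)
    finally show "(\<Sum>x\<in>?X. ?P x / ?c x) \<le> (\<Prod>e\<in>E. p e (f e)) * 1" .
  qed
  also have "\<dots> = 1 - (\<Prod>e\<in>E. p e (t0 e))"
    using total finT t0T by (simp add: sum_diff1)
  finally have S: "(\<Sum>x\<in>\<Omega>. ?P x / ?c x) \<le> 1 - \<delta> ^ card E" using t0p by linarith
  have "cond_entropy \<Omega> E {} - (\<Sum>e\<in>E. cond_entropy \<Omega> {e} {}) = (\<Sum>x\<in>\<Omega>. log 2 (?N * (?P x / ?c x)))"
  proof -
    have "(\<Sum>e\<in>E. cond_entropy \<Omega> {e} {}) = (\<Sum>x\<in>\<Omega>. \<Sum>e\<in>E. log 2 (?N / real (card (cell \<Omega> {e} x))))"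
      unfolding cond_entropy_def by (subst sum.swap) simp
    also have "\<dots> = (\<Sum>x\<in>\<Omega>. - log 2 (?P x))"
    proof (rule sum.cong[OF HOL.refl])
      fix x assume x: "x \<in> \<Omega>"
      have "(\<Sum>e\<in>E. log 2 (p e (x e))) = log 2 (?P x)"
        using finE
      proof induction
        case (insert a F)
        have "0 < (\<Prod>e\<in>F. p e (x e))" using p_pos[OF x] by (intro prod_pos) auto
        then show ?case using insert log_mult_pos[OF p_pos[OF x, of a], of _ 2] by simp
      qed simp
      moreover have "log 2 (?N / real (card (cell \<Omega> {e} x))) = - log 2 (p e (x e))" for e
        using card_cell_pos[OF fin x, of "{e}"] N by (simp add: p_def cell1 log_divide)
      ultimately show "(\<Sum>e\<in>E. log 2 (?N / real (card (cell \<Omega> {e} x)))) = - log 2 (?P x)"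
        by (simp add: sum_negf)
    qed
    finally have 1: "(\<Sum>e\<in>E. cond_entropy \<Omega> {e} {}) = (\<Sum>x\<in>\<Omega>. - log 2 (?P x))" .
    show ?thesis
      unfolding 1 unfolding cond_entropy_def sum_subtractf[symmetric]
    proof (rule sum.cong[OF HOL.refl])
      fix x assume x: "x \<in> \<Omega>"
      show "log 2 (real (card (cell \<Omega> {} x)) / real (card (cell \<Omega> (E \<union> {}) x))) - - log 2 (?P x) =
            log 2 (?N * (?P x / ?c x))"
        using N Ppos[OF x] cpos[OF x] by (simp add: log_mult log_divide)
    qed
  qed
  also have "\<dots> \<le> (\<Sum>x\<in>\<Omega>. (?N * (?P x / ?c x) - 1) / ln 2)"
    using N cpos Ppos by (intro sum_mono log2_le_diff) (meson divide_pos_pos mult_pos_pos)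
  also have "\<dots> = ?N * ((\<Sum>x\<in>\<Omega>. ?P x / ?c x) - 1) / ln 2"
    by (simp add: sum_divide_distrib[symmetric] sum_subtractf sum_distrib_left[symmetric] algebra_simps
        del: times_divide_eq_right)
  also have "\<dots> \<le> ?N * (- (\<delta> ^ card E)) / ln 2"
    using S N by (intro divide_right_mono mult_left_mono) auto
  finally show False using tc by simp
qed

section \<open>Boxes, Turan densities and supersaturation\<close>

lemma card_nsets_supersets:
  assumes fin: "finite V" and e: "e \<subseteq> V" "card e \<le> m"
  shows "card {M \<in> [V]\<^bsup>m\<^esup>. e \<subseteq> M} = (card V - card e) choose (m - card e)"
proof -
  have fe: "finite e" using e fin finite_subset by blast
  have "bij_betw (\<lambda>M. M - e) {M \<in> [V]\<^bsup>m\<^esup>. e \<subseteq> M} (nsets (V - e) (m - card e))"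
  proof (rule bij_betw_byWitness[where f' = "\<lambda>M. M \<union> e"])
    show "(\<lambda>M. M - e) ` {M \<in> [V]\<^bsup>m\<^esup>. e \<subseteq> M} \<subseteq> nsets (V - e) (m - card e)"
      using fe by (auto simp: nsets_def card_Diff_subset)
    show "(\<lambda>M. M \<union> e) ` (nsets (V - e) (m - card e)) \<subseteq> {M \<in> [V]\<^bsup>m\<^esup>. e \<subseteq> M}"
    proof (clarsimp simp: nsets_def)
      fix N assume N: "N \<subseteq> V - e" "finite N" "card N = m - card e"
      have "card (N \<union> e) = card N + card e" using N fe by (intro card_Un_disjoint) auto
      then show "N \<subseteq> V \<and> e \<subseteq> V \<and> finite e \<and> card (N \<union> e) = m" using N e fe by auto
    qed
  qed (auto simp: nsets_def)
  then have "card {M \<in> [V]\<^bsup>m\<^esup>. e \<subseteq> M} = card (nsets (V - e) (m - card e))"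
    by (rule bij_betw_same_card)
  then show ?thesis using fin fe e by (simp add: card_Diff_subset)
qed

lemma sum_nsets_nsets:
  fixes f :: "'a set \<Rightarrow> real"
  assumes fin: "finite V" and km: "k \<le> m"
  shows "(\<Sum>M\<in>[V]\<^bsup>m\<^esup>. \<Sum>e\<in>[M]\<^bsup>k\<^esup>. f e) =
    real ((card V - k) choose (m - k)) * (\<Sum>e\<in>[V]\<^bsup>k\<^esup>. f e)"
proof -
  have fk: "finite ([V]\<^bsup>j\<^esup>)" for j using fin by (rule finite_imp_finite_nsets)
  have "(\<Sum>M\<in>[V]\<^bsup>m\<^esup>. \<Sum>e\<in>[M]\<^bsup>k\<^esup>. f e) = (\<Sum>M\<in>[V]\<^bsup>m\<^esup>. \<Sum>e\<in>[V]\<^bsup>k\<^esup>. if e \<subseteq> M then f e else 0)"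
  proof (rule sum.cong[OF HOL.refl])
    fix M assume "M \<in> [V]\<^bsup>m\<^esup>"
    then have "[M]\<^bsup>k\<^esup> = {e \<in> [V]\<^bsup>k\<^esup>. e \<subseteq> M}" by (auto simp: nsets_def)
    then show "(\<Sum>e\<in>[M]\<^bsup>k\<^esup>. f e) = (\<Sum>e\<in>[V]\<^bsup>k\<^esup>. if e \<subseteq> M then f e else 0)"
      by (simp only: sum.inter_filter[OF fk])
  qed
  also have "\<dots> = (\<Sum>e\<in>[V]\<^bsup>k\<^esup>. \<Sum>M\<in>[V]\<^bsup>m\<^esup>. if e \<subseteq> M then f e else 0)"
    by (rule sum.swap)
  also have "\<dots> = (\<Sum>e\<in>[V]\<^bsup>k\<^esup>. real ((card V - k) choose (m - k)) * f e)"
  proof (rule sum.cong[OF HOL.refl])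
    fix e assume e: "e \<in> [V]\<^bsup>k\<^esup>"
    have "(\<Sum>M\<in>[V]\<^bsup>m\<^esup>. if e \<subseteq> M then f e else 0) = (\<Sum>M\<in>{M \<in> [V]\<^bsup>m\<^esup>. e \<subseteq> M}. f e)"
      by (rule sum.inter_filter[OF fk, symmetric])
    also have "\<dots> = real (card {M \<in> [V]\<^bsup>m\<^esup>. e \<subseteq> M}) * f e" by simp
    also have "card {M \<in> [V]\<^bsup>m\<^esup>. e \<subseteq> M} = (card V - k) choose (m - k)"
      using card_nsets_supersets[OF fin, of e m] e km by (auto simp: nsets_def)
    finally show "(\<Sum>M\<in>[V]\<^bsup>m\<^esup>. if e \<subseteq> M then f e else 0) = real ((card V - k) choose (m - k)) * f e" .
  qed
  finally show ?thesis by (simp add: sum_distrib_left)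
qed

section \<open>Boxes in dense sets of lists\<close>

definition box :: "'a list \<Rightarrow> 'a list \<Rightarrow> 'a list set" where
  "box xs ys = {zs. length zs = length xs \<and> (\<forall>i<length xs. zs ! i = xs ! i \<or> zs ! i = ys ! i)}"

text \<open>Erdos's theorem on complete \<open>s\<close>-partite hypergraphs with parts of size two,
  for ordered tuples. Averaging yields two first entries \<open>u\<close> and \<open>u'\<close>
  whose common tails have density at least \<open>\<rho>\<^sup>2 / 2\<close>; a box of tails, by
  induction, extends by \<open>u\<close> and \<open>u'\<close>.\<close>

lemma dense_contains_box:
  "0 < \<rho> \<Longrightarrow> \<exists>r0. \<forall>(V::'a set) P. finite V \<and> r0 \<le> card V \<and> P \<subseteq> {zs. set zs \<subseteq> V \<and> length zs = s} \<and>
      \<rho> * real (card V) ^ s \<le> real (card P) \<longrightarrow>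
      (\<exists>xs ys. length xs = s \<and> length ys = s \<and> (\<forall>i<s. xs ! i \<noteq> ys ! i) \<and> box xs ys \<subseteq> P)"
proof (induction s arbitrary: \<rho>)
  case 0
  show ?case
  proof (intro exI[of _ 0] allI impI; elim conjE)
    fix V :: "'a set" and P :: "'a list set"
    assume P: "P \<subseteq> {zs. set zs \<subseteq> V \<and> length zs = 0}" and c: "\<rho> * real (card V) ^ 0 \<le> real (card P)"
    have "P \<noteq> {}" using c 0 by auto
    then obtain zs where zs: "zs \<in> P" by blast
    have "zs = []" using zs P by auto
    then have "[] \<in> P" using zs by simp
    then show "\<exists>xs ys. length xs = 0 \<and> length ys = 0 \<and> (\<forall>i<0. xs ! i \<noteq> ys ! i) \<and> box xs ys \<subseteq> P"
      by (auto simp: box_def)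
  qed
next
  case (Suc s)
  have "0 < \<rho>\<^sup>2 / 2" using Suc.prems by simp
  from Suc.IH[OF this] obtain r1 where "\<forall>(V::'a set) P. finite V \<and> r1 \<le> card V \<and>
      P \<subseteq> {zs. set zs \<subseteq> V \<and> length zs = s} \<and> \<rho>\<^sup>2 / 2 * real (card V) ^ s \<le> real (card P) \<longrightarrow>
      (\<exists>xs ys. length xs = s \<and> length ys = s \<and> (\<forall>i<s. xs ! i \<noteq> ys ! i) \<and> box xs ys \<subseteq> P)" ..
  note r1 = this[rule_format, OF conjI, OF _ conjI, OF _ _ conjI]
  show ?case
  proof (intro exI[of _ "max r1 (nat \<lceil>2 / \<rho>\<rceil> + 1)"] allI impI; elim conjE)
    fix V :: "'a set" and P :: "'a list set"
    assume fin: "finite V" and big: "max r1 (nat \<lceil>2 / \<rho>\<rceil> + 1) \<le> card V"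
      and P: "P \<subseteq> {zs. set zs \<subseteq> V \<and> length zs = Suc s}" and c: "\<rho> * real (card V) ^ Suc s \<le> real (card P)"
    let ?N = "real (card V)"
    have "2 / \<rho> \<le> real_of_int \<lceil>2 / \<rho>\<rceil>" by (rule le_of_int_ceiling)
    also have "\<dots> \<le> ?N" using big by linarith
    finally have N2: "2 \<le> \<rho> * ?N" using Suc.prems by (simp add: field_simps)
    have N0: "0 < ?N" using big by linarith
    define L where "L = {zs. set zs \<subseteq> V \<and> length zs = s}"
    have finL: "finite L" and cardL: "real (card L) = ?N ^ s"
      using fin by (auto simp: L_def finite_lists_length_eq card_lists_length_eq)
    define F where "F y = {u \<in> V. u # y \<in> P}" for y
    define D where "D = {(u, u'). u \<in> V \<and> u' \<in> V \<and> u \<noteq> u'}"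
    define G where "G = (\<lambda>(u, u'). {y \<in> L. u # y \<in> P \<and> u' # y \<in> P})"
    have DV: "D \<subseteq> V \<times> V" by (auto simp: D_def)
    have finD: "finite D" using DV fin finite_subset by blast
    have cardD: "real (card D) \<le> ?N\<^sup>2"
      using card_mono[OF _ DV] fin by (simp add: card_cartesian_product power2_eq_square flip: of_nat_mult)
    have finF: "finite (F y)" for y using fin by (auto simp: F_def)
    have "P = (\<Union>y\<in>L. (\<lambda>u. u # y) ` F y)"
    proof (intro subset_antisym subsetI)
      fix zs assume zs: "zs \<in> P"
      then obtain u y where "zs = u # y" using P by (auto simp: length_Suc_conv)
      then show "zs \<in> (\<Union>y\<in>L. (\<lambda>u. u # y) ` F y)"
        using zs P by (force simp: L_def F_def)
    qed (auto simp: F_def)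
    then have "card P = card (\<Union>y\<in>L. (\<lambda>u. u # y) ` F y)" by simp
    also have "\<dots> = (\<Sum>y\<in>L. card ((\<lambda>u. u # y) ` F y))"
      using finL finF by (intro card_UN_disjoint) auto
    also have "\<dots> = (\<Sum>y\<in>L. card (F y))" by (intro sum.cong HOL.refl card_image) (auto simp: inj_on_def)
    finally have cardP: "real (card P) = (\<Sum>y\<in>L. real (card (F y)))" by simp
    have pairs: "card {p \<in> D. y \<in> G p} = card (F y) * card (F y) - card (F y)" if y: "y \<in> L" for y
    proof -
      have "{p \<in> D. y \<in> G p} = F y \<times> F y - (\<lambda>u. (u, u)) ` F y"
        using y by (auto simp: D_def G_def F_def)
      then have "card {p \<in> D. y \<in> G p} = card (F y \<times> F y) - card ((\<lambda>u. (u, u)) ` F y)"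
        using finF by (simp only:) (intro card_Diff_subset, auto)
      then show ?thesis by (simp add: card_cartesian_product card_image inj_on_def)
    qed
    have "(\<Sum>p\<in>D. card (G p)) = (\<Sum>p\<in>D. \<Sum>y\<in>L. if y \<in> G p then 1 else 0)"
    proof (rule sum.cong[OF HOL.refl])
      fix p
      have "L \<inter> G p = G p" by (cases p) (auto simp: G_def)
      then show "card (G p) = (\<Sum>y\<in>L. if y \<in> G p then 1 else 0)"
        using finL by (simp add: sum.If_cases)
    qed
    also have "\<dots> = (\<Sum>y\<in>L. \<Sum>p\<in>D. if y \<in> G p then 1 else 0)" by (rule sum.swap)
    also have "\<dots> = (\<Sum>y\<in>L. card {p \<in> D. y \<in> G p})"
      using finD by (intro sum.cong HOL.refl) (simp add: sum.If_cases Int_def)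
    finally have "real (\<Sum>p\<in>D. card (G p)) = (\<Sum>y\<in>L. real (card {p \<in> D. y \<in> G p}))" by simp
    also have "\<dots> = (\<Sum>y\<in>L. (real (card (F y)))\<^sup>2 - real (card (F y)))"
      using pairs by (intro sum.cong HOL.refl) (simp add: of_nat_diff power2_eq_square)
    finally have sum_G: "(\<Sum>p\<in>D. real (card (G p))) = (\<Sum>y\<in>L. (real (card (F y)))\<^sup>2 - real (card (F y)))"
      by simp
    \<comment> \<open>The tangent of the square at \<open>\<rho> * ?N\<close> replaces
      Cauchy-Schwarz. Pairs with \<open>u = u'\<close> account for the \<open>- 1\<close>, which is
      absorbed because \<open>\<rho> * ?N\<close> is at least 2.\<close>
    have "?N ^ s * (\<rho> * ?N) * (\<rho> * ?N / 2) \<le> ?N ^ s * (\<rho> * ?N) * (\<rho> * ?N - 1)"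
      using N2 by (intro mult_left_mono) auto
    also have "\<dots> = (2 * (\<rho> * ?N) - 1) * (\<rho> * ?N ^ Suc s) - ?N ^ s * (\<rho> * ?N)\<^sup>2"
      by (simp add: power2_eq_square algebra_simps)
    also have "\<dots> \<le> (2 * (\<rho> * ?N) - 1) * real (card P) - ?N ^ s * (\<rho> * ?N)\<^sup>2"
      using c N2 by (intro diff_mono mult_left_mono) auto
    also have "\<dots> = (\<Sum>y\<in>L. (2 * (\<rho> * ?N) - 1) * real (card (F y)) - (\<rho> * ?N)\<^sup>2)"
      by (simp add: sum_subtractf sum_distrib_left[symmetric] cardP cardL)
    also have "\<dots> \<le> (\<Sum>p\<in>D. real (card (G p)))"
      unfolding sum_G
    proof (rule sum_mono)
      fix y
      have "0 \<le> (real (card (F y)) - \<rho> * ?N)\<^sup>2" by simp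
      then show "(2 * (\<rho> * ?N) - 1) * real (card (F y)) - (\<rho> * ?N)\<^sup>2 \<le> (real (card (F y)))\<^sup>2 - real (card (F y))"
        by (simp add: power2_eq_square algebra_simps)
    qed
    finally have big_sum: "?N ^ s * (\<rho> * ?N) * (\<rho> * ?N / 2) \<le> (\<Sum>p\<in>D. real (card (G p)))" .
    have "\<exists>p\<in>D. \<rho>\<^sup>2 / 2 * ?N ^ s \<le> real (card (G p))"
    proof (rule ccontr)
      assume no: "\<not> ?thesis"
      have pos: "0 < ?N ^ s * (\<rho> * ?N) * (\<rho> * ?N / 2)" using N0 N2 Suc.prems by simp
      then have "D \<noteq> {}" using big_sum by auto
      then have "(\<Sum>p\<in>D. real (card (G p))) < (\<Sum>p\<in>D. \<rho>\<^sup>2 / 2 * ?N ^ s)"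
        using no finD by (intro sum_strict_mono) auto
      also have "\<dots> = real (card D) * (\<rho>\<^sup>2 / 2 * ?N ^ s)" by simp
      also have "\<dots> \<le> ?N\<^sup>2 * (\<rho>\<^sup>2 / 2 * ?N ^ s)"
        using cardD by (intro mult_right_mono) auto
      also have "\<dots> = ?N ^ s * (\<rho> * ?N) * (\<rho> * ?N / 2)" by (simp add: power2_eq_square)
      finally show False using big_sum by simp
    qed
    then obtain u u' where uu: "u \<in> V" "u' \<in> V" "u \<noteq> u'" "\<rho>\<^sup>2 / 2 * ?N ^ s \<le> real (card (G (u, u')))"
      by (auto simp: D_def)
    have "r1 \<le> card V" using big by simp
    moreover have "G (u, u') \<subseteq> {zs. set zs \<subseteq> V \<and> length zs = s}" by (auto simp: G_def L_def)
    ultimately obtain xs ys where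
      xy: "length xs = s" "length ys = s" "\<forall>i<s. xs ! i \<noteq> ys ! i" "box xs ys \<subseteq> G (u, u')"
      using r1[OF fin _ _ uu(4)] by blast
    show "\<exists>xs ys. length xs = Suc s \<and> length ys = Suc s \<and> (\<forall>i<Suc s. xs ! i \<noteq> ys ! i) \<and> box xs ys \<subseteq> P"
    proof (rule exI[of _ "u # xs"], rule exI[of _ "u' # ys"], intro conjI)
      show "\<forall>i<Suc s. (u # xs) ! i \<noteq> (u' # ys) ! i"
        using xy(3) uu(3) by (auto simp: less_Suc_eq_0_disj)
      show "box (u # xs) (u' # ys) \<subseteq> P"
      proof
        fix zs assume z: "zs \<in> box (u # xs) (u' # ys)"
        then obtain z zt where zs: "zs = z # zt" by (auto simp: box_def length_Suc_conv)
        have h: "z = u \<or> z = u'" using z zs by (auto simp: box_def)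
        have "zt \<in> box xs ys" using z zs by (fastforce simp: box_def)
        then have "zt \<in> G (u, u')" using xy(4) by blast
        then show "zs \<in> P" using h zs by (auto simp: G_def)
      qed
    qed (use xy in auto)
  qed
qed

lemma dense_union_contains_box:
  assumes "0 < \<rho>" and finT: "finite \<T>"
  shows "\<exists>r0. \<forall>(V::'a set) Q. finite V \<and> r0 \<le> card V \<and> (\<forall>\<tau>\<in>\<T>. Q \<tau> \<subseteq> {zs. set zs \<subseteq> V \<and> length zs = s}) \<and>
      \<rho> * real (card V) ^ s \<le> real (card (\<Union>\<tau>\<in>\<T>. Q \<tau>)) \<longrightarrow>
      (\<exists>\<tau>\<in>\<T>. \<exists>xs ys. length xs = s \<and> length ys = s \<and> (\<forall>i<s. xs ! i \<noteq> ys ! i) \<and> box xs ys \<subseteq> Q \<tau>)"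
proof -
  \<comment> \<open>Pigeonhole over the types; the \<open>+ 1\<close> makes the final comparison
    strict and covers an empty set of types.\<close>
  define \<rho>' where "\<rho>' = \<rho> / (real (card \<T>) + 1)"
  have "0 < \<rho>'" using assms by (simp add: \<rho>'_def)
  from dense_contains_box[OF this, of s] obtain r0 where "\<forall>(V::'a set) P. finite V \<and> r0 \<le> card V \<and>
      P \<subseteq> {zs. set zs \<subseteq> V \<and> length zs = s} \<and> \<rho>' * real (card V) ^ s \<le> real (card P) \<longrightarrow>
      (\<exists>xs ys. length xs = s \<and> length ys = s \<and> (\<forall>i<s. xs ! i \<noteq> ys ! i) \<and> box xs ys \<subseteq> P)" ..
  note r0 = this[rule_format, OF conjI, OF _ conjI, OF _ _ conjI]
  show ?thesis
  proof (intro exI[of _ "max r0 1"] allI impI; elim conjE)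
    fix V :: "'a set" and Q
    assume fin: "finite V" and big: "max r0 1 \<le> card V"
      and Q: "\<forall>\<tau>\<in>\<T>. Q \<tau> \<subseteq> {zs. set zs \<subseteq> V \<and> length zs = s}"
      and c: "\<rho> * real (card V) ^ s \<le> real (card (\<Union>\<tau>\<in>\<T>. Q \<tau>))"
    have "\<exists>\<tau>\<in>\<T>. \<rho>' * real (card V) ^ s \<le> real (card (Q \<tau>))"
    proof (rule ccontr)
      assume no: "\<not> ?thesis"
      have pos: "0 < real (card V) ^ s" using big by auto
      have "real (card (\<Union>\<tau>\<in>\<T>. Q \<tau>)) \<le> (\<Sum>\<tau>\<in>\<T>. real (card (Q \<tau>)))"
        using card_UN_le[OF finT, of Q] by (simp flip: of_nat_sum)
      also have "\<dots> \<le> (\<Sum>\<tau>\<in>\<T>. \<rho>' * real (card V) ^ s)"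
        using no by (intro sum_mono) (auto simp: not_le less_imp_le)
      also have "\<dots> = real (card \<T>) * \<rho>' * real (card V) ^ s" by simp
      also have "\<dots> < \<rho> * real (card V) ^ s"
        using pos assms(1) by (intro mult_strict_right_mono) (auto simp: \<rho>'_def field_simps)
      finally show False using c by simp
    qed
    then obtain \<tau> where t: "\<tau> \<in> \<T>" "\<rho>' * real (card V) ^ s \<le> real (card (Q \<tau>))" by blast
    moreover have "r0 \<le> card V" using big by simp
    moreover have "Q \<tau> \<subseteq> {zs. set zs \<subseteq> V \<and> length zs = s}" using Q t by blast
    ultimately show "\<exists>\<tau>\<in>\<T>. \<exists>xs ys. length xs = s \<and> length ys = s \<and> (\<forall>i<s. xs ! i \<noteq> ys ! i) \<and> box xs ys \<subseteq> Q \<tau>"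
      using r0[OF fin _ _ t(2)] by blast
  qed
qed

section \<open>Turan density and supersaturation for \<open>T_pdg k\<close>\<close>

fun edge_weight :: "real \<Rightarrow> 'a edge_status \<Rightarrow> real" where
  "edge_weight \<theta> No_Edge = 0"
| "edge_weight \<theta> Undirected = 1"
| "edge_weight \<theta> (Directed v) = \<theta>"

lemma density_eq_sum_weight:
  assumes "is_kpdg k H"
  shows "undirected_density k H + \<theta> * directed_density k H =
    (\<Sum>e\<in>[verts H]\<^bsup>k\<^esup>. edge_weight \<theta> (edge H e)) / real (card (verts H) choose k)"
proof -
  let ?E = "[verts H]\<^bsup>k\<^esup>"
  have fin: "finite (verts H)" and sub: "\<And>S. edge H S \<noteq> No_Edge \<Longrightarrow> S \<in> ?E"
    using assms by (auto simp: is_kpdg_def nsets_def intro: finite_subset)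
  have finE: "finite ?E" by (rule finite_imp_finite_nsets[OF fin])
  have "edge_weight \<theta> x = (if x = Undirected then 1 else 0) + \<theta> * (if \<exists>v. x = Directed v then 1 else 0)"
    for x :: "'a edge_status"
    by (cases x) auto
  then have "(\<Sum>e\<in>?E. edge_weight \<theta> (edge H e)) =
      (\<Sum>e\<in>?E. if edge H e = Undirected then 1 else 0) + \<theta> * (\<Sum>e\<in>?E. if \<exists>v. edge H e = Directed v then 1 else 0)"
    by (simp add: sum.distrib sum_distrib_left)
  moreover have "(\<Sum>e\<in>?E. if edge H e = Undirected then 1 else 0) = real (card {S. edge H S = Undirected})"
  proof -
    have "?E \<inter> {e. edge H e = Undirected} = {S. edge H S = Undirected}" using sub by auto
    then show ?thesis using finE by (simp add: sum.If_cases)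
  qed
  moreover have "(\<Sum>e\<in>?E. if \<exists>v. edge H e = Directed v then 1 else 0) = real (card {S. \<exists>v. edge H S = Directed v})"
  proof -
    have "?E \<inter> {e. \<exists>v. edge H e = Directed v} = {S. \<exists>v. edge H S = Directed v}" using sub by auto
    then show ?thesis using finE by (simp add: sum.If_cases)
  qed
  ultimately show ?thesis
    by (simp add: undirected_density_def directed_density_def add_divide_distrib)
qed

lemma obtainable_from_edge:
  assumes "obtainable_from H G"
  shows "verts G \<subseteq> verts H \<and> (\<forall>S. edge G S \<noteq> No_Edge \<longrightarrow> edge H S \<noteq> No_Edge) \<and>
    (\<forall>S v. edge G S = Directed v \<longrightarrow> edge H S = Directed v)"
  using assms by induction (auto split: if_splits)

text \<open>An ordered copy of \<open>T_pdg k\<close>; the vertex \<open>i + 1\<close> of \<open>T_pdg k\<close> sits at position \<open>i\<close>.\<close>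

definition T_lists :: "nat \<Rightarrow> ('a set \<Rightarrow> 'a edge_status) \<Rightarrow> 'a set \<Rightarrow> 'a list set" where
  "T_lists k st V = {vs. length vs = k + 1 \<and> distinct vs \<and> set vs \<subseteq> V \<and>
     st ((!) vs ` {0..<k}) \<noteq> No_Edge \<and> st ((!) vs ` {1..k}) \<noteq> No_Edge \<and>
     st ((!) vs ` insert k {0..<k-1}) = Directed (vs ! k)}"

text \<open>Used in contrapositive form, to show that a graph without ordered copies is
  \<open>T_pdg k\<close>-free. The permitted operations never create an edge or a direction; as
  directions may be forgotten, \<open>T_lists\<close> accepts any kind of edge in the two undirected
  places.\<close>

lemma T_pdg_subgraph_imp_T_list:
  assumes sub: "pdg_subgraph (T_pdg k) H" and k: "k \<ge> 2"
  shows "T_lists k (edge H) (verts H) \<noteq> {}"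
proof -
  obtain G f where G: "obtainable_from H G" and bij: "bij_betw f {1..k+1} (verts G)"
    and f: "\<And>S. S \<subseteq> {1..k+1} \<Longrightarrow> edge G (f ` S) = map_edge_status f (edge (T_pdg k) S)"
    using sub unfolding pdg_subgraph_def pdg_isomorphic_def by (auto simp: T_pdg_def)
  note HG = obtainable_from_edge[OF G]
  define vs where "vs = map f [1..<k+2]"
  have len: "length vs = k + 1" by (simp add: vs_def)
  have inj: "inj_on f {1..k+1}" using bij by (rule bij_betw_imp_inj_on)
  have upt: "set [1..<k+2] = {1..k+1}" by auto
  have setvs: "set vs = verts G"
    unfolding vs_def set_map upt using bij_betw_imp_surj_on[OF bij] .
  have dist: "distinct vs" using inj unfolding vs_def distinct_map upt by simp
  have nth: "vs ! i = f (Suc i)" if "i \<le> k" for i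
    unfolding vs_def using that by (subst nth_map) (auto simp: nth_append simp del: upt_Suc)
  have img: "(!) vs ` I = f ` (Suc ` I)" if "I \<subseteq> {0..k}" for I
    unfolding image_image using that nth by (intro image_cong) auto
  have s1: "Suc ` {0..<k} = {1..k}" and s2: "Suc ` {1..k} = {2..k+1}"
    and s3: "Suc ` insert k {0..<k-1} = insert (k+1) {1..k-1}"
    using k by (auto simp: image_Suc_atLeastLessThan image_Suc_atLeastAtMost atLeastLessThanSuc_atLeastAtMost)
  \<comment> \<open>The vertices \<open>k\<close> and 1 separate the third edge from the other two,
    so the conditional in \<open>T_pdg\<close> does reach its directed branch.\<close>
  have "k \<in> {1..k}" "k \<notin> insert (k+1) {1..k-1}" "1 \<in> insert (k+1) {1..k-1}" "1 \<notin> {2..k+1}"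
    using k by auto
  then have n1: "insert (k+1) {1..k-1} \<noteq> {1..k}" "insert (k+1) {1..k-1} \<noteq> {2..k+1}"
    by metis+
  have edge_G: "edge G ((!) vs ` I) = map_edge_status f (edge (T_pdg k) (Suc ` I))" if "I \<subseteq> {0..k}" for I
    unfolding img[OF that] using that by (intro f) auto
  have "edge G ((!) vs ` {0..<k}) \<noteq> No_Edge"
    by (subst edge_G, fastforce, unfold s1) (simp add: T_pdg_def)
  moreover have "edge G ((!) vs ` {1..k}) \<noteq> No_Edge"
    by (subst edge_G, fastforce, unfold s2) (simp add: T_pdg_def)
  moreover have "edge G ((!) vs ` insert k {0..<k-1}) = Directed (vs ! k)"
  proof -
    have "edge G ((!) vs ` insert k {0..<k-1}) = map_edge_status f (edge (T_pdg k) (insert (k+1) {1..k-1}))"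
      by (subst edge_G, fastforce, unfold s3) (rule HOL.refl)
    also have "edge (T_pdg k) (insert (k+1) {1..k-1}) = Directed (k+1)"
      using n1 by (simp add: T_pdg_def)
    finally show ?thesis using nth[of k] by simp
  qed
  ultimately have "vs \<in> T_lists k (edge H) (verts H)"
    using HG len dist setvs by (auto simp: T_lists_def)
  then show ?thesis by blast
qed

lemma edge_weight_bounds: "0 \<le> \<theta> \<Longrightarrow> 0 \<le> edge_weight \<theta> x \<and> edge_weight \<theta> x \<le> 1 + \<theta>"
  by (cases x) auto

lemma sum_edge_weight_le:
  assumes "finite V" "0 \<le> \<theta>"
  shows "(\<Sum>e\<in>[V]\<^bsup>k\<^esup>. edge_weight \<theta> (f e)) \<le> (1 + \<theta>) * real (card V choose k)"
proof -
  have "(\<Sum>e\<in>[V]\<^bsup>k\<^esup>. edge_weight \<theta> (f e)) \<le> (\<Sum>e\<in>[V]\<^bsup>k\<^esup>. 1 + \<theta>)"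
    using assms edge_weight_bounds by (intro sum_mono) auto
  then show ?thesis using assms by (simp add: mult.commute)
qed

text \<open>A \<open>LEAST\<close> over the reals is meaningful only if a minimum exists. The
  infimum \<open>c\<close> of all bounds is itself a bound, with the positive part of
  \<open>M n - c\<close> as error sequence, where \<open>M n\<close> is the supremum on
  \<open>n\<close> vertices.\<close>

lemma turan_density_T_pdg:
  fixes k :: nat and \<theta> :: real
  assumes k: "k \<ge> 2" and th: "0 \<le> \<theta>"
  defines "\<pi> \<equiv> turan_density k (T_pdg k) \<theta>"
  shows turan_density_nonneg: "0 \<le> \<pi>"
    and turan_density_eventually: "0 < \<epsilon> \<Longrightarrow> \<exists>m0. \<forall>m\<ge>m0. \<forall>H :: nat pdg.
      is_kpdg k H \<and> card (verts H) = m \<and> \<not> pdg_subgraph (T_pdg k) H \<longrightarrow>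
      undirected_density k H + \<theta> * directed_density k H \<le> \<pi> + \<epsilon>"
proof -
  let ?v = "\<lambda>H :: nat pdg. undirected_density k H + \<theta> * directed_density k H"
  let ?B = "turan_bound k (T_pdg k) \<theta>"
  define vals where "vals n = ?v ` {H. is_kpdg k H \<and> card (verts H) = n \<and> \<not> pdg_subgraph (T_pdg k) H}" for n
  have ub: "v \<le> 1 + \<theta>" if "v \<in> vals n" for v n
  proof -
    obtain H :: "nat pdg" where H: "is_kpdg k H" and v: "v = ?v H" using \<open>v \<in> vals n\<close> by (auto simp: vals_def)
    have fin: "finite (verts H)" using H by (simp add: is_kpdg_def)
    show ?thesis
      unfolding v density_eq_sum_weight[OF H]
      using sum_edge_weight_le[OF fin th, where k = k and f = "edge H"] th
      by (cases "card (verts H) choose k = 0") (auto simp: divide_le_eq)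
  qed
  \<comment> \<open>The edgeless graph bounds every admissible \<open>c\<close> below by 0 and makes
    each supremum one over a nonempty set.\<close>
  have zero: "0 \<in> vals n" for n
  proof -
    define H :: "nat pdg" where "H = \<lparr>verts = {..<n}, edge = (\<lambda>_. No_Edge)\<rparr>"
    have "is_kpdg k H" "card (verts H) = n" by (auto simp: H_def is_kpdg_def)
    moreover have "\<not> pdg_subgraph (T_pdg k) H"
      using T_pdg_subgraph_imp_T_list[OF _ k, of H] by (auto simp: H_def T_lists_def)
    moreover have "?v H = 0" by (simp add: H_def undirected_density_def directed_density_def)
    ultimately show ?thesis unfolding vals_def by force
  qed
  have bound_iff: "?B c \<longleftrightarrow> (\<exists>\<epsilon>. \<epsilon> \<longlonglongrightarrow> 0 \<and> (\<forall>n. \<forall>v\<in>vals n. v \<le> c + \<epsilon> n))" for c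
    unfolding turan_bound_def vals_def by auto
  have ge0: "0 \<le> c" if B: "?B c" for c
  proof -
    obtain \<epsilon> where e: "\<epsilon> \<longlonglongrightarrow> 0" "\<And>n v. v \<in> vals n \<Longrightarrow> v \<le> c + \<epsilon> n" using B by (auto simp: bound_iff)
    have "(\<lambda>n. c + \<epsilon> n) \<longlonglongrightarrow> c + 0" by (intro tendsto_add tendsto_const e)
    then have "0 \<le> c + 0" by (rule LIMSEQ_le_const) (use e(2)[OF zero] in blast)
    then show ?thesis by simp
  qed
  have "?B (1 + \<theta>)" unfolding bound_iff by (rule exI[of _ "\<lambda>_. 0"]) (use ub in auto)
  then have ne: "Collect ?B \<noteq> {}" by blast
  have bdd: "bdd_below (Collect ?B)" by (rule bdd_belowI[of _ 0]) (use ge0 in simp)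
  define c where "c = Inf (Collect ?B)"
  define M where "M n = Sup (vals n)" for n
  have bddv: "bdd_above (vals n)" for n by (rule bdd_aboveI[of _ "1 + \<theta>"]) (rule ub)
  have lim: "(\<lambda>n. max 0 (M n - c)) \<longlonglongrightarrow> 0"
  proof (rule LIMSEQ_I)
    fix \<delta> :: real assume d: "0 < \<delta>"
    \<comment> \<open>A bound \<open>b\<close> slightly above the infimum controls
      \<open>M n\<close> up to its own vanishing error.\<close>
    obtain b where b: "?B b" "b < c + \<delta> / 2"
      using cInf_lessD[OF ne, of "c + \<delta> / 2"] d by (auto simp: c_def)
    obtain \<epsilon> where e: "\<epsilon> \<longlonglongrightarrow> 0" "\<And>n v. v \<in> vals n \<Longrightarrow> v \<le> b + \<epsilon> n" using b by (auto simp: bound_iff)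
    have d2: "0 < \<delta> / 2" using d by simp
    from LIMSEQ_D[OF e(1) d2] obtain N where N: "\<And>n. n \<ge> N \<Longrightarrow> \<bar>\<epsilon> n\<bar> < \<delta> / 2" by auto
    have "norm (max 0 (M n - c) - 0) < \<delta>" if "n \<ge> N" for n
    proof -
      have "vals n \<noteq> {}" using zero[of n] by blast
      then have "M n \<le> b + \<epsilon> n" unfolding M_def by (rule cSup_least) (rule e(2))
      then show ?thesis using N[OF that] b d by auto
    qed
    then show "\<exists>N. \<forall>n\<ge>N. norm (max 0 (M n - c) - 0) < \<delta>" by blast
  qed
  have le_M: "v \<le> c + max 0 (M n - c)" if "v \<in> vals n" for v n
    using cSup_upper[OF that bddv] by (auto simp: M_def)
  have "?B c" unfolding bound_iff using lim le_M by blast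
  then have pi: "\<pi> = c"
    unfolding \<pi>_def turan_density_def
    by (rule Least_equality) (use bdd in \<open>auto simp: c_def intro: cInf_lower\<close>)
  show "0 \<le> \<pi>" using ge0[OF \<open>?B c\<close>] pi by simp
  assume "0 < \<epsilon>"
  from LIMSEQ_D[OF lim this] obtain N where N: "\<And>n. n \<ge> N \<Longrightarrow> max 0 (M n - c) < \<epsilon>" by auto
  show "\<exists>m0. \<forall>m\<ge>m0. \<forall>H :: nat pdg.
      is_kpdg k H \<and> card (verts H) = m \<and> \<not> pdg_subgraph (T_pdg k) H \<longrightarrow> ?v H \<le> \<pi> + \<epsilon>"
  proof (intro exI[of _ N] allI impI)
    fix m and H :: "nat pdg"
    assume "N \<le> m" and H: "is_kpdg k H \<and> card (verts H) = m \<and> \<not> pdg_subgraph (T_pdg k) H"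
    have "?v H \<in> vals m" unfolding vals_def using H by blast
    then show "?v H \<le> \<pi> + \<epsilon>" using le_M[of "?v H" m] N[OF \<open>N \<le> m\<close>] pi by linarith
  qed
qed

text \<open>Averaging over \<open>m\<close>-subsets with \<open>m\<close> fixed: those without a
  copy have weight at most \<open>\<pi> + \<epsilon> / 2\<close>, so excess weight forces a positive
  proportion of them to contain a copy, and each copy lies in only
  \<open>(r - (k+1)) choose (m - (k+1))\<close> of them, where \<open>r = card R\<close>.\<close>

lemma supersaturation:
  fixes k :: nat and \<theta> :: real
  assumes k: "k \<ge> 2" and th: "0 \<le> \<theta>" and eps: "0 < \<epsilon>"
  defines "\<pi> \<equiv> turan_density k (T_pdg k) \<theta>"
  shows "\<exists>\<rho>>0. \<exists>r0. \<forall>(R :: nat set) st. finite R \<and> r0 \<le> card R \<and> (\<forall>e v. st e = Directed v \<longrightarrow> v \<in> e) \<and>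
    (\<pi> + \<epsilon>) * real (card R choose k) < (\<Sum>e\<in>[R]\<^bsup>k\<^esup>. edge_weight \<theta> (st e)) \<longrightarrow>
    \<rho> * real (card R) ^ (k+1) \<le> real (card (T_lists k st R))"
proof -
  have "0 < \<epsilon> / 2" using eps by simp
  from turan_density_eventually[OF k th this] obtain m0 where
    m0: "\<And>m H. m0 \<le> m \<Longrightarrow> is_kpdg k (H :: nat pdg) \<Longrightarrow> card (verts H) = m \<Longrightarrow> \<not> pdg_subgraph (T_pdg k) H \<Longrightarrow>
      undirected_density k H + \<theta> * directed_density k H \<le> \<pi> + \<epsilon> / 2"
    unfolding \<pi>_def by metis
  define m where "m = max m0 (k + 1)"
  have m: "m0 \<le> m" "k + 1 \<le> m" "k \<le> m" by (auto simp: m_def)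
  \<comment> \<open>The factors are the proportion of \<open>m\<close>-sets with a copy, the loss
    from counting a copy in many \<open>m\<close>-sets, and the estimate of
    \<open>r choose (k+1)\<close> from below by \<open>(r / (k+1)) ^ (k+1)\<close>.\<close>
  define \<rho> where "\<rho> = \<epsilon> / (2 * (1 + \<theta>)) / real (m choose (k+1)) / real (k+1) ^ (k+1)"
  have cm: "0 < real (m choose (k+1))" using m by (simp add: zero_less_binomial)
  have "0 < \<rho>" using eps th cm by (simp add: \<rho>_def)
  moreover have "\<rho> * real (card R) ^ (k+1) \<le> real (card (T_lists k st R))"
    if R: "finite R" "m \<le> card R" and st: "\<forall>e v. st e = Directed v \<longrightarrow> v \<in> e"
      and heavy: "(\<pi> + \<epsilon>) * real (card R choose k) < (\<Sum>e\<in>[R]\<^bsup>k\<^esup>. edge_weight \<theta> (st e))"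
    for R :: "nat set" and st
  proof -
    let ?r = "card R"
    let ?w = "\<lambda>e. edge_weight \<theta> (st e)"
    define T where "T = T_lists k st R"
    have "T \<subseteq> {vs. set vs \<subseteq> R \<and> length vs = k + 1}" by (auto simp: T_def T_lists_def)
    then have finT: "finite T" using finite_lists_length_eq[OF R(1)] finite_subset by blast
    define D where "D = {M \<in> [R]\<^bsup>m\<^esup>. \<exists>vs\<in>T. set vs \<subseteq> M}"
    have finR: "finite ([R]\<^bsup>m\<^esup>)" by (rule finite_imp_finite_nsets[OF R(1)])
    have local: "(\<Sum>e\<in>[M]\<^bsup>k\<^esup>. ?w e) \<le> (\<pi> + \<epsilon> / 2) * real (m choose k) +
        (if M \<in> D then (1 + \<theta>) * real (m choose k) else 0)" if M: "M \<in> [R]\<^bsup>m\<^esup>" for M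
    proof -
      have fM: "finite M" and cM: "card M = m" and MR: "M \<subseteq> R" using M by (auto simp: nsets_def)
      show ?thesis
      proof (cases "M \<in> D")
        case True
        have "0 \<le> (\<pi> + \<epsilon> / 2) * real (m choose k)"
          using turan_density_nonneg[OF k th] eps by (simp add: \<pi>_def)
        then show ?thesis using sum_edge_weight_le[OF fM th, where k = k and f = st] True cM by simp
      next
        case False
        \<comment> \<open>\<open>st\<close> is arbitrary off the \<open>k\<close>-subsets of
          \<open>M\<close>; cutting it down there gives a legitimate \<open>k\<close>-PDG.\<close>
        define H :: "nat pdg" where "H = \<lparr>verts = M, edge = (\<lambda>e. if e \<in> [M]\<^bsup>k\<^esup> then st e else No_Edge)\<rparr>"
        have H: "is_kpdg k H" using fM st by (auto simp: H_def is_kpdg_def nsets_def)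
        have "T_lists k (edge H) (verts H) = {}"
        proof -
          have "vs \<in> T \<and> set vs \<subseteq> M" if "vs \<in> T_lists k (edge H) (verts H)" for vs
            using that MR unfolding T_lists_def H_def T_def by (auto split: if_splits)
          then show ?thesis using False M unfolding D_def by blast
        qed
        then have "\<not> pdg_subgraph (T_pdg k) H" using T_pdg_subgraph_imp_T_list[OF _ k] by blast
        then have "undirected_density k H + \<theta> * directed_density k H \<le> \<pi> + \<epsilon> / 2"
          using m0[OF m(1) H] cM by (simp add: H_def)
        moreover have "(\<Sum>e\<in>[verts H]\<^bsup>k\<^esup>. edge_weight \<theta> (edge H e)) = (\<Sum>e\<in>[M]\<^bsup>k\<^esup>. ?w e)"
          by (intro sum.cong) (auto simp: H_def)
        moreover have "0 < real (m choose k)" using m by (simp add: zero_less_binomial)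
        ultimately show ?thesis
          using False cM unfolding density_eq_sum_weight[OF H] by (simp add: H_def divide_le_eq)
      qed
    qed
    define A where "A = real ((?r - k) choose (m - k))"
    define A' where "A' = real ((?r - (k+1)) choose (m - (k+1)))"
    have pos: "0 < A" "0 < A'" "0 < real (m choose k)" "0 < real (?r choose m)"
      using m R by (auto simp: A_def A'_def zero_less_binomial diff_le_mono)
    have mult: "real (?r choose m) * real (m choose k) = real (?r choose k) * A"
      unfolding A_def of_nat_mult[symmetric] using choose_mult[of k m ?r] m R by simp
    have mult': "real (?r choose m) * real (m choose (k+1)) = real (?r choose (k+1)) * A'"
      unfolding A'_def of_nat_mult[symmetric] using choose_mult[of "k+1" m ?r] m R by simp
    have "(\<pi> + \<epsilon>) * (real (?r choose m) * real (m choose k)) = (\<pi> + \<epsilon>) * real (?r choose k) * A"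
      unfolding mult by simp
    also have "\<dots> \<le> (\<Sum>e\<in>[R]\<^bsup>k\<^esup>. ?w e) * A" using heavy pos by (intro mult_right_mono) auto
    also have "\<dots> = (\<Sum>M\<in>[R]\<^bsup>m\<^esup>. \<Sum>e\<in>[M]\<^bsup>k\<^esup>. ?w e)"
      unfolding sum_nsets_nsets[OF R(1) m(3)] A_def by simp
    also have "\<dots> \<le> (\<Sum>M\<in>[R]\<^bsup>m\<^esup>. (\<pi> + \<epsilon> / 2) * real (m choose k) +
        (if M \<in> D then (1 + \<theta>) * real (m choose k) else 0))"
      by (intro sum_mono local)
    also have "\<dots> = real (?r choose m) * ((\<pi> + \<epsilon> / 2) * real (m choose k)) + real (card D) * ((1 + \<theta>) * real (m choose k))"
    proof -
      have "[R]\<^bsup>m\<^esup> \<inter> D = D" by (auto simp: D_def)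
      then show ?thesis using finR R by (simp add: sum.distrib sum.If_cases)
    qed
    finally have "(\<epsilon> / 2 * real (?r choose m)) * real (m choose k) \<le> (real (card D) * (1 + \<theta>)) * real (m choose k)"
      by (simp add: algebra_simps)
    then have 1: "\<epsilon> / 2 * real (?r choose m) \<le> real (card D) * (1 + \<theta>)"
      by (rule mult_right_le_imp_le[OF _ pos(3)])
    have "card D \<le> (\<Sum>vs\<in>T. card {M \<in> [R]\<^bsup>m\<^esup>. set vs \<subseteq> M})"
    proof -
      have "D = (\<Union>vs\<in>T. {M \<in> [R]\<^bsup>m\<^esup>. set vs \<subseteq> M})" by (auto simp: D_def)
      then show ?thesis using card_UN_le[OF finT] by simp
    qed
    also have "\<dots> = (\<Sum>vs\<in>T. (?r - (k+1)) choose (m - (k+1)))"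
    proof (rule sum.cong[OF HOL.refl])
      fix vs assume "vs \<in> T"
      then have "set vs \<subseteq> R" "card (set vs) = k + 1"
        by (auto simp: T_def T_lists_def distinct_card)
      then show "card {M \<in> [R]\<^bsup>m\<^esup>. set vs \<subseteq> M} = (?r - (k+1)) choose (m - (k+1))"
        using card_nsets_supersets[OF R(1), of "set vs" m] m by simp
    qed
    finally have "card D \<le> card T * ((?r - (k+1)) choose (m - (k+1)))" by simp
    then have 2: "real (card D) \<le> real (card T) * A'"
      unfolding A'_def of_nat_mult[symmetric] of_nat_le_iff .
    have "\<epsilon> / 2 * (real (?r choose (k+1)) * A') = \<epsilon> / 2 * real (?r choose m) * real (m choose (k+1))"
      unfolding mult'[symmetric] by simp
    also have "\<dots> \<le> real (card D) * (1 + \<theta>) * real (m choose (k+1))"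
      using 1 by (intro mult_right_mono) auto
    also have "\<dots> \<le> real (card T) * A' * (1 + \<theta>) * real (m choose (k+1))"
      using 2 th by (intro mult_right_mono) auto
    finally have "(\<epsilon> / 2 * real (?r choose (k+1))) * A' \<le> (real (card T) * ((1 + \<theta>) * real (m choose (k+1)))) * A'"
      by (simp only: mult_ac)
    then have 3: "\<epsilon> / 2 * real (?r choose (k+1)) \<le> real (card T) * ((1 + \<theta>) * real (m choose (k+1)))"
      by (rule mult_right_le_imp_le[OF _ pos(2)])
    have "k + 1 \<le> ?r" using m R by linarith
    then have 4: "(real ?r / real (k+1)) ^ (k+1) \<le> real (?r choose (k+1))"
      by (rule binomial_ge_n_over_k_pow_k)
    have pos5: "0 < (1 + \<theta>) * real (m choose (k+1))" using th cm by simp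
    have "\<rho> * real ?r ^ (k+1) = \<epsilon> / 2 * (real ?r / real (k+1)) ^ (k+1) / ((1 + \<theta>) * real (m choose (k+1)))"
      by (simp add: \<rho>_def power_divide mult_ac)
    also have "\<dots> \<le> \<epsilon> / 2 * real (?r choose (k+1)) / ((1 + \<theta>) * real (m choose (k+1)))"
      using 4 eps pos5 by (intro divide_right_mono mult_left_mono) auto
    also have "\<dots> \<le> real (card T)"
      using 3 pos5 by (simp only: divide_le_eq if_True)
    finally show ?thesis by (simp add: T_def)
  qed
  ultimately show ?thesis by blast
qed

section \<open>Irredundant formulas and independent selections\<close>

definition irredundant :: "sat_formula \<Rightarrow> bool" where
  "irredundant \<Phi> \<longleftrightarrow> (\<forall>C\<in>\<Phi>. \<exists>a. (\<forall>l\<in>C. literal_true a l) \<and>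
     (\<forall>C'\<in>\<Phi>. (\<forall>l\<in>C'. literal_true a l) \<longrightarrow> C' = C))"

lemma irredundant_subset: "irredundant \<Phi> \<Longrightarrow> \<Psi> \<subseteq> \<Phi> \<Longrightarrow> irredundant \<Psi>"
  unfolding irredundant_def by (meson subsetD)

section \<open>Clauses as sign patterns along vertex lists\<close>

definition clause_on :: "nat list \<Rightarrow> bool list \<Rightarrow> nat set \<Rightarrow> clause" where
  "clause_on vs bs I = (\<lambda>i. (vs ! i, bs ! i)) ` I"

lemma fst_clause_on: "fst ` clause_on vs bs I = (!) vs ` I"
  by (simp add: clause_on_def image_image)

lemma clause_on_true: "(\<forall>l\<in>clause_on vs bs I. literal_true a l) \<longleftrightarrow> (\<forall>i\<in>I. a (vs ! i) = bs ! i)"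
  by (auto simp: clause_on_def literal_true_def)

lemma clause_on_cong: "(\<And>i. i \<in> I \<Longrightarrow> vs ! i = ws ! i) \<Longrightarrow> clause_on vs bs I = clause_on ws bs I"
  by (auto simp: clause_on_def)

text \<open>Signs are read off from the positive literals. Attaching them to positions instead of
  variables lets one sign pattern be used along a whole box.\<close>

lemma clause_eq_clause_on:
  assumes I: "I \<subseteq> {..<length vs}" and C: "fst ` C = (!) vs ` I" "inj_on fst C"
  shows "C = clause_on vs (map (\<lambda>v. (v, True) \<in> C) vs) I"
proof (intro subset_antisym subsetI)
  fix l assume l: "l \<in> C"
  obtain i where i: "i \<in> I" "fst l = vs ! i" using l C(1) by blast
  have "snd l = ((vs ! i, True) \<in> C)"
  proof (cases "snd l")
    case True
    then show ?thesis using l i by (metis (full_types) prod.collapse)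
  next
    case False
    have "(vs ! i, True) \<notin> C"
      using inj_onD[OF C(2), of "(vs ! i, True)" l] l i False by auto
    then show ?thesis using False by simp
  qed
  then show "l \<in> clause_on vs (map (\<lambda>v. (v, True) \<in> C) vs) I"
    using i I by (auto simp: clause_on_def image_iff prod_eq_iff intro!: bexI[of _ i])
next
  fix l assume "l \<in> clause_on vs (map (\<lambda>v. (v, True) \<in> C) vs) I"
  then obtain i where i: "i \<in> I" "l = (vs ! i, (vs ! i, True) \<in> C)" using I by (auto simp: clause_on_def)
  have "vs ! i \<in> fst ` C" using C(1) i by blast
  then obtain \<beta> where "(vs ! i, \<beta>) \<in> C" by force
  then show "l \<in> C" using i by (cases \<beta>) (auto, (metis (full_types))+)
qed

lemma box_self: "xs \<in> box xs ys"
  by (simp add: box_def)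

lemma box_update: "xs[i := ys ! i] \<in> box xs ys"
  by (auto simp: box_def) (metis nth_list_update_eq nth_list_update_neq)

lemma box_mix: "map (\<lambda>i. if P i then xs ! i else ys ! i) [0..<length xs] \<in> box xs ys"
  by (auto simp: box_def)

text \<open>If an entry could occur at two positions, writing it into both would give a member of
  the box with a repetition. Hence the variable set of a clause along the box determines its
  positions and the copies used, as \<open>box_image_eq\<close> records.\<close>

lemma box_nth_eq:
  assumes dist: "\<forall>zs\<in>box xs ys. distinct zs" and w: "w \<in> box xs ys" "w' \<in> box xs ys"
    and ij: "i < length xs" "j < length xs" "w ! i = w' ! j"
  shows "i = j"
proof (rule ccontr)
  assume "i \<noteq> j"
  have len: "length w = length xs" using w by (simp add: box_def)
  have "w[j := w' ! j] \<in> box xs ys"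
    using w len ij by (auto simp: box_def nth_list_update)
  from dist[rule_format, OF this] have "w[j := w' ! j] ! i \<noteq> w[j := w' ! j] ! j"
    using ij \<open>i \<noteq> j\<close> len by (subst nth_eq_iff_index_eq) auto
  then show False using ij \<open>i \<noteq> j\<close> len by simp
qed

lemma box_image_eq:
  assumes dist: "\<forall>zs\<in>box xs ys. distinct zs" and w: "w \<in> box xs ys" "w' \<in> box xs ys"
    and IJ: "I \<subseteq> {..<length xs}" "J \<subseteq> {..<length xs}" "(!) w ` I = (!) w' ` J"
  shows "I = J" and "i \<in> I \<Longrightarrow> w ! i = w' ! i"
proof -
  note eq = box_nth_eq[OF dist]
  have 1: "i \<in> J \<and> w ! i = w' ! i" if i: "i \<in> I" for i
  proof -
    obtain j where j: "j \<in> J" "w ! i = w' ! j" using i IJ(3) by blast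
    have "i = j" by (rule eq[OF w _ _ j(2)]) (use i j IJ in auto)
    then show ?thesis using j by simp
  qed
  have 2: "j \<in> I" if j: "j \<in> J" for j
  proof -
    obtain i where i: "i \<in> I" "w ! i = w' ! j" using j IJ(3) by (metis imageE imageI)
    have "i = j" by (rule eq[OF w _ _ i(2)]) (use i j IJ in auto)
    then show ?thesis using i by simp
  qed
  show "I = J" using 1 2 by blast
  show "i \<in> I \<Longrightarrow> w ! i = w' ! i" using 1 by blast
qed

text \<open>A private witness of a clause must falsify each of its one-variable swaps, so it takes
  opposite values on the two copies of every variable.\<close>

lemma swap_witness:
  assumes irr: "irredundant G" and mem: "clause_on xs b I \<in> G"
    and swaps: "\<forall>i\<in>I. clause_on (xs[i := ys ! i]) b I \<in> G"
    and dist: "\<forall>zs\<in>box xs ys. distinct zs" and ne: "\<forall>i\<in>I. xs ! i \<noteq> ys ! i"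
    and I: "I \<subseteq> {..<length xs}"
  shows "\<exists>a. (\<forall>C\<in>G. (\<forall>l\<in>C. literal_true a l) \<longrightarrow> C = clause_on xs b I) \<and>
    (\<forall>i\<in>I. a (xs ! i) = b ! i \<and> a (ys ! i) = (\<not> b ! i))"
proof -
  obtain a where a: "\<forall>l\<in>clause_on xs b I. literal_true a l"
    and only: "\<And>C. C \<in> G \<Longrightarrow> \<forall>l\<in>C. literal_true a l \<Longrightarrow> C = clause_on xs b I"
    using irr mem unfolding irredundant_def by meson
  have x: "a (xs ! i) = b ! i" if "i \<in> I" for i using a that unfolding clause_on_true by blast
  have y: "a (ys ! i) = (\<not> b ! i)" if i: "i \<in> I" for i
  proof (rule ccontr)
    assume "a (ys ! i) \<noteq> (\<not> b ! i)"
    then have "\<forall>l\<in>clause_on (xs[i := ys ! i]) b I. literal_true a l"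
      unfolding clause_on_true using x I by (metis (full_types) lessThan_iff nth_list_update_eq nth_list_update_neq subsetD)
    then have "clause_on (xs[i := ys ! i]) b I = clause_on xs b I" by (rule only[OF swaps[rule_format, OF i]])
    then have "(!) (xs[i := ys ! i]) ` I = (!) xs ` I" by (metis fst_clause_on)
    then have "xs[i := ys ! i] ! i = xs ! i"
      by (rule box_image_eq(2)[OF dist box_update box_self I I _ i])
    moreover have "i < length xs" using i I by auto
    ultimately show False using ne i by (metis nth_list_update_eq)
  qed
  show ?thesis using only x y by blast
qed

definition two_diff :: "nat \<Rightarrow> bool list \<Rightarrow> bool list \<Rightarrow> bool" where
  "two_diff k b c \<longleftrightarrow> (\<exists>i<k. \<exists>j<k. i \<noteq> j \<and> b ! i \<noteq> c ! i \<and> b ! j \<noteq> c ! j)"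

lemma lists_differ: "length b = k \<Longrightarrow> length c = k \<Longrightarrow> b \<noteq> c \<Longrightarrow> \<exists>i<k. b ! i \<noteq> c ! i"
  by (auto simp: list_eq_iff_nth_eq)

text \<open>Patterns differing in exactly one place are neighbours in the Boolean cube, and the cube
  graph, being bipartite, has no triangle.\<close>

lemma two_diff_triple:
  assumes len: "length b = k" "length c = k" "length d = k" and ne: "b \<noteq> c" "b \<noteq> d" "c \<noteq> d"
  shows "two_diff k b c \<or> two_diff k b d \<or> two_diff k c d"
proof (rule ccontr)
  assume no: "\<not> ?thesis"
  obtain i where i: "i < k" "b ! i \<noteq> c ! i" using ne len lists_differ by blast
  obtain j where j: "j < k" "b ! j \<noteq> d ! j" using ne len lists_differ by blast
  obtain l where l: "l < k" "c ! l \<noteq> d ! l" using ne len lists_differ by blast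
  have bc: "b ! m = c ! m" if "m < k" "m \<noteq> i" for m using no that i unfolding two_diff_def by metis
  have bd: "b ! m = d ! m" if "m < k" "m \<noteq> j" for m using no that j unfolding two_diff_def by metis
  have cd: "c ! m = d ! m" if "m < k" "m \<noteq> l" for m using no that l unfolding two_diff_def by metis
  show False using bc bd cd i j l by (metis (full_types))
qed

text \<open>\<open>S e\<close> collects the possible sets of clauses on the \<open>k\<close>-set \<open>e\<close>, and these can be chosen
  independently for different \<open>e\<close>.\<close>

locale clause_selection =
  fixes k :: nat and R :: "nat set" and S :: "nat set \<Rightarrow> clause set set"
  assumes k2: "k \<ge> 2" and finR: "finite R"
    and clauses: "\<And>e s C. e \<in> [R]\<^bsup>k\<^esup> \<Longrightarrow> s \<in> S e \<Longrightarrow> C \<in> s \<Longrightarrow> fst ` C = e \<and> inj_on fst C"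
    and nonempty: "\<And>e. e \<in> [R]\<^bsup>k\<^esup> \<Longrightarrow> S e \<noteq> {}"
    and selection: "\<And>\<sigma>. (\<forall>e\<in>[R]\<^bsup>k\<^esup>. \<sigma> e \<in> S e) \<Longrightarrow> irredundant (\<Union>e\<in>[R]\<^bsup>k\<^esup>. \<sigma> e)"
begin

definition plausible :: "clause set" where
  "plausible = {C. \<exists>e\<in>[R]\<^bsup>k\<^esup>. \<exists>s\<in>S e. C \<in> s}"

text \<open>Choosing for each \<open>k\<close>-set a possible state that covers the clauses of
  \<open>G\<close> there embeds \<open>G\<close> into a selection.\<close>

lemma irredundant_grouped:
  assumes G: "\<And>C. C \<in> G \<Longrightarrow> fst ` C \<in> [R]\<^bsup>k\<^esup>"
    and group: "\<And>e. e \<in> [R]\<^bsup>k\<^esup> \<Longrightarrow> \<exists>s\<in>S e. {C \<in> G. fst ` C = e} \<subseteq> s"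
  shows "irredundant G"
proof -
  have "\<exists>\<sigma>. \<forall>e\<in>[R]\<^bsup>k\<^esup>. \<sigma> e \<in> S e \<and> {C \<in> G. fst ` C = e} \<subseteq> \<sigma> e"
    using group by (intro bchoice) blast
  then obtain \<sigma> where s: "\<forall>e\<in>[R]\<^bsup>k\<^esup>. \<sigma> e \<in> S e \<and> {C \<in> G. fst ` C = e} \<subseteq> \<sigma> e" ..
  have "G \<subseteq> (\<Union>e\<in>[R]\<^bsup>k\<^esup>. \<sigma> e)" using G s by fast
  moreover have "irredundant (\<Union>e\<in>[R]\<^bsup>k\<^esup>. \<sigma> e)" using s by (intro selection) blast
  ultimately show ?thesis by (rule irredundant_subset[rotated])
qed

lemma plausible_edge: "C \<in> plausible \<Longrightarrow> fst ` C \<in> [R]\<^bsup>k\<^esup> \<and> (\<exists>s\<in>S (fst ` C). C \<in> s)"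
  using clauses unfolding plausible_def by auto

lemma irredundant_single:
  assumes G: "G \<subseteq> plausible" and inj: "\<And>C C'. C \<in> G \<Longrightarrow> C' \<in> G \<Longrightarrow> fst ` C = fst ` C' \<Longrightarrow> C = C'"
  shows "irredundant G"
proof (rule irredundant_grouped)
  fix e assume e: "e \<in> [R]\<^bsup>k\<^esup>"
  show "\<exists>s\<in>S e. {C \<in> G. fst ` C = e} \<subseteq> s"
  proof (cases "\<exists>C\<in>G. fst ` C = e")
    case True
    then obtain C where C: "C \<in> G" "fst ` C = e" by blast
    then obtain s where s: "s \<in> S e" "C \<in> s" using plausible_edge[of C] G by auto
    have "C' = C" if "C' \<in> G" "fst ` C' = e" for C' using inj[of C' C] C that by simp
    then have "{C \<in> G. fst ` C = e} \<subseteq> s" using s by blast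
    then show ?thesis using s by blast
  next
    case False
    obtain s where "s \<in> S e" using nonempty[OF e] by blast
    then show ?thesis using False by blast
  qed
qed (use G plausible_edge in blast)

section \<open>Doubled configurations that contradict irredundancy\<close>

definition bad_lists :: "bool list \<Rightarrow> bool list \<Rightarrow> nat list set" where
  "bad_lists b c = {vs. length vs = k \<and> distinct vs \<and> set vs \<subseteq> R \<and>
     clause_on vs b {..<k} \<in> plausible \<and> clause_on vs c {..<k} \<in> plausible \<and>
     (two_diff k b c \<or> (\<exists>s\<in>S (set vs). clause_on vs b {..<k} \<in> s \<and> clause_on vs c {..<k} \<in> s))}"

lemma nth_image_set: "length vs = k \<Longrightarrow> (!) vs ` {..<k} = set vs"
  by (auto simp: set_conv_nth)

text \<open>Take the clause with pattern \<open>b\<close> on \<open>xs\<close>, all its one-variable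
  swaps, and a clause with pattern \<open>c\<close> on a mixture \<open>z\<close> of the two copies.
  A private witness of the first clause is forced to satisfy the last one.\<close>

lemma no_bad_box:
  assumes len: "length b = k" "length c = k" "length xs = k" and bc: "b \<noteq> c"
    and ne: "\<forall>i<k. xs ! i \<noteq> ys ! i" and box: "box xs ys \<subseteq> bad_lists b c"
  shows False
proof -
  let ?I = "{..<k}"
  \<comment> \<open>The witness takes the value \<open>b ! i\<close> on \<open>xs ! i\<close> and
    its negation on \<open>ys ! i\<close>; \<open>z\<close> selects the copy on which this value is
    \<open>c ! i\<close>.\<close>
  define z where "z = map (\<lambda>i. if b ! i = c ! i then xs ! i else ys ! i) [0..<length xs]"
  have z: "z \<in> box xs ys" unfolding z_def by (rule box_mix)
  have znth: "z ! i = (if b ! i = c ! i then xs ! i else ys ! i)" if "i < k" for i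
    using that len by (simp add: z_def)
  have dist: "\<forall>zs\<in>box xs ys. distinct zs" using box by (auto simp: bad_lists_def)
  have pl: "clause_on zs b ?I \<in> plausible" "clause_on zs c ?I \<in> plausible" if "zs \<in> box xs ys" for zs
    using box that by (auto simp: bad_lists_def)
  have I: "?I \<subseteq> {..<length xs}" using len by simp
  have eqI: "w ! i = w' ! i" if "w \<in> box xs ys" "w' \<in> box xs ys" "(!) w ` ?I = (!) w' ` ?I" "i < k" for w w' i
    using box_image_eq(2)[OF dist that(1,2) I I that(3)] that(4) by auto
  obtain j where j: "j < k" "b ! j \<noteq> c ! j" using bc len lists_differ by blast
  define G where "G = insert (clause_on xs b ?I)
    ((\<lambda>i. clause_on (xs[i := ys ! i]) b ?I) ` ?I \<union> {clause_on z c ?I})"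
  have form: "(\<exists>w\<in>box xs ys. C = clause_on w b ?I \<and> (w = xs \<or> (\<exists>i<k. w = xs[i := ys ! i]))) \<or> C = clause_on z c ?I"
    if "C \<in> G" for C
    using that box_self box_update unfolding G_def by fast
  have irr: "irredundant G"
  proof (rule irredundant_grouped)
    fix C assume "C \<in> G"
    then have "C \<in> plausible" using form pl z by blast
    then show "fst ` C \<in> [R]\<^bsup>k\<^esup>" using plausible_edge by blast
  next
    fix e assume e: "e \<in> [R]\<^bsup>k\<^esup>"
    \<comment> \<open>Two clauses of \<open>G\<close> can meet on one \<open>k\<close>-set only if
      \<open>z\<close> is itself a one-variable swap, that is, if \<open>b\<close> and
      \<open>c\<close> differ once. Badness then puts both clauses into one state. If they differ
      twice, \<open>z\<close> is neither \<open>xs\<close> nor a swap.\<close>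
    consider (z) "(!) z ` ?I = e" "\<not> two_diff k b c" | (z2) "(!) z ` ?I = e" "two_diff k b c"
      | (other) w where "(!) z ` ?I \<noteq> e" "w \<in> box xs ys" "(!) w ` ?I = e"
      | (none) "(!) z ` ?I \<noteq> e" "\<not> (\<exists>w\<in>box xs ys. (!) w ` ?I = e)"
      by blast
    then show "\<exists>s\<in>S e. {C \<in> G. fst ` C = e} \<subseteq> s"
    proof cases
      case z: z
      have "z \<in> bad_lists b c" using \<open>z \<in> box xs ys\<close> box by blast
      then obtain s where s: "s \<in> S (set z)" "clause_on z b ?I \<in> s" "clause_on z c ?I \<in> s" "length z = k"
        using z by (auto simp: bad_lists_def)
      have "e = set z" using z(1) nth_image_set[OF s(4)] by metis
      moreover have "C \<in> s" if C: "C \<in> G" "fst ` C = e" for C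
      proof -
        have "C = clause_on z b ?I" if w: "w \<in> box xs ys" "C = clause_on w b ?I" for w
          unfolding w(2) by (rule clause_on_cong) (use eqI[OF w(1) \<open>z \<in> box xs ys\<close>] C w z fst_clause_on in auto)
        then show ?thesis using form[OF C(1)] s by metis
      qed
      ultimately show ?thesis using s by blast
    next
      case z2
      obtain i i' where i: "i < k" "i' < k" "i \<noteq> i'" "b ! i \<noteq> c ! i" "b ! i' \<noteq> c ! i'"
        using z2 by (auto simp: two_diff_def)
      have "C = clause_on z c ?I" if C: "C \<in> G" "fst ` C = e" for C
      proof (rule ccontr)
        assume "C \<noteq> clause_on z c ?I"
        then obtain w where w: "w \<in> box xs ys" "C = clause_on w b ?I" "w = xs \<or> (\<exists>i<k. w = xs[i := ys ! i])"
          using form[OF C(1)] by blast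
        have im: "(!) z ` ?I = (!) w ` ?I" using C w z2 fst_clause_on by simp
        have "ys ! i = w ! i" "ys ! i' = w ! i'"
          using eqI[OF z w(1) im i(1)] eqI[OF z w(1) im i(2)] znth[OF i(1)] znth[OF i(2)] i(4,5) by simp_all
        then show False using w(3) i ne len
          by (metis nth_list_update_neq)
      qed
      moreover obtain s where "s \<in> S e" "clause_on z c ?I \<in> s"
        using plausible_edge[OF pl(2)[OF z]] z2 fst_clause_on by auto
      ultimately show ?thesis by blast
    next
      case (other w)
      obtain s where s: "s \<in> S e" "clause_on w b ?I \<in> s"
        using plausible_edge[OF pl(1)[OF other(2)]] other fst_clause_on by auto
      have "C \<in> s" if C: "C \<in> G" "fst ` C = e" for C
      proof -
        obtain w' where w: "w' \<in> box xs ys" "C = clause_on w' b ?I"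
          using form[OF C(1)] C other fst_clause_on by metis
        have "C = clause_on w b ?I"
          unfolding w(2) by (rule clause_on_cong) (use eqI[OF w(1) other(2)] C w other fst_clause_on in auto)
        then show ?thesis using s by blast
      qed
      then show ?thesis using s by blast
    next
      case none
      have "C \<notin> G" if "fst ` C = e" for C using form[of C] none that fst_clause_on by metis
      then show ?thesis using nonempty[OF e] by blast
    qed
  qed
  have mem: "clause_on xs b ?I \<in> G" "\<forall>i\<in>?I. clause_on (xs[i := ys ! i]) b ?I \<in> G"
    unfolding G_def by blast+
  have ne': "\<forall>i\<in>?I. xs ! i \<noteq> ys ! i" using ne by auto
  obtain a where a: "(\<forall>C\<in>G. (\<forall>l\<in>C. literal_true a l) \<longrightarrow> C = clause_on xs b ?I) \<and>
      (\<forall>i\<in>?I. a (xs ! i) = b ! i \<and> a (ys ! i) = (\<not> b ! i))"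
    using swap_witness[OF irr mem dist ne' I] ..
  have only: "C = clause_on xs b ?I" if "C \<in> G" "\<forall>l\<in>C. literal_true a l" for C
    using bspec[OF conjunct1[OF a] that(1)] that(2) by (rule mp)
  have ax: "a (xs ! i) = b ! i" and ay: "a (ys ! i) = (\<not> b ! i)" if "i \<in> ?I" for i
    using bspec[OF conjunct2[OF a] that] by simp_all
  have "clause_on z c ?I = clause_on xs b ?I"
  proof (rule only)
    show "clause_on z c ?I \<in> G" by (simp add: G_def)
    show "\<forall>l\<in>clause_on z c ?I. literal_true a l"
      unfolding clause_on_true
    proof
      fix i assume "i \<in> ?I"
      then show "a (z ! i) = c ! i" using ax[of i] ay[of i] znth[of i] by auto
    qed
  qed
  then have "(!) z ` ?I = (!) xs ` ?I" by (metis fst_clause_on)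
  from eqI[OF z box_self this j(1)] show False using znth[OF j(1)] j ne by auto
qed

definition T_typed :: "bool list \<times> bool list \<times> bool list \<Rightarrow> nat list set" where
  "T_typed = (\<lambda>(b, c, d). {vs. length vs = k + 1 \<and> distinct vs \<and> set vs \<subseteq> R \<and>
     clause_on vs b {0..<k} \<in> plausible \<and> clause_on vs c {1..k} \<in> plausible \<and>
     clause_on vs d (insert k {0..<k-1}) \<in> plausible \<and> d ! k = (\<not> c ! k)})"

text \<open>The swaps of the first clause force the values on positions below \<open>k\<close>, and
  mixing copies there satisfies the patterns \<open>c\<close> and \<open>d\<close>. The last
  position stays free, but \<open>c\<close> and \<open>d\<close> have opposite signs on it, so every
  value satisfies one of the two extra clauses.\<close>

lemma no_T_box:
  assumes len: "length xs = k + 1" and ne: "\<forall>i<k+1. xs ! i \<noteq> ys ! i"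
    and box: "box xs ys \<subseteq> T_typed (b, c, d)"
  shows False
proof -
  let ?I1 = "{0..<k}" and ?I2 = "{1..k}" and ?I3 = "insert k {0..<k-1}"
  \<comment> \<open>Position \<open>k\<close> keeps its copy from \<open>xs\<close>, so both extra
    clauses use the same last variable.\<close>
  define mix where "mix e = map (\<lambda>i. if i = k \<or> b ! i = e ! i then xs ! i else ys ! i) [0..<length xs]"
    for e :: "bool list"
  have mix: "mix e \<in> box xs ys" for e unfolding mix_def by (rule box_mix)
  have mnth: "mix e ! i = (if i = k \<or> b ! i = e ! i then xs ! i else ys ! i)" if "i \<le> k" for e i
    using that len unfolding mix_def by (subst nth_map) (auto simp del: upt_Suc)
  have dist: "\<forall>zs\<in>box xs ys. distinct zs" using box by (auto simp: T_typed_def)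
  have pl: "clause_on zs b ?I1 \<in> plausible" "clause_on zs c ?I2 \<in> plausible" "clause_on zs d ?I3 \<in> plausible"
    if "zs \<in> box xs ys" for zs
    using box that by (auto simp: T_typed_def)
  have dk: "d ! k = (\<not> c ! k)" using box box_self[of xs ys] by (auto simp: T_typed_def)
  have I: "?I1 \<subseteq> {..<length xs}" "?I2 \<subseteq> {..<length xs}" "?I3 \<subseteq> {..<length xs}" using len by auto
  have Ine: "?I1 \<noteq> ?I2" "?I1 \<noteq> ?I3" "?I2 \<noteq> ?I3"
  proof -
    have "k \<notin> ?I1" "k \<in> ?I2" "k \<in> ?I3" "0 \<in> ?I3" "0 \<notin> ?I2" using k2 by auto
    then show "?I1 \<noteq> ?I2" "?I1 \<noteq> ?I3" "?I2 \<noteq> ?I3" by metis+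
  qed
  \<comment> \<open>Letting the position set determine the pattern shows that clauses of
    \<open>G\<close> with equal variable sets coincide, as \<open>irredundant_single\<close>
    requires.\<close>
  define \<beta> where "\<beta> J = (if J = ?I1 then b else if J = ?I2 then c else d)" for J
  have \<beta>: "\<beta> ?I1 = b" "\<beta> ?I2 = c" "\<beta> ?I3 = d" 
    using Ine not_sym[OF Ine(1)] not_sym[OF Ine(2)] not_sym[OF Ine(3)]
    by (simp_all only: \<beta>_def if_True if_False simp_thms)
  define G where "G = insert (clause_on xs b ?I1)
    ((\<lambda>i. clause_on (xs[i := ys ! i]) b ?I1) ` ?I1 \<union> {clause_on (mix c) c ?I2, clause_on (mix d) d ?I3})"
  have form: "\<exists>w\<in>box xs ys. \<exists>J\<in>{?I1, ?I2, ?I3}. C = clause_on w (\<beta> J) J" if C: "C \<in> G" for C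
  proof -
    consider "C = clause_on xs b ?I1" | i where "C = clause_on (xs[i := ys ! i]) b ?I1"
      | "C = clause_on (mix c) c ?I2" | "C = clause_on (mix d) d ?I3"
      using C unfolding G_def by blast
    then show ?thesis
    proof cases
      case 1
      show ?thesis by (rule bexI[of _ xs], rule bexI[of _ ?I1]) (use 1 \<beta> box_self in auto)
    next
      case (2 i)
      show ?thesis by (rule bexI[of _ "xs[i := ys ! i]"], rule bexI[of _ ?I1]) (use 2 \<beta> box_update in auto)
    next
      case 3
      show ?thesis by (rule bexI[of _ "mix c"], rule bexI[of _ ?I2]) (use 3 \<beta> mix in auto)
    next
      case 4
      show ?thesis by (rule bexI[of _ "mix d"], rule bexI[of _ ?I3]) (use 4 \<beta> mix in auto)
    qed
  qed
  have irr: "irredundant G"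
  proof (rule irredundant_single)
    show "G \<subseteq> plausible"
    proof
      fix C assume "C \<in> G"
      then obtain w J where w: "w \<in> box xs ys" "J \<in> {?I1, ?I2, ?I3}" "C = clause_on w (\<beta> J) J"
        using form by blast
      from w(2) show "C \<in> plausible"
        unfolding w(3) using pl[OF w(1)] \<beta> by (elim insertE emptyE) (simp_all only:)
    qed
    fix C C' assume C: "C \<in> G" "C' \<in> G" "fst ` C = fst ` C'"
    obtain w J where w: "w \<in> box xs ys" "J \<in> {?I1, ?I2, ?I3}" "C = clause_on w (\<beta> J) J"
      using form[OF C(1)] by blast
    obtain w' J' where w': "w' \<in> box xs ys" "J' \<in> {?I1, ?I2, ?I3}" "C' = clause_on w' (\<beta> J') J'"
      using form[OF C(2)] by blast
    have sub: "J \<subseteq> {..<length xs}" "J' \<subseteq> {..<length xs}" using w(2) w'(2) I by blast+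
    have im: "(!) w ` J = (!) w' ` J'" using C(3) unfolding w(3) w'(3) fst_clause_on .
    have "J = J'" by (rule box_image_eq(1)[OF dist w(1) w'(1) sub im])
    moreover have "w ! i = w' ! i" if "i \<in> J" for i
      by (rule box_image_eq(2)[OF dist w(1) w'(1) sub im that])
    ultimately show "C = C'" unfolding w(3) w'(3) using clause_on_cong by metis
  qed
  have mem: "clause_on xs b ?I1 \<in> G" "\<forall>i\<in>?I1. clause_on (xs[i := ys ! i]) b ?I1 \<in> G"
    unfolding G_def by blast+
  have ne': "\<forall>i\<in>?I1. xs ! i \<noteq> ys ! i" using ne by auto
  obtain a where a: "(\<forall>C\<in>G. (\<forall>l\<in>C. literal_true a l) \<longrightarrow> C = clause_on xs b ?I1) \<and>
      (\<forall>i\<in>?I1. a (xs ! i) = b ! i \<and> a (ys ! i) = (\<not> b ! i))"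
    using swap_witness[OF irr mem dist ne' I(1)] ..
  have only: "C = clause_on xs b ?I1" if "C \<in> G" "\<forall>l\<in>C. literal_true a l" for C
    using bspec[OF conjunct1[OF a] that(1)] that(2) by (rule mp)
  have ax: "a (xs ! i) = b ! i" and ay: "a (ys ! i) = (\<not> b ! i)" if "i \<in> ?I1" for i
    using bspec[OF conjunct2[OF a] that] by simp_all
  have amix: "a (mix e ! i) = e ! i" if "i < k" for e i
    using that ax[of i] ay[of i] mnth[of i e] by auto
  have differ: "clause_on w e J \<noteq> clause_on xs b ?I1"
    if "w \<in> box xs ys" "J \<subseteq> {..<length xs}" "?I1 \<noteq> J" for w e J
  proof
    assume "clause_on w e J = clause_on xs b ?I1"
    then have "(!) w ` J = (!) xs ` ?I1" by (metis fst_clause_on)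
    then have "J = ?I1" by (rule box_image_eq(1)[OF dist that(1) box_self that(2) I(1)])
    then show False using that by simp
  qed
  have "a (xs ! k) \<noteq> c ! k"
  proof
    assume k: "a (xs ! k) = c ! k"
    have "\<forall>i\<in>?I2. a (mix c ! i) = c ! i"
    proof
      fix i assume i: "i \<in> ?I2"
      show "a (mix c ! i) = c ! i" using amix[of i c] k mnth[of k c] i by (cases "i = k") auto
    qed
    then have "clause_on (mix c) c ?I2 = clause_on xs b ?I1"
      by (intro only) (auto simp: G_def clause_on_true)
    then show False using differ[OF mix I(2) Ine(1)] by blast
  qed
  then have "a (mix d ! i) = d ! i" if "i \<in> ?I3" for i
    using amix[of i d] mnth[of k d] that dk by (cases "i = k") auto
  then have "clause_on (mix d) d ?I3 = clause_on xs b ?I1"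
    by (intro only) (auto simp: G_def clause_on_true)
  then show False using differ[OF mix I(3) Ine(2)] by blast
qed

end

lemma subset_pair_cases: "s \<subseteq> {x, y} \<Longrightarrow> \<not> (x \<in> s \<and> y \<in> s) \<Longrightarrow> s \<in> {{}, {x}, {y}}"
  by (cases "x \<in> s"; cases "y \<in> s") auto

section \<open>The partially directed graph of a selection\<close>

context clause_selection
begin

definition bad_types :: "(bool list \<times> bool list) set" where
  "bad_types = {(b, c). length b = k \<and> length c = k \<and> b \<noteq> c}"

definition bad_edges :: "nat set set" where
  "bad_edges = set ` (\<Union>(b, c)\<in>bad_types. bad_lists b c)"

text \<open>In the directed branch exactly two clauses are possible and they differ in a single
  variable, which is the only vertex the choice can return.\<close>

definition status :: "nat set \<Rightarrow> nat edge_status" where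
  "status e = (if e \<notin> [R]\<^bsup>k\<^esup> \<or> e \<in> bad_edges \<or> \<Union>(S e) = {} then No_Edge
     else if is_singleton (\<Union>(S e)) then Undirected
     else Directed (SOME v. v \<in> e \<and> (\<forall>\<beta>. \<exists>C\<in>\<Union>(S e). (v, \<beta>) \<in> C)))"

lemma edge_list:
  assumes e: "e \<in> [R]\<^bsup>k\<^esup>"
  obtains vs where "length vs = k" "distinct vs" "set vs = e" "set vs \<subseteq> R"
    "\<And>C. C \<in> \<Union>(S e) \<Longrightarrow> C = clause_on vs (map (\<lambda>v. (v, True) \<in> C) vs) {..<k}"
proof -
  have fe: "finite e" "card e = k" "e \<subseteq> R" using e by (auto simp: nsets_def)
  obtain vs where vs: "distinct vs" "set vs = e" using finite_distinct_list[OF fe(1)] by blast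
  have len: "length vs = k" using vs fe by (metis distinct_card)
  have "C = clause_on vs (map (\<lambda>v. (v, True) \<in> C) vs) {..<k}" if C: "C \<in> \<Union>(S e)" for C
  proof (rule clause_eq_clause_on)
    obtain s where "s \<in> S e" "C \<in> s" using C by blast
    then have "fst ` C = e \<and> inj_on fst C" using clauses[OF e] by blast
    then show "fst ` C = (!) vs ` {..<k}" "inj_on fst C"
      using nth_image_set[OF len] vs by simp_all
  qed (use len in auto)
  then show ?thesis using that[of vs] len vs fe by blast
qed

text \<open>Off the bad edges possible clauses pairwise differ in one sign, so a third one is
  excluded by \<open>two_diff_triple\<close>.\<close>

lemma good_edge_pair:
  assumes e: "e \<in> [R]\<^bsup>k\<^esup>" "e \<notin> bad_edges" and C: "C \<in> \<Union>(S e)" "C' \<in> \<Union>(S e)" "C \<noteq> C'"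
  shows "\<Union>(S e) = {C, C'}" and "s \<in> S e \<Longrightarrow> \<not> (C \<in> s \<and> C' \<in> s)"
proof -
  obtain vs where vs: "length vs = k" "distinct vs" "set vs = e" "set vs \<subseteq> R"
    and rep: "\<And>C. C \<in> \<Union>(S e) \<Longrightarrow> C = clause_on vs (map (\<lambda>v. (v, True) \<in> C) vs) {..<k}"
    using edge_list[OF e(1)] by metis
  define bs where "bs C = map (\<lambda>v. (v, True) \<in> C) vs" for C :: clause
  have rep': "clause_on vs (bs C) {..<k} = C" if "C \<in> \<Union>(S e)" for C using rep[OF that] by (simp add: bs_def)
  have len: "length (bs C) = k" for C by (simp add: bs_def vs)
  have ne: "bs C \<noteq> bs C'" if "C \<in> \<Union>(S e)" "C' \<in> \<Union>(S e)" "C \<noteq> C'" for C C'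
    using rep'[OF that(1)] rep'[OF that(2)] that(3) by metis
  have good: "\<not> two_diff k (bs C) (bs C') \<and> (\<forall>s\<in>S e. \<not> (C \<in> s \<and> C' \<in> s))"
    if C: "C \<in> \<Union>(S e)" "C' \<in> \<Union>(S e)" "C \<noteq> C'" for C C'
  proof -
    have "vs \<notin> bad_lists (bs C) (bs C')"
    proof
      assume "vs \<in> bad_lists (bs C) (bs C')"
      moreover have "(bs C, bs C') \<in> bad_types" using len ne[OF C] by (simp add: bad_types_def)
      ultimately have "vs \<in> (\<Union>(b, c)\<in>bad_types. bad_lists b c)" by blast
      then have "e \<in> bad_edges" unfolding bad_edges_def using vs(3) by blast
      then show False using e by blast
    qed
    moreover have "C \<in> plausible" "C' \<in> plausible" using C e(1) unfolding plausible_def by blast+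
    ultimately show ?thesis unfolding bad_lists_def using vs rep'[OF C(1)] rep'[OF C(2)] by auto
  qed
  show "s \<in> S e \<Longrightarrow> \<not> (C \<in> s \<and> C' \<in> s)" using good[OF C] by blast
  have "D \<in> {C, C'}" if D: "D \<in> \<Union>(S e)" for D
  proof (rule ccontr)
    assume "D \<notin> {C, C'}"
    then have neD: "C \<noteq> D" "C' \<noteq> D" by auto
    show False
      using two_diff_triple[OF len[of C] len[of C'] len[of D] ne[OF C] ne[OF C(1) D neD(1)] ne[OF C(2) D neD(2)]]
        good[OF C] good[OF C(1) D neD(1)] good[OF C(2) D neD(2)] by blast
  qed
  then show "\<Union>(S e) = {C, C'}" using C by blast
qed

lemma not_singleton_pair:
  assumes "A \<noteq> {}" "\<not> is_singleton A"
  obtains x y where "x \<in> A" "y \<in> A" "x \<noteq> y"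
  using assms by (metis equals0I is_singletonI')

lemma status_directed:
  assumes "status e = Directed v"
  shows "v \<in> e" and "\<exists>C\<in>\<Union>(S e). (v, \<beta>) \<in> C"
proof -
  have e: "e \<in> [R]\<^bsup>k\<^esup>" "\<Union>(S e) \<noteq> {}" "\<not> is_singleton (\<Union>(S e))"
    and v: "v = (SOME v. v \<in> e \<and> (\<forall>\<beta>. \<exists>C\<in>\<Union>(S e). (v, \<beta>) \<in> C))"
    using assms unfolding status_def by (auto split: if_splits)
  obtain C C' where C: "C \<in> \<Union>(S e)" "C' \<in> \<Union>(S e)" "C \<noteq> C'" using not_singleton_pair[OF e(2,3)] by metis
  obtain vs where vs: "length vs = k" "distinct vs" "set vs = e" "set vs \<subseteq> R"
    and rep: "\<And>C. C \<in> \<Union>(S e) \<Longrightarrow> C = clause_on vs (map (\<lambda>v. (v, True) \<in> C) vs) {..<k}"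
    using edge_list[OF e(1)] by metis
  define bs where "bs C = map (\<lambda>v. (v, True) \<in> C) vs" for C :: clause
  have rep': "C = clause_on vs (bs C) {..<k}" if "C \<in> \<Union>(S e)" for C using rep[OF that] by (simp add: bs_def)
  have "bs C \<noteq> bs C'" using rep'[OF C(1)] rep'[OF C(2)] C(3) by metis
  moreover have "length (bs C) = k" "length (bs C') = k" by (simp_all add: bs_def vs)
  ultimately obtain i where i: "i < k" "bs C ! i \<noteq> bs C' ! i" using lists_differ by blast
  have mem: "(vs ! i, bs C ! i) \<in> C" if "C \<in> \<Union>(S e)" for C
    using rep'[OF that] i(1) unfolding clause_on_def by (metis (no_types, lifting) imageI lessThan_iff)
  have "\<exists>C\<in>\<Union>(S e). (vs ! i, \<beta>) \<in> C" for \<beta>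
  proof (cases "\<beta> = bs C ! i")
    case True
    then show ?thesis using mem[OF C(1)] C(1) by blast
  next
    case False
    then have "\<beta> = bs C' ! i" using i(2) by simp
    then show ?thesis using mem[OF C(2)] C(2) by blast
  qed
  moreover have "vs ! i \<in> e" using i(1) vs by auto
  ultimately have "\<exists>v. v \<in> e \<and> (\<forall>\<beta>. \<exists>C\<in>\<Union>(S e). (v, \<beta>) \<in> C)" by blast
  from someI_ex[OF this] have "v \<in> e \<and> (\<forall>\<beta>. \<exists>C\<in>\<Union>(S e). (v, \<beta>) \<in> C)" unfolding v .
  then show "v \<in> e" "\<exists>C\<in>\<Union>(S e). (v, \<beta>) \<in> C" by blast+
qed

text \<open>Source of the parameter \<open>log 2 3\<close>: with two possible clauses that never
  occur together, the states are at most the empty one and two singletons.\<close>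

lemma log_card_le_weight:
  assumes e: "e \<in> [R]\<^bsup>k\<^esup>" "e \<notin> bad_edges"
  shows "log 2 (real (card (S e))) \<le> edge_weight (log 2 3) (status e)"
proof -
  have le: "log 2 (real (card (S e))) \<le> log 2 (real n)" if "S e \<subseteq> A" "finite A" "card A \<le> n" for A n
  proof -
    have "finite (S e)" using that finite_subset by blast
    then have "0 < card (S e)" using nonempty[OF e(1)] by (simp add: card_gt_0_iff)
    moreover have "card (S e) \<le> n" using card_mono[OF that(2,1)] that(3) by simp
    ultimately show ?thesis by simp
  qed
  show ?thesis
  proof (cases "\<Union>(S e) = {}")
    case True
    then have "S e \<subseteq> {{}}" by auto
    then have "log 2 (real (card (S e))) \<le> log 2 (real 1)" by (rule le) auto
    moreover have "status e = No_Edge" using True by (simp add: status_def)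
    ultimately show ?thesis by simp
  next
    case ne: False
    show ?thesis
    proof (cases "is_singleton (\<Union>(S e))")
      case True
      then obtain C where C: "\<Union>(S e) = {C}" by (auto simp: is_singleton_def)
      have "S e \<subseteq> {{}, {C}}"
      proof
        fix s assume "s \<in> S e"
        then have "s \<subseteq> {C}" unfolding C[symmetric] by (rule Union_upper)
        then show "s \<in> {{}, {C}}" by (simp add: subset_singleton_iff)
      qed
      then have "log 2 (real (card (S e))) \<le> log 2 (real 2)" by (rule le) (auto simp: card_insert_if)
      moreover have "status e = Undirected" using True ne e by (simp add: status_def)
      ultimately show ?thesis by simp
    next
      case False
      then obtain C C' where C: "C \<in> \<Union>(S e)" "C' \<in> \<Union>(S e)" "C \<noteq> C'" using not_singleton_pair[OF ne] by metis
      have "S e \<subseteq> {{}, {C}, {C'}}"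
      proof
        fix s assume s: "s \<in> S e"
        have "s \<subseteq> {C, C'}" unfolding good_edge_pair(1)[OF e C, symmetric] using s by (rule Union_upper)
        moreover have "\<not> (C \<in> s \<and> C' \<in> s)" by (rule good_edge_pair(2)[OF e C s])
        ultimately show "s \<in> {{}, {C}, {C'}}" by (rule subset_pair_cases)
      qed
      then have "log 2 (real (card (S e))) \<le> log 2 (real 3)" by (rule le) (auto simp: card_insert_if)
      moreover have "edge_weight (log 2 3) (status e) = log 2 3"
        using False ne e by (simp only: status_def if_False simp_thms edge_weight.simps not_not)
      ultimately show ?thesis by simp
    qed
  qed
qed

definition T_types :: "(bool list \<times> bool list \<times> bool list) set" where
  "T_types = {b. length b = k + 1} \<times> {c. length c = k + 1} \<times> {d. length d = k + 1}"

text \<open>The directed edge offers clauses with either sign at its head, so after any choice on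
  the second edge a clause with the opposite sign is available on the third.\<close>

lemma T_lists_subset_typed: "T_lists k status R \<subseteq> (\<Union>\<tau>\<in>T_types. T_typed \<tau>)"
proof
  fix vs assume "vs \<in> T_lists k status R"
  then have vs: "length vs = k + 1" "distinct vs" "set vs \<subseteq> R"
    and st: "status ((!) vs ` {0..<k}) \<noteq> No_Edge" "status ((!) vs ` {1..k}) \<noteq> No_Edge"
      "status ((!) vs ` insert k {0..<k-1}) = Directed (vs ! k)"
    by (auto simp: T_lists_def)
  have edge: "e \<in> [R]\<^bsup>k\<^esup> \<and> \<Union>(S e) \<noteq> {}" if "status e \<noteq> No_Edge" for e
    using that unfolding status_def by presburger
  have pl: "C \<in> plausible" "fst ` C = e" "inj_on fst C" if "e \<in> [R]\<^bsup>k\<^esup>" "C \<in> \<Union>(S e)" for C e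
    using that clauses unfolding plausible_def by blast+
  define bs where "bs C = map (\<lambda>v. (v, True) \<in> C) vs" for C :: clause
  have len: "length (bs C) = k + 1" for C by (simp add: bs_def vs)
  have rep: "clause_on vs (bs C) I \<in> plausible"
    if "(!) vs ` I \<in> [R]\<^bsup>k\<^esup>" "C \<in> \<Union>(S ((!) vs ` I))" "I \<subseteq> {..<k+1}" for C I
    using pl(1)[OF that(1,2)] clause_eq_clause_on[OF _ pl(2,3)[OF that(1,2)]] that(3) vs(1) by (simp add: bs_def)
  obtain B where B: "B \<in> \<Union>(S ((!) vs ` {0..<k}))" using edge[OF st(1)] by blast
  obtain C where C: "C \<in> \<Union>(S ((!) vs ` {1..k}))" using edge[OF st(2)] by blast
  have e3: "(!) vs ` insert k {0..<k-1} \<in> [R]\<^bsup>k\<^esup>" using edge[of "(!) vs ` insert k {0..<k-1}"] st(3) by simp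
  obtain D where D: "D \<in> \<Union>(S ((!) vs ` insert k {0..<k-1}))" "(vs ! k, \<not> bs C ! k) \<in> D"
    using status_directed(2)[OF st(3)] by blast
  have "bs D ! k = (\<not> bs C ! k)"
  proof -
    have "bs D ! k = ((vs ! k, True) \<in> D)" by (simp add: bs_def vs)
    moreover have "(vs ! k, bs C ! k) \<notin> D"
      using inj_onD[OF pl(3)[OF e3 D(1)], of "(vs ! k, bs C ! k)" "(vs ! k, \<not> bs C ! k)"] D(2) by auto
    ultimately show ?thesis using D(2) by (cases "bs C ! k") auto
  qed
  moreover have "clause_on vs (bs B) {0..<k} \<in> plausible"
    by (rule rep[OF _ B]) (use edge[OF st(1)] in auto)
  moreover have "clause_on vs (bs C) {1..k} \<in> plausible"
    by (rule rep[OF _ C]) (use edge[OF st(2)] in auto)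
  moreover have "clause_on vs (bs D) (insert k {0..<k-1}) \<in> plausible"
    by (rule rep[OF e3 D(1)]) auto
  ultimately have "vs \<in> T_typed (bs B, bs C, bs D)" using vs by (simp add: T_typed_def)
  moreover have "(bs B, bs C, bs D) \<in> T_types" using len by (simp add: T_types_def)
  ultimately show "vs \<in> (\<Union>\<tau>\<in>T_types. T_typed \<tau>)" by blast
qed

end

lemma finite_bool_lists: "finite {b :: bool list. length b = n}"
  using finite_lists_length_eq[of "UNIV :: bool set" n] by simp

text \<open>Bad lists and ordered copies of \<open>T_pdg k\<close> each split into a number of sign
  types independent of \<open>R\<close>. If either family were dense, one type would contain a box,
  contradicting \<open>no_bad_box\<close> or \<open>no_T_box\<close>. So the bad edges are few, and
  supersaturation bounds the weight of the rest.\<close>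

lemma sum_log_card_selection_le:
  fixes k K :: nat and \<epsilon> :: real
  assumes k: "k \<ge> 2" and eps: "0 < \<epsilon>"
  shows "\<exists>r0. \<forall>R S. clause_selection k R S \<and> r0 \<le> card R \<and> (\<forall>e\<in>[R]\<^bsup>k\<^esup>. finite (S e) \<and> card (S e) \<le> 2 ^ K) \<longrightarrow>
    (\<Sum>e\<in>[R]\<^bsup>k\<^esup>. log 2 (real (card (S e)))) \<le>
    (turan_density k (T_pdg k) (log 2 3) + \<epsilon>) * real (card R choose k)"
proof -
  let ?\<theta> = "log 2 3 :: real"
  let ?\<pi> = "turan_density k (T_pdg k) ?\<theta>"
  have th: "0 \<le> ?\<theta>" by simp
  have e2: "0 < \<epsilon> / 2" using eps by simp
  obtain \<rho> r1 where \<rho>: "0 < \<rho>" and r1: "\<forall>(R :: nat set) st. finite R \<and> r1 \<le> card R \<and>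
      (\<forall>e v. st e = Directed v \<longrightarrow> v \<in> e) \<and>
      (?\<pi> + \<epsilon> / 2) * real (card R choose k) < (\<Sum>e\<in>[R]\<^bsup>k\<^esup>. edge_weight ?\<theta> (st e)) \<longrightarrow>
      \<rho> * real (card R) ^ (k+1) \<le> real (card (T_lists k st R))"
    using supersaturation[OF k th e2] by metis
  define \<T> :: "(bool list \<times> bool list \<times> bool list) set"
    where "\<T> = {b. length b = k + 1} \<times> {c. length c = k + 1} \<times> {d. length d = k + 1}"
  have finT: "finite \<T>" unfolding \<T>_def by (intro finite_cartesian_product finite_bool_lists)
  obtain r2 where r2: "\<forall>(V::nat set) Q. finite V \<and> r2 \<le> card V \<and> (\<forall>\<tau>\<in>\<T>. Q \<tau> \<subseteq> {zs. set zs \<subseteq> V \<and> length zs = k+1}) \<and>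
      \<rho> * real (card V) ^ (k+1) \<le> real (card (\<Union>\<tau>\<in>\<T>. Q \<tau>)) \<longrightarrow>
      (\<exists>\<tau>\<in>\<T>. \<exists>xs ys. length xs = k+1 \<and> length ys = k+1 \<and> (\<forall>i<k+1. xs ! i \<noteq> ys ! i) \<and> box xs ys \<subseteq> Q \<tau>)"
    using dense_union_contains_box[OF \<rho> finT, of "k+1"] ..
  define \<B> :: "(bool list \<times> bool list) set" where "\<B> = {(b, c). length b = k \<and> length c = k \<and> b \<noteq> c}"
  have "\<B> \<subseteq> {b. length b = k} \<times> {c. length c = k}" by (auto simp: \<B>_def)
  then have finB: "finite \<B>" using finite_bool_lists finite_subset by blast
  \<comment> \<open>Chosen so that fewer than \<open>\<gamma> * r ^ k\<close> bad edges, at a cost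
    of at most \<open>K\<close> each, stay within \<open>\<epsilon> / 2 * (r choose k)\<close>,
    where \<open>r = card R\<close>.\<close>
  define \<gamma> where "\<gamma> = \<epsilon> / 2 / real k ^ k / (real K + 1)"
  have \<gamma>: "0 < \<gamma>" using eps k by (simp add: \<gamma>_def)
  obtain r3 where r3: "\<forall>(V::nat set) Q. finite V \<and> r3 \<le> card V \<and> (\<forall>\<tau>\<in>\<B>. Q \<tau> \<subseteq> {zs. set zs \<subseteq> V \<and> length zs = k}) \<and>
      \<gamma> * real (card V) ^ k \<le> real (card (\<Union>\<tau>\<in>\<B>. Q \<tau>)) \<longrightarrow>
      (\<exists>\<tau>\<in>\<B>. \<exists>xs ys. length xs = k \<and> length ys = k \<and> (\<forall>i<k. xs ! i \<noteq> ys ! i) \<and> box xs ys \<subseteq> Q \<tau>)"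
    using dense_union_contains_box[OF \<gamma> finB, of k] ..
  show ?thesis
  proof (intro exI[of _ "max (max r1 r2) (max r3 k)"] allI impI; elim conjE)
    fix R S assume sel: "clause_selection k R S" and big: "max (max r1 r2) (max r3 k) \<le> card R"
      and S: "\<forall>e\<in>[R]\<^bsup>k\<^esup>. finite (S e) \<and> card (S e) \<le> 2 ^ K"
    interpret clause_selection k R S by (rule sel)
    let ?r = "card R"
    have bigs: "r1 \<le> ?r" "r2 \<le> ?r" "r3 \<le> ?r" "k \<le> ?r" using big by auto
    define bad where "bad = (\<Union>\<tau>\<in>\<B>. case \<tau> of (b, c) \<Rightarrow> bad_lists b c)"
    have bad_sub: "(case \<tau> of (b, c) \<Rightarrow> bad_lists b c) \<subseteq> {zs. set zs \<subseteq> R \<and> length zs = k}" for \<tau>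
      by (cases \<tau>) (auto simp: bad_lists_def)
    have fin_bad: "finite bad"
      unfolding bad_def by (intro finite_UN_I finB finite_subset[OF bad_sub] finite_lists_length_eq finR)
    have few_bad: "real (card bad) < \<gamma> * real ?r ^ k"
    proof (rule ccontr)
      assume "\<not> ?thesis"
      then have "\<gamma> * real ?r ^ k \<le> real (card (\<Union>\<tau>\<in>\<B>. case \<tau> of (b, c) \<Rightarrow> bad_lists b c))"
        unfolding bad_def by simp
      then obtain \<tau> xs ys where \<tau>: "\<tau> \<in> \<B>"
        and box: "length xs = k" "length ys = k" "\<forall>i<k. xs ! i \<noteq> ys ! i" "box xs ys \<subseteq> (case \<tau> of (b, c) \<Rightarrow> bad_lists b c)"
        using r3[rule_format, of R "\<lambda>\<tau>. case \<tau> of (b, c) \<Rightarrow> bad_lists b c"] finR bigs(3) bad_sub by metis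
      obtain b c where bc: "\<tau> = (b, c)" by (cases \<tau>)
      show False
        using no_bad_box[of b c xs ys] \<tau> box unfolding bc \<B>_def by simp
    qed
    have light: "(\<Sum>e\<in>[R]\<^bsup>k\<^esup>. edge_weight ?\<theta> (status e)) \<le> (?\<pi> + \<epsilon> / 2) * real (?r choose k)"
    proof (rule ccontr)
      assume "\<not> ?thesis"
      then have "\<rho> * real ?r ^ (k+1) \<le> real (card (T_lists k status R))"
        using r1[rule_format, of R status] finR bigs(1) status_directed(1) by (simp add: not_le)
      also have "\<dots> \<le> real (card (\<Union>\<tau>\<in>\<T>. T_typed \<tau>))"
      proof -
        have fin: "finite (T_typed \<tau>)" for \<tau>
          by (rule finite_subset[OF _ finite_lists_length_eq[OF finR, of "k+1"]]) (auto simp: T_typed_def)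
        have "finite (\<Union>\<tau>\<in>\<T>. T_typed \<tau>)" using finT fin by blast
        moreover have "T_lists k status R \<subseteq> (\<Union>\<tau>\<in>\<T>. T_typed \<tau>)"
          using T_lists_subset_typed unfolding T_types_def \<T>_def .
        ultimately show ?thesis by (simp add: card_mono)
      qed
      finally have dense: "\<rho> * real ?r ^ (k+1) \<le> real (card (\<Union>\<tau>\<in>\<T>. T_typed \<tau>))" .
      have sub: "\<forall>\<tau>\<in>\<T>. T_typed \<tau> \<subseteq> {zs. set zs \<subseteq> R \<and> length zs = k+1}" by (auto simp: T_typed_def)
      obtain \<tau> xs ys where
        box: "length xs = k+1" "length ys = k+1" "\<forall>i<k+1. xs ! i \<noteq> ys ! i" "box xs ys \<subseteq> T_typed \<tau>"
        using mp[OF spec[OF spec[OF r2, of R], of T_typed] conjI[OF finR conjI[OF bigs(2) conjI[OF sub dense]]]]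
        by blast
      obtain b c d where "\<tau> = (b, c, d)" by (cases \<tau>)
      then show False using no_T_box[of xs ys b c d] box by simp
    qed
    have finE: "finite ([R]\<^bsup>k\<^esup>)" by (rule finite_imp_finite_nsets[OF finR])
    have bad_edges: "bad_edges = set ` bad" by (simp add: bad_edges_def bad_def bad_types_def \<B>_def)
    have "(\<Sum>e\<in>[R]\<^bsup>k\<^esup>. log 2 (real (card (S e)))) \<le>
        (\<Sum>e\<in>[R]\<^bsup>k\<^esup>. edge_weight ?\<theta> (status e) + (if e \<in> bad_edges then real K else 0))"
    proof (rule sum_mono)
      fix e assume e: "e \<in> [R]\<^bsup>k\<^esup>"
      show "log 2 (real (card (S e))) \<le> edge_weight ?\<theta> (status e) + (if e \<in> bad_edges then real K else 0)"
      proof (cases "e \<in> bad_edges")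
        case True
        have p: "0 < card (S e)" using S e nonempty[OF e] by (auto simp: card_gt_0_iff)
        have "real (card (S e)) \<le> 2 ^ K" using S e by (metis of_nat_le_iff of_nat_numeral of_nat_power)
        then have "log 2 (real (card (S e))) \<le> log 2 (2 ^ K)" using p by (subst log_le_cancel_iff) auto
        also have "\<dots> = real K" by (simp add: log_nat_power)
        finally show ?thesis using True edge_weight_bounds[OF th, of "status e"] by simp
      qed (use log_card_le_weight[OF e] in simp)
    qed
    also have "\<dots> = (\<Sum>e\<in>[R]\<^bsup>k\<^esup>. edge_weight ?\<theta> (status e)) + real (card ([R]\<^bsup>k\<^esup> \<inter> bad_edges)) * real K"
      using finE by (simp add: sum.distrib sum.If_cases)
    also have "\<dots> \<le> (?\<pi> + \<epsilon> / 2) * real (?r choose k) + \<epsilon> / 2 * real (?r choose k)"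
    proof (rule add_mono[OF light])
      have "card ([R]\<^bsup>k\<^esup> \<inter> bad_edges) \<le> card bad"
        unfolding bad_edges using fin_bad by (meson Int_lower2 card_image_le card_mono finite_imageI le_trans)
      then have "real (card ([R]\<^bsup>k\<^esup> \<inter> bad_edges)) \<le> \<gamma> * real ?r ^ k" using few_bad by linarith
      then have "real (card ([R]\<^bsup>k\<^esup> \<inter> bad_edges)) * real K \<le> \<gamma> * real ?r ^ k * (real K + 1)"
        by (intro mult_mono) (use \<gamma> in auto)
      also have "\<dots> = \<epsilon> / 2 * (real ?r / real k) ^ k"
      proof -
        have "real K + 1 \<noteq> 0" by linarith
        then show ?thesis by (simp add: \<gamma>_def power_divide)
      qed
      also have "\<dots> \<le> \<epsilon> / 2 * real (?r choose k)"
        using eps binomial_ge_n_over_k_pow_k[OF bigs(4), where 'a = real] by (intro mult_left_mono) auto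
      finally show "real (card ([R]\<^bsup>k\<^esup> \<inter> bad_edges)) * real K \<le> \<epsilon> / 2 * real (?r choose k)" .
    qed
    finally show "(\<Sum>e\<in>[R]\<^bsup>k\<^esup>. log 2 (real (card (S e)))) \<le> (?\<pi> + \<epsilon>) * real (?r choose k)"
      by (simp add: algebra_simps)
  qed
qed

section \<open>Counting irredundant formulas\<close>

definition edge_states :: "nat set \<Rightarrow> clause set set" where
  "edge_states e = {s. \<forall>C\<in>s. fst ` C = e \<and> inj_on fst C}"

lemma edge_states:
  assumes "finite e" "card e = k"
  shows "finite (edge_states e)" and "card (edge_states e) \<le> 2 ^ (2 ^ (2 * k))"
proof -
  have sub: "edge_states e \<subseteq> Pow (Pow (e \<times> UNIV))"
    unfolding edge_states_def by force
  have fin: "finite (Pow (Pow (e \<times> (UNIV :: bool set))))" using assms by simp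
  then show "finite (edge_states e)" using sub finite_subset by blast
  have "card (Pow (Pow (e \<times> (UNIV :: bool set)))) = 2 ^ (2 ^ (2 * k))"
    using assms by (simp add: card_Pow card_cartesian_product mult.commute)
  then show "card (edge_states e) \<le> 2 ^ (2 ^ (2 * k))" using card_mono[OF fin sub] by simp
qed

lemma entropy_edge_le:
  fixes \<Omega> :: "(nat set \<Rightarrow> clause set) set"
  assumes fin: "finite \<Omega>" and e: "e \<in> [V]\<^bsup>k\<^esup>" and x: "\<forall>x\<in>\<Omega>. x e \<in> edge_states e"
  shows "cond_entropy \<Omega> {e} {} \<le> real (card \<Omega>) * real (2 ^ (2 * k) :: nat)"
proof (cases "\<Omega> = {}")
  case False
  define K :: nat where "K = 2 ^ (2 * k)"
  have st: "finite (edge_states e)" "card (edge_states e) \<le> 2 ^ K"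
    using edge_states[of e k] e by (auto simp: nsets_def K_def)
  have "edge_states e \<noteq> {}" using x False by blast
  then have p: "0 < card (edge_states e)" using st(1) by (simp add: card_gt_0_iff)
  have "real (card (edge_states e)) \<le> 2 ^ K" using st(2) by (metis of_nat_le_iff of_nat_numeral of_nat_power)
  then have "log 2 (real (card (edge_states e))) \<le> log 2 (2 ^ K)" using p by (subst log_le_cancel_iff) auto
  then have "real (card \<Omega>) * log 2 (real (card (edge_states e))) \<le> real (card \<Omega>) * real K"
    by (intro mult_left_mono) (simp_all add: log_nat_power)
  moreover have "cond_entropy \<Omega> {e} {} \<le> real (card \<Omega>) * log 2 (real (card (edge_states e)))"
    by (rule entropy_le_log_card[OF fin st(1)]) (use x in blast)
  ultimately show ?thesis unfolding K_def by linarith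
qed (simp add: cond_entropy_def)

text \<open>Small total correlation makes the frequent states a clause selection, and the selection
  bound applies; large total correlation lets the penalty term absorb the trivial bound. Stating
  this as one inequality linear in the total correlation allows summation over all cells and all
  \<open>R\<close>, with no set of exceptions to track.\<close>

lemma local_entropy_bound:
  fixes k :: nat and \<epsilon> :: real
  assumes k: "k \<ge> 2" and eps: "0 < \<epsilon>"
  shows "\<exists>r\<ge>k. \<exists>L\<ge>0. \<forall>R \<Omega>. finite R \<and> card R = r \<and> finite \<Omega> \<and>
    (\<forall>x\<in>\<Omega>. (\<forall>e\<in>[R]\<^bsup>k\<^esup>. x e \<in> edge_states e) \<and> irredundant (\<Union>e\<in>[R]\<^bsup>k\<^esup>. x e)) \<longrightarrow>
    (\<Sum>e\<in>[R]\<^bsup>k\<^esup>. cond_entropy \<Omega> {e} {}) \<le>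
      (turan_density k (T_pdg k) (log 2 3) + \<epsilon>) * real (r choose k) * real (card \<Omega>) +
      L * ((\<Sum>e\<in>[R]\<^bsup>k\<^esup>. cond_entropy \<Omega> {e} {}) - cond_entropy \<Omega> ([R]\<^bsup>k\<^esup>) {})"
proof -
  let ?\<pi> = "turan_density k (T_pdg k) (log 2 3)"
  define K :: nat where "K = 2 ^ (2 * k)"
  have e2: "0 < \<epsilon> / 2" using eps by simp
  have pi0: "0 \<le> ?\<pi>" by (rule turan_density_nonneg[OF k]) simp
  obtain r0 where r0: "\<forall>R S. clause_selection k R S \<and> r0 \<le> card R \<and>
      (\<forall>e\<in>[R]\<^bsup>k\<^esup>. finite (S e) \<and> card (S e) \<le> 2 ^ K) \<longrightarrow>
      (\<Sum>e\<in>[R]\<^bsup>k\<^esup>. log 2 (real (card (S e)))) \<le> (?\<pi> + \<epsilon> / 2) * real (card R choose k)"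
    using sum_log_card_selection_le[OF k e2, of K] ..
  define r where "r = max r0 k"
  obtain \<delta> where \<delta>: "0 < \<delta>" and freq: "\<forall>(\<Omega> :: (nat set \<Rightarrow> clause set) set) S i. finite \<Omega> \<and> \<Omega> \<noteq> {} \<and>
      finite S \<and> card S \<le> 2 ^ K \<and> (\<forall>x\<in>\<Omega>. x i \<in> S) \<longrightarrow> frequent \<delta> \<Omega> i \<noteq> {} \<and>
      cond_entropy \<Omega> {i} {} \<le> real (card \<Omega>) * (log 2 (real (card (frequent \<delta> \<Omega> i))) + \<epsilon> / 2)"
    using entropy_le_log_frequent[OF e2, of "2 ^ K"] by metis
  define m where "m = r choose k"
  \<comment> \<open>The threshold of \<open>total_correlation_realizes\<close> for the
    \<open>m\<close> coordinates of \<open>R\<close>; \<open>L\<close> is then the trivial bound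
    \<open>K * m\<close> divided by it.\<close>
  define \<eta> where "\<eta> = \<delta> ^ m / ln 2"
  have \<eta>: "0 < \<eta>" using \<delta> by (simp add: \<eta>_def)
  define L where "L = real K * real m / \<eta>"
  have L: "0 \<le> L" using \<eta> by (simp add: L_def)
  have "(\<Sum>e\<in>[R]\<^bsup>k\<^esup>. cond_entropy \<Omega> {e} {}) \<le> (?\<pi> + \<epsilon>) * real (r choose k) * real (card \<Omega>) +
      L * ((\<Sum>e\<in>[R]\<^bsup>k\<^esup>. cond_entropy \<Omega> {e} {}) - cond_entropy \<Omega> ([R]\<^bsup>k\<^esup>) {})"
    if R: "finite R" "card R = r" and fin: "finite \<Omega>"
      and x: "\<forall>x\<in>\<Omega>. (\<forall>e\<in>[R]\<^bsup>k\<^esup>. x e \<in> edge_states e) \<and> irredundant (\<Union>e\<in>[R]\<^bsup>k\<^esup>. x e)" for R \<Omega>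
  proof (cases "\<Omega> = {}")
    case True
    then show ?thesis by (simp add: cond_entropy_def)
  next
    case ne: False
    let ?E = "[R]\<^bsup>k\<^esup>" and ?N = "real (card \<Omega>)"
    have finE: "finite ?E" by (rule finite_imp_finite_nsets[OF R(1)])
    have cardE: "card ?E = m" using R by (simp add: m_def)
    have st: "finite (edge_states e)" "card (edge_states e) \<le> 2 ^ K" if "e \<in> ?E" for e
      using edge_states[of e k] that by (auto simp: nsets_def K_def)
    define TC where "TC = (\<Sum>e\<in>?E. cond_entropy \<Omega> {e} {}) - cond_entropy \<Omega> ?E {}"
    have TC0: "0 \<le> TC" using cond_entropy_le_sum[OF fin finE, of "{}"] by (simp add: TC_def)
    have "(\<Sum>e\<in>?E. cond_entropy \<Omega> {e} {}) \<le> (?\<pi> + \<epsilon>) * real m * ?N + L * TC"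
    proof (cases "TC < ?N * \<eta>")
      case True
      define S where "S e = frequent \<delta> \<Omega> e" for e
      have S_sub: "S e \<subseteq> edge_states e" if "e \<in> ?E" for e
        using x that unfolding S_def frequent_def by blast
      have S_freq: "S e \<noteq> {}" "cond_entropy \<Omega> {e} {} \<le> ?N * (log 2 (real (card (S e))) + \<epsilon> / 2)" if e: "e \<in> ?E" for e
      proof -
        have "\<forall>x\<in>\<Omega>. x e \<in> edge_states e" using x e by blast
        then show "S e \<noteq> {}" "cond_entropy \<Omega> {e} {} \<le> ?N * (log 2 (real (card (S e))) + \<epsilon> / 2)"
          using freq[rule_format, of \<Omega> "edge_states e" e] fin ne st[OF e] unfolding S_def by blast+
      qed
      have sel: "clause_selection k R S"
      proof
        fix e s C assume "e \<in> ?E" "s \<in> S e" "C \<in> s"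
        then show "fst ` C = e \<and> inj_on fst C" using S_sub[of e] unfolding edge_states_def by blast
      next
        fix \<sigma> assume \<sigma>: "\<forall>e\<in>?E. \<sigma> e \<in> S e"
        have "\<exists>x\<in>\<Omega>. \<forall>e\<in>?E. x e = \<sigma> e"
          by (rule total_correlation_realizes[OF fin ne finE \<delta>])
            (use \<sigma> True R in \<open>auto simp: S_def TC_def \<eta>_def m_def\<close>)
        then obtain y where y: "y \<in> \<Omega>" "\<forall>e\<in>?E. y e = \<sigma> e" by blast
        then have "(\<Union>e\<in>?E. \<sigma> e) = (\<Union>e\<in>?E. y e)" by simp
        then show "irredundant (\<Union>e\<in>?E. \<sigma> e)" using x y(1) by simp
      qed (use k R S_freq in auto)
      have "\<forall>e\<in>?E. finite (S e) \<and> card (S e) \<le> 2 ^ K"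
      proof
        fix e assume e: "e \<in> ?E"
        show "finite (S e) \<and> card (S e) \<le> 2 ^ K"
          using finite_subset[OF S_sub[OF e] st(1)[OF e]] card_mono[OF st(1)[OF e] S_sub[OF e]] st(2)[OF e] by simp
      qed
      then have logs: "(\<Sum>e\<in>?E. log 2 (real (card (S e)))) \<le> (?\<pi> + \<epsilon> / 2) * real m"
        using r0[rule_format, of R S] sel R by (simp add: r_def m_def)
      have "(\<Sum>e\<in>?E. cond_entropy \<Omega> {e} {}) \<le> (\<Sum>e\<in>?E. ?N * (log 2 (real (card (S e))) + \<epsilon> / 2))"
        by (intro sum_mono S_freq(2))
      also have "\<dots> = ?N * ((\<Sum>e\<in>?E. log 2 (real (card (S e)))) + real m * (\<epsilon> / 2))"
        by (simp only: sum_distrib_left[symmetric] sum.distrib sum_constant cardE)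
      also have "\<dots> \<le> ?N * ((?\<pi> + \<epsilon> / 2) * real m + real m * (\<epsilon> / 2))"
        using logs by (intro mult_left_mono add_mono) auto
      also have "\<dots> = (?\<pi> + \<epsilon>) * real m * ?N" by (simp add: algebra_simps)
      also have "\<dots> \<le> \<dots> + L * TC" using L TC0 by simp
      finally show ?thesis .
    next
      case False
      have "(\<Sum>e\<in>?E. cond_entropy \<Omega> {e} {}) \<le> (\<Sum>e\<in>?E. ?N * real K)"
        unfolding K_def by (intro sum_mono entropy_edge_le[OF fin]) (use x in auto)
      also have "\<dots> = L * (?N * \<eta>)" using \<eta> R by (simp add: L_def m_def)
      also have "\<dots> \<le> L * TC" using False L by (intro mult_left_mono) auto
      also have "\<dots> \<le> (?\<pi> + \<epsilon>) * real m * ?N + L * TC" using pi0 eps by simp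
      finally show ?thesis .
    qed
    then show ?thesis by (simp add: TC_def m_def)
  qed
  moreover have "k \<le> r" by (simp add: r_def)
  ultimately show ?thesis using L by blast
qed

text \<open>Energy increment: a bounded nonnegative potential cannot drop by \<open>c\<close> too often.\<close>

lemma exists_stable_set:
  fixes F :: "'a set \<Rightarrow> real"
  assumes F0: "\<And>U. 0 \<le> F U" and FT: "F {} \<le> c * real T" and c: "0 < c"
  shows "\<exists>U\<subseteq>V. finite U \<and> card U \<le> T * j \<and> (\<forall>W\<in>[V]\<^bsup>j\<^esup>. F U - F (U \<union> W) \<le> c)"
proof (rule ccontr)
  assume no: "\<not> ?thesis"
  have step: "\<exists>W\<in>[V]\<^bsup>j\<^esup>. c < F U - F (U \<union> W)" if "U \<subseteq> V" "finite U" "card U \<le> T * j" for U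
    using no that by (auto simp: not_le)
  have "\<exists>U\<subseteq>V. finite U \<and> card U \<le> t * j \<and> F U \<le> F {} - real t * c" if "t \<le> T" for t
    using that
  proof (induction t)
    case 0
    then show ?case by (intro exI[of _ "{}"]) auto
  next
    case (Suc t)
    then obtain U where U: "U \<subseteq> V" "finite U" "card U \<le> t * j" "F U \<le> F {} - real t * c" by auto
    have "t * j \<le> T * j" using Suc.prems by simp
    then have "card U \<le> T * j" using U(3) by (rule order_trans[rotated])
    then obtain W where W: "W \<in> [V]\<^bsup>j\<^esup>" "c < F U - F (U \<union> W)" using step[OF U(1,2)] by blast
    have "card (U \<union> W) \<le> card U + card W" by (rule card_Un_le)
    then have "card (U \<union> W) \<le> Suc t * j" using U(3) W(1) by (simp add: nsets_def)
    then show ?case using U W by (intro exI[of _ "U \<union> W"]) (auto simp: nsets_def algebra_simps)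
  qed
  from this[OF order_refl] obtain U where U: "U \<subseteq> V" "finite U" "card U \<le> T * j" "F U \<le> F {} - real T * c" by blast
  obtain W where "c < F U - F (U \<union> W)" using step[OF U(1-3)] by blast
  then show False using F0[of "U \<union> W"] U(4) FT c by (simp add: algebra_simps)
qed

text \<open>Compares the number of all candidate sets \<open>W\<close> with the number of extensions
  of a fixed \<open>k\<close>-set to an \<open>r\<close>-set. The ratio is bounded independently of
  \<open>n\<close>.\<close>

lemma binomial_ratio_bound:
  fixes n k j :: nat
  assumes "2 * k \<le> n" "j + k \<le> n"
  shows "real (n choose j) \<le> real (2 * j) ^ j * real ((n - k) choose j)"
proof (cases "j = 0")
  case False
  have "n choose j \<le> n ^ j" using assms by (intro binomial_le_pow) simp
  then have "real (n choose j) \<le> real n ^ j" by (metis of_nat_le_iff of_nat_power)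
  also have "\<dots> \<le> (real (2 * j) * (real (n - k) / real j)) ^ j"
  proof (rule power_mono)
    have "real n \<le> 2 * real (n - k)" using assms by (simp add: of_nat_diff)
    then show "real n \<le> real (2 * j) * (real (n - k) / real j)" using False by simp
  qed simp
  also have "\<dots> = real (2 * j) ^ j * (real (n - k) / real j) ^ j" by (rule power_mult_distrib)
  also have "\<dots> \<le> real (2 * j) ^ j * real ((n - k) choose j)"
    using assms by (intro mult_left_mono binomial_ge_n_over_k_pow_k) auto
  finally show ?thesis .
qed simp

section \<open>Conditioning on a bounded set of variables\<close>

definition touching :: "nat \<Rightarrow> nat set \<Rightarrow> nat set \<Rightarrow> nat set set" where
  "touching k V U = {e \<in> [V]\<^bsup>k\<^esup>. e \<inter> U \<noteq> {}}"

lemma card_touching_le: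
  assumes fin: "finite V" and U: "U \<subseteq> V" and k: "0 < k" and V: "0 < card V"
  shows "real (card (touching k V U)) \<le> real (card U) * (real k * real (card V choose k) / real (card V))"
proof -
  have finU: "finite U" using U fin finite_subset by blast
  have "touching k V U = (\<Union>u\<in>U. {e \<in> [V]\<^bsup>k\<^esup>. {u} \<subseteq> e})" by (auto simp: touching_def)
  then have "card (touching k V U) \<le> (\<Sum>u\<in>U. card {e \<in> [V]\<^bsup>k\<^esup>. {u} \<subseteq> e})"
    using card_UN_le[OF finU] by simp
  also have "\<dots> = (\<Sum>u\<in>U. (card V - 1) choose (k - 1))"
  proof (rule sum.cong[OF HOL.refl])
    fix u assume "u \<in> U"
    then show "card {e \<in> [V]\<^bsup>k\<^esup>. {u} \<subseteq> e} = (card V - 1) choose (k - 1)"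
      using card_nsets_supersets[OF fin, of "{u}" k] U k by auto
  qed
  finally have "card (touching k V U) \<le> card U * ((card V - 1) choose (k - 1))" by simp
  then have "real (card (touching k V U)) \<le> real (card U) * real ((card V - 1) choose (k - 1))"
    by (metis of_nat_le_iff of_nat_mult)
  also have "real ((card V - 1) choose (k - 1)) = real k * real (card V choose k) / real (card V)"
  proof -
    have "k * (card V choose k) = card V * ((card V - 1) choose (k - 1))"
      by (rule times_binomial_minus1_eq[OF k])
    then have "real k * real (card V choose k) = real (card V) * real ((card V - 1) choose (k - 1))"
      by (metis of_nat_mult)
    then show ?thesis using V by simp
  qed
  finally show ?thesis .
qed

text \<open>The total correlation on \<open>R\<close> is at most the sum of the losses of each
  \<open>e\<close> when the other \<open>k\<close>-subsets of \<open>R\<close> are revealed.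
  Revealing everything that touches \<open>R - e\<close> loses at least as much, and summed over
  \<open>e\<close> this is a drop of \<open>h\<close>.\<close>

lemma sum_total_correlation_le:
  assumes fin: "finite \<Omega>" and V: "finite V" and kr: "k \<le> r"
  defines "Z \<equiv> touching k V"
  defines "h \<equiv> \<lambda>U. \<Sum>e\<in>[V]\<^bsup>k\<^esup>. cond_entropy \<Omega> {e} (Z U)"
  assumes stable: "\<And>W. W \<in> nsets V (r - k) \<Longrightarrow> h U - h (U \<union> W) \<le> c"
  shows "(\<Sum>R\<in>[V]\<^bsup>r\<^esup>. (\<Sum>e\<in>[R]\<^bsup>k\<^esup>. cond_entropy \<Omega> {e} (Z U)) - cond_entropy \<Omega> ([R]\<^bsup>k\<^esup>) (Z U))
    \<le> real (card V choose (r - k)) * c"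
proof -
  define D where "D e W = cond_entropy \<Omega> {e} (Z U) - cond_entropy \<Omega> {e} (Z (U \<union> W))" for e W
  have Zmono: "Z U \<subseteq> Z (U \<union> W)" for W by (auto simp: Z_def touching_def)
  have D0: "0 \<le> D e W" for e W using cond_entropy_antimono[OF fin Zmono] by (simp add: D_def)
  have "(\<Sum>R\<in>[V]\<^bsup>r\<^esup>. (\<Sum>e\<in>[R]\<^bsup>k\<^esup>. cond_entropy \<Omega> {e} (Z U)) - cond_entropy \<Omega> ([R]\<^bsup>k\<^esup>) (Z U))
      \<le> (\<Sum>R\<in>[V]\<^bsup>r\<^esup>. \<Sum>e\<in>[R]\<^bsup>k\<^esup>. D e (R - e))"
  proof (rule sum_mono)
    fix R assume R: "R \<in> [V]\<^bsup>r\<^esup>"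
    have RV: "R \<subseteq> V" and finR: "finite R" using R by (auto simp: nsets_def)
    have "(\<Sum>e\<in>[R]\<^bsup>k\<^esup>. cond_entropy \<Omega> {e} (Z (U \<union> (R - e)))) \<le>
        (\<Sum>e\<in>[R]\<^bsup>k\<^esup>. cond_entropy \<Omega> {e} ([R]\<^bsup>k\<^esup> - {e} \<union> Z U))"
    proof (rule sum_mono)
      fix e assume e: "e \<in> [R]\<^bsup>k\<^esup>"
      have "e' \<in> Z (U \<union> (R - e))" if e': "e' \<in> [R]\<^bsup>k\<^esup>" "e' \<noteq> e" for e'
      proof -
        have "\<not> e' \<subseteq> e"
        proof
          assume "e' \<subseteq> e"
          then have "e' = e" using e e' by (intro card_subset_eq) (auto simp: nsets_def)
          then show False using e' by simp
        qed
        then have "e' \<inter> (R - e) \<noteq> {}" using e' by (auto simp: nsets_def)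
        then show ?thesis using e' RV by (auto simp: Z_def touching_def nsets_def)
      qed
      then have "[R]\<^bsup>k\<^esup> - {e} \<union> Z U \<subseteq> Z (U \<union> (R - e))" using Zmono by blast
      then show "cond_entropy \<Omega> {e} (Z (U \<union> (R - e))) \<le> cond_entropy \<Omega> {e} ([R]\<^bsup>k\<^esup> - {e} \<union> Z U)"
        by (rule cond_entropy_antimono[OF fin])
    qed
    also have "\<dots> \<le> cond_entropy \<Omega> ([R]\<^bsup>k\<^esup>) (Z U)"
      by (rule cond_entropy_ge_sum[OF fin finite_imp_finite_nsets[OF finR]])
    finally show "(\<Sum>e\<in>[R]\<^bsup>k\<^esup>. cond_entropy \<Omega> {e} (Z U)) - cond_entropy \<Omega> ([R]\<^bsup>k\<^esup>) (Z U)
        \<le> (\<Sum>e\<in>[R]\<^bsup>k\<^esup>. D e (R - e))"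
      by (simp add: D_def sum_subtractf)
  qed
  also have "\<dots> = (\<Sum>(R, e)\<in>Sigma ([V]\<^bsup>r\<^esup>) (\<lambda>R. [R]\<^bsup>k\<^esup>). D e (R - e))"
    using V by (intro sum.Sigma) (auto simp: nsets_def)
  \<comment> \<open>A pair \<open>(R, e)\<close> is recovered from \<open>(R - e, e)\<close>. Since
    all losses are nonnegative, the sum may be extended to every pair \<open>(W, e)\<close>, after
    which \<open>e\<close> ranges freely and \<open>h\<close> appears.\<close>
  also have "\<dots> = (\<Sum>(W, e)\<in>(\<lambda>(R, e). (R - e, e)) ` Sigma ([V]\<^bsup>r\<^esup>) (\<lambda>R. [R]\<^bsup>k\<^esup>). D e W)"
  proof (subst sum.reindex)
    show "inj_on (\<lambda>(R, e). (R - e, e)) (Sigma ([V]\<^bsup>r\<^esup>) (\<lambda>R. [R]\<^bsup>k\<^esup>))"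
      by (rule inj_on_inverseI[where g = "\<lambda>(W, e). (W \<union> e, e)"]) (auto simp: nsets_def)
  qed (auto intro: sum.cong)
  also have "\<dots> \<le> (\<Sum>(W, e)\<in>nsets V (r - k) \<times> [V]\<^bsup>k\<^esup>. D e W)"
  proof (rule sum_mono2)
    show "finite (nsets V (r - k) \<times> [V]\<^bsup>k\<^esup>)" using V by (simp add: finite_imp_finite_nsets)
    show "(\<lambda>(R, e). (R - e, e)) ` Sigma ([V]\<^bsup>r\<^esup>) (\<lambda>R. [R]\<^bsup>k\<^esup>) \<subseteq> nsets V (r - k) \<times> [V]\<^bsup>k\<^esup>"
      by (auto simp: nsets_def card_Diff_subset)
  qed (use D0 in auto)
  also have "\<dots> = (\<Sum>W\<in>nsets V (r - k). h U - h (U \<union> W))"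
    by (simp add: sum.cartesian_product[symmetric] D_def sum_subtractf h_def)
  also have "\<dots> \<le> (\<Sum>W\<in>nsets V (r - k). c)" by (intro sum_mono stable)
  also have "\<dots> = real (card V choose (r - k)) * c" by simp
  finally show ?thesis .
qed

text \<open>The three errors \<epsilon> pay for the local bound, for the correlation left after
  stabilising \<open>U\<close>, and for the coordinates touching \<open>U\<close>.\<close>

lemma log_card_family_le:
  fixes k :: nat and \<epsilon> :: real
  assumes k: "k \<ge> 2" and eps: "0 < \<epsilon>"
  shows "\<exists>n0. \<forall>V \<Omega>. finite V \<and> n0 \<le> card V \<and> finite \<Omega> \<and> \<Omega> \<noteq> {} \<and>
    (\<forall>x\<in>\<Omega>. (\<forall>e\<in>[V]\<^bsup>k\<^esup>. x e \<in> edge_states e) \<and> irredundant (\<Union>e\<in>[V]\<^bsup>k\<^esup>. x e)) \<and>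
    (\<forall>x\<in>\<Omega>. \<forall>y\<in>\<Omega>. (\<forall>e\<in>[V]\<^bsup>k\<^esup>. y e = x e) \<longrightarrow> y = x) \<longrightarrow>
    log 2 (real (card \<Omega>)) \<le> (turan_density k (T_pdg k) (log 2 3) + 3 * \<epsilon>) * real (card V choose k)"
proof -
  let ?\<pi> = "turan_density k (T_pdg k) (log 2 3)"
  define K :: nat where "K = 2 ^ (2 * k)"
  obtain r L where r: "k \<le> r" and L: "0 \<le> L" and loc: "\<forall>R \<Omega>. finite R \<and> card R = r \<and> finite \<Omega> \<and>
      (\<forall>x\<in>\<Omega>. (\<forall>e\<in>[R]\<^bsup>k\<^esup>. x e \<in> edge_states e) \<and> irredundant (\<Union>e\<in>[R]\<^bsup>k\<^esup>. x e)) \<longrightarrow>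
      (\<Sum>e\<in>[R]\<^bsup>k\<^esup>. cond_entropy \<Omega> {e} {}) \<le> (?\<pi> + \<epsilon>) * real (r choose k) * real (card \<Omega>) +
      L * ((\<Sum>e\<in>[R]\<^bsup>k\<^esup>. cond_entropy \<Omega> {e} {}) - cond_entropy \<Omega> ([R]\<^bsup>k\<^esup>) {})"
    using local_entropy_bound[OF k eps] by metis
  define j where "j = r - k"
  define B where "B = real (2 * j) ^ j"
  \<comment> \<open>Number of increments: with steps of size \<open>M * ?N * K / T\<close> the
    leftover correlation, magnified by \<open>L * B\<close>, costs at most
    \<open>\<epsilon> * M * ?N\<close>.\<close>
  define T where "T = nat \<lceil>L * B * real K / \<epsilon>\<rceil> + 1"
  have B0: "0 \<le> B" by (simp add: B_def)
  have T0: "0 < real T" by (simp add: T_def)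
  have T: "L * B * real K / real T \<le> \<epsilon>"
  proof -
    have "L * B * real K / \<epsilon> \<le> real T" unfolding T_def by linarith
    then show ?thesis using eps T0 by (simp add: field_simps)
  qed
  \<comment> \<open>\<open>U\<close> has at most \<open>T * j\<close> elements, so the coordinates
    touching it form a fraction of at most \<open>T * j * k / n\<close> of all; this bound on
    \<open>n\<close> makes their entropy negligible.\<close>
  define n0 where "n0 = max (2 * k + r) (nat \<lceil>real (T * j * k * K) / \<epsilon>\<rceil> + 1)"
  have "log 2 (real (card \<Omega>)) \<le> (?\<pi> + 3 * \<epsilon>) * real (card V choose k)"
    if V: "finite V" "n0 \<le> card V" and fin: "finite \<Omega>" and ne: "\<Omega> \<noteq> {}"
      and x: "\<forall>x\<in>\<Omega>. (\<forall>e\<in>[V]\<^bsup>k\<^esup>. x e \<in> edge_states e) \<and> irredundant (\<Union>e\<in>[V]\<^bsup>k\<^esup>. x e)"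
      and inj: "\<forall>x\<in>\<Omega>. \<forall>y\<in>\<Omega>. (\<forall>e\<in>[V]\<^bsup>k\<^esup>. y e = x e) \<longrightarrow> y = x" for V \<Omega>
  proof -
    let ?n = "card V" and ?N = "real (card \<Omega>)" and ?E = "[V]\<^bsup>k\<^esup>"
    have N: "0 < ?N" using fin ne by (simp add: card_gt_0_iff)
    have n: "2 * k + r \<le> ?n" and n': "real (T * j * k * K) / \<epsilon> \<le> real ?n"
      using V(2) unfolding n0_def by linarith+
    have n_pos: "0 < ?n" using n k by linarith
    define M where "M = real (?n choose k)"
    have M: "0 < M" using n by (simp add: M_def zero_less_binomial)
    have finE: "finite ?E" by (rule finite_imp_finite_nsets[OF V(1)])
    define Z where "Z = touching k V"
    have ZE: "Z U \<subseteq> ?E" for U by (auto simp: Z_def touching_def)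
    have single: "cond_entropy \<Omega> {e} {} \<le> ?N * real K" if e: "e \<in> ?E" for e
      unfolding K_def by (rule entropy_edge_le[OF fin e]) (use x e in blast)
    define h where "h U = (\<Sum>e\<in>?E. cond_entropy \<Omega> {e} (Z U))" for U
    define c where "c = M * ?N * real K / real T"
    have c: "0 < c" using M N T0 by (simp add: c_def K_def)
    have h0: "0 \<le> h U" for U unfolding h_def by (intro sum_nonneg cond_entropy_nonneg fin)
    have "h {} = (\<Sum>e\<in>?E. cond_entropy \<Omega> {e} {})" by (simp add: h_def Z_def touching_def)
    also have "\<dots> \<le> (\<Sum>e\<in>?E. ?N * real K)" by (intro sum_mono single)
    also have "\<dots> = c * real T" using T0 by (simp add: c_def M_def)
    finally have hT: "h {} \<le> c * real T" .
    obtain U where U: "U \<subseteq> V" "card U \<le> T * j" and stable: "\<forall>W\<in>[V]\<^bsup>j\<^esup>. h U - h (U \<union> W) \<le> c"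
      using exists_stable_set[of h, OF h0 hT c, of V j] by blast
    define tc where "tc R = (\<Sum>e\<in>[R]\<^bsup>k\<^esup>. cond_entropy \<Omega> {e} (Z U)) - cond_entropy \<Omega> ([R]\<^bsup>k\<^esup>) (Z U)" for R
    have tc: "(\<Sum>R\<in>[V]\<^bsup>r\<^esup>. tc R) \<le> real (?n choose j) * c"
      unfolding tc_def j_def Z_def
      by (rule sum_total_correlation_le[OF fin V(1) r]) (use stable in \<open>auto simp: h_def Z_def j_def\<close>)
    have local: "(\<Sum>e\<in>[R]\<^bsup>k\<^esup>. cond_entropy \<Omega> {e} (Z U)) \<le> (?\<pi> + \<epsilon>) * real (r choose k) * ?N + L * tc R"
      if R: "R \<in> [V]\<^bsup>r\<^esup>" for R
    proof -
      let ?C = "cell \<Omega> (Z U) ` \<Omega>"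
      have finC: "finite c" if "c \<in> ?C" for c using that finite_cell[OF fin] by blast
      have sub: "[R]\<^bsup>k\<^esup> \<subseteq> ?E" using R by (auto simp: nsets_def)
      have "(\<Sum>e\<in>[R]\<^bsup>k\<^esup>. cond_entropy \<Omega> {e} (Z U)) = (\<Sum>e\<in>[R]\<^bsup>k\<^esup>. \<Sum>c\<in>?C. cond_entropy c {e} {})"
        by (intro sum.cong HOL.refl cond_entropy_cells fin)
      also have "\<dots> = (\<Sum>c\<in>?C. \<Sum>e\<in>[R]\<^bsup>k\<^esup>. cond_entropy c {e} {})" by (rule sum.swap)
      finally have split: "(\<Sum>e\<in>[R]\<^bsup>k\<^esup>. cond_entropy \<Omega> {e} (Z U)) = (\<Sum>c\<in>?C. \<Sum>e\<in>[R]\<^bsup>k\<^esup>. cond_entropy c {e} {})" .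
      have "(\<Sum>c\<in>?C. \<Sum>e\<in>[R]\<^bsup>k\<^esup>. cond_entropy c {e} {}) \<le>
        (\<Sum>c\<in>?C. (?\<pi> + \<epsilon>) * real (r choose k) * real (card c) +
          L * ((\<Sum>e\<in>[R]\<^bsup>k\<^esup>. cond_entropy c {e} {}) - cond_entropy c ([R]\<^bsup>k\<^esup>) {}))"
      proof (rule sum_mono)
        fix c assume cC: "c \<in> ?C"
        then have "c \<subseteq> \<Omega>" using cell_subset by blast
        have "(\<forall>e\<in>[R]\<^bsup>k\<^esup>. y e \<in> edge_states e) \<and> irredundant (\<Union>e\<in>[R]\<^bsup>k\<^esup>. y e)" if "y \<in> c" for y
        proof -
          have "y \<in> \<Omega>" using that \<open>c \<subseteq> \<Omega>\<close> by blast
          then have y: "\<forall>e\<in>?E. y e \<in> edge_states e" "irredundant (\<Union>e\<in>?E. y e)" using x by blast+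
          have "(\<Union>e\<in>[R]\<^bsup>k\<^esup>. y e) \<subseteq> (\<Union>e\<in>?E. y e)" using sub by blast
          then show ?thesis using y sub irredundant_subset by blast
        qed
        moreover have "finite R" "card R = r" using R by (auto simp: nsets_def)
        ultimately show "(\<Sum>e\<in>[R]\<^bsup>k\<^esup>. cond_entropy c {e} {}) \<le> (?\<pi> + \<epsilon>) * real (r choose k) * real (card c) +
          L * ((\<Sum>e\<in>[R]\<^bsup>k\<^esup>. cond_entropy c {e} {}) - cond_entropy c ([R]\<^bsup>k\<^esup>) {})"
          using loc[rule_format, of R c] finC[OF cC] by simp
      qed
      also have "\<dots> = (?\<pi> + \<epsilon>) * real (r choose k) * (\<Sum>c\<in>?C. real (card c)) +
          L * ((\<Sum>c\<in>?C. \<Sum>e\<in>[R]\<^bsup>k\<^esup>. cond_entropy c {e} {}) - (\<Sum>c\<in>?C. cond_entropy c ([R]\<^bsup>k\<^esup>) {}))"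
        by (simp only: sum.distrib sum_distrib_left[symmetric] sum_subtractf)
      also have "(\<Sum>c\<in>?C. real (card c)) = ?N"
        using sum_card_cells[OF fin, of "Z U"] by (metis of_nat_sum)
      also have "(\<Sum>c\<in>?C. cond_entropy c ([R]\<^bsup>k\<^esup>) {}) = cond_entropy \<Omega> ([R]\<^bsup>k\<^esup>) (Z U)"
        by (rule cond_entropy_cells[OF fin, symmetric])
      finally show ?thesis unfolding split[symmetric] tc_def .
    qed
    define A where "A = real ((?n - k) choose j)"
    have A: "0 < A" using n r by (auto simp: A_def j_def zero_less_binomial)
    \<comment> \<open>Every \<open>k\<close>-set lies in \<open>A\<close> of the
      \<open>r\<close>-sets, so the local bounds average to a bound on the global potential.\<close>
    have "A * h U = (\<Sum>R\<in>[V]\<^bsup>r\<^esup>. \<Sum>e\<in>[R]\<^bsup>k\<^esup>. cond_entropy \<Omega> {e} (Z U))"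
      unfolding sum_nsets_nsets[OF V(1) r] A_def j_def h_def ..
    also have "\<dots> \<le> (\<Sum>R\<in>[V]\<^bsup>r\<^esup>. (?\<pi> + \<epsilon>) * real (r choose k) * ?N + L * tc R)"
      by (intro sum_mono local)
    also have "\<dots> = (?\<pi> + \<epsilon>) * ?N * (real (?n choose r) * real (r choose k)) + L * (\<Sum>R\<in>[V]\<^bsup>r\<^esup>. tc R)"
      by (simp add: sum.distrib sum_distrib_left)
    also have "real (?n choose r) * real (r choose k) = M * A"
      unfolding A_def M_def j_def of_nat_mult[symmetric] using choose_mult[OF r, of ?n] n by simp
    also have "L * (\<Sum>R\<in>[V]\<^bsup>r\<^esup>. tc R) \<le> L * (B * A * c)"
    proof (rule mult_left_mono[OF _ L])
      have "real (?n choose j) \<le> B * A"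
        unfolding A_def B_def using n r by (intro binomial_ratio_bound) (auto simp: j_def)
      then have "real (?n choose j) * c \<le> B * A * c" using c by (intro mult_right_mono) auto
      then show "(\<Sum>R\<in>[V]\<^bsup>r\<^esup>. tc R) \<le> B * A * c" using tc by linarith
    qed
    finally have "A * h U \<le> A * ((?\<pi> + \<epsilon>) * ?N * M + L * B * c)"
      by (simp add: algebra_simps)
    then have "h U \<le> (?\<pi> + \<epsilon>) * ?N * M + L * B * c"
      by (rule mult_left_le_imp_le[OF _ A])
    also have "L * B * c = (L * B * real K / real T) * (M * ?N)" by (simp add: c_def)
    also have "\<dots> \<le> \<epsilon> * (M * ?N)" using T M N by (intro mult_right_mono) auto
    finally have hU: "h U \<le> ?N * ((?\<pi> + 2 * \<epsilon>) * M)" by (simp add: algebra_simps)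
    have "real (card (Z U)) * real K \<le> \<epsilon> * M"
    proof -
      have "real (card (Z U)) \<le> real (card U) * (real k * M / real ?n)"
        unfolding Z_def M_def by (rule card_touching_le[OF V(1) U(1) _ n_pos]) (use k in simp)
      also have "\<dots> \<le> real (T * j) * (real k * M / real ?n)"
        using U(2) M by (intro mult_right_mono) (auto simp flip: of_nat_mult)
      finally have "real (card (Z U)) * real K \<le> real (T * j) * (real k * M / real ?n) * real K"
        by (intro mult_right_mono) auto
      also have "\<dots> = real (T * j * k * K) / real ?n * M" by simp
      also have "\<dots> \<le> \<epsilon> * M"
      proof (rule mult_right_mono)
        show "real (T * j * k * K) / real ?n \<le> \<epsilon>" using n' n_pos eps by (simp add: field_simps)
      qed (use M in simp)
      finally show ?thesis .
    qed
    then have touch: "?N * (real (card (Z U)) * real K) \<le> ?N * (\<epsilon> * M)" by (intro mult_left_mono) auto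
    \<comment> \<open>The coordinates determine the element, so the full entropy is the logarithm to
      be bounded. The chain rule splits it into the touching coordinates and the rest.\<close>
    have "?N * log 2 ?N = cond_entropy \<Omega> (Z U \<union> ?E) {}"
    proof -
      have "Z U \<union> ?E = ?E" using ZE by blast
      moreover have "cond_entropy \<Omega> ?E {} = ?N * log 2 ?N" by (rule entropy_full[OF fin]) (use inj in blast)
      ultimately show ?thesis by simp
    qed
    also have "\<dots> = cond_entropy \<Omega> (Z U) {} + cond_entropy \<Omega> ?E (Z U \<union> {})" by (rule cond_entropy_chain[OF fin])
    also have "\<dots> \<le> ?N * (real (card (Z U)) * real K) + h U"
    proof (rule add_mono)
      have finZ: "finite (Z U)" using ZE finE finite_subset by blast
      have "cond_entropy \<Omega> (Z U) {} \<le> (\<Sum>e\<in>Z U. cond_entropy \<Omega> {e} {})" by (rule cond_entropy_le_sum[OF fin finZ])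
      also have "\<dots> \<le> (\<Sum>e\<in>Z U. ?N * real K)" using ZE by (intro sum_mono single) auto
      finally show "cond_entropy \<Omega> (Z U) {} \<le> ?N * (real (card (Z U)) * real K)" by (simp add: mult.left_commute)
      show "cond_entropy \<Omega> ?E (Z U \<union> {}) \<le> h U"
        unfolding h_def Un_empty_right by (rule cond_entropy_le_sum[OF fin finE])
    qed
    also have "\<dots> \<le> ?N * (\<epsilon> * M) + ?N * ((?\<pi> + 2 * \<epsilon>) * M)" by (rule add_mono[OF touch hU])
    also have "\<dots> = ?N * ((?\<pi> + 3 * \<epsilon>) * M)" by (simp add: algebra_simps)
    finally show ?thesis unfolding M_def by (rule mult_left_le_imp_le[OF _ N])
  qed
  then show ?thesis by blast
qed

section \<open>From \<open>k\<close>-SAT functions to irredundant formulas\<close>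

lemma finite_clauses: "finite (clauses k n)"
  by (rule finite_subset[of _ "Pow ({1..n} \<times> UNIV)"]) (auto simp: clauses_def)

lemma clause_vars:
  assumes "C \<in> clauses k n"
  shows "fst ` C \<in> [{1..n}]\<^bsup>k\<^esup>"
proof -
  have C: "C \<subseteq> {1..n} \<times> UNIV" "card C = k" "inj_on fst C" using assms by (auto simp: clauses_def)
  have "finite C" by (rule finite_subset[OF C(1)]) simp
  then show ?thesis using C by (auto simp: nsets_def card_image)
qed

lemma ksat_functions_subset_irredundant:
  "ksat_functions k n \<subseteq>
    (\<lambda>\<Phi>. restrict (formula_true \<Phi>) (assignments n)) ` {\<Phi>. \<Phi> \<subseteq> clauses k n \<and> irredundant \<Phi>}"
proof
  fix f assume "f \<in> ksat_functions k n"
  then have f: "f \<in> assignments n \<rightarrow>\<^sub>E UNIV"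
    and ex: "\<exists>\<Phi>. \<Phi> \<subseteq> clauses k n \<and> (\<forall>a\<in>assignments n. f a = formula_true \<Phi> a)"
    by (auto simp: ksat_functions_def)
  define rep where "rep \<Phi> \<longleftrightarrow> \<Phi> \<subseteq> clauses k n \<and> (\<forall>a\<in>assignments n. f a = formula_true \<Phi> a)" for \<Phi>
  obtain \<Psi> where "rep \<Psi>" using ex unfolding rep_def by blast
  from ex_has_least_nat[of rep, OF this, of card] obtain \<Phi> where "rep \<Phi>" and least: "\<And>\<Psi>. rep \<Psi> \<Longrightarrow> card \<Phi> \<le> card \<Psi>"
    by blast
  then have \<Phi>: "\<Phi> \<subseteq> clauses k n" "\<forall>a\<in>assignments n. f a = formula_true \<Phi> a" by (simp_all add: rep_def)
  have finP: "finite \<Phi>" using \<Phi>(1) finite_clauses finite_subset by blast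
  have "irredundant \<Phi>"
    unfolding irredundant_def
  proof
    fix C assume C: "C \<in> \<Phi>"
    \<comment> \<open>By minimality, dropping \<open>C\<close> changes the function at some
      assignment, where \<open>C\<close> is then the only true clause.\<close>
    have "card (\<Phi> - {C}) < card \<Phi>" by (rule card_Diff1_less[OF finP C])
    then have "\<not> rep (\<Phi> - {C})" using least[of "\<Phi> - {C}"] by linarith
    then obtain a where a: "a \<in> assignments n" "f a \<noteq> formula_true (\<Phi> - {C}) a"
      using \<Phi>(1) unfolding rep_def by blast
    then have "formula_true \<Phi> a \<noteq> formula_true (\<Phi> - {C}) a" using \<Phi>(2) by simp
    then show "\<exists>a. (\<forall>l\<in>C. literal_true a l) \<and> (\<forall>C'\<in>\<Phi>. (\<forall>l\<in>C'. literal_true a l) \<longrightarrow> C' = C)"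
      unfolding formula_true_def by (intro exI[of _ a]) blast
  qed
  moreover have "f = restrict (formula_true \<Phi>) (assignments n)"
    by (rule PiE_ext[OF f]) (use \<Phi>(2) in auto)
  ultimately show "f \<in> (\<lambda>\<Phi>. restrict (formula_true \<Phi>) (assignments n)) ` {\<Phi>. \<Phi> \<subseteq> clauses k n \<and> irredundant \<Phi>}"
    using \<Phi>(1) by blast
qed

lemma card_ksat_functions_le:
  "card (ksat_functions k n) \<le> card {\<Phi>. \<Phi> \<subseteq> clauses k n \<and> irredundant \<Phi>}"
proof -
  have "finite {\<Phi>. \<Phi> \<subseteq> clauses k n \<and> irredundant \<Phi>}"
    by (rule finite_subset[of _ "Pow (clauses k n)"]) (auto simp: finite_clauses)
  then show ?thesis
    using card_mono[OF _ ksat_functions_subset_irredundant] card_image_le by (meson finite_imageI le_trans)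
qed

text \<open>Sorting the clauses of a formula by their variable sets turns it into a vector indexed
  by \<open>k\<close>-sets, and the union of the entries recovers the formula.\<close>

lemma log_card_irredundant_le:
  fixes k :: nat and \<epsilon> :: real
  assumes k: "k \<ge> 2" and eps: "0 < \<epsilon>"
  shows "\<exists>n0. \<forall>n\<ge>n0. log 2 (real (card {\<Phi>. \<Phi> \<subseteq> clauses k n \<and> irredundant \<Phi>})) \<le>
    (turan_density k (T_pdg k) (log 2 3) + \<epsilon>) * real (n choose k)"
proof -
  have "0 < \<epsilon> / 3" using eps by simp
  from log_card_family_le[OF k this] obtain n0 where n0: "\<forall>V \<Omega>. finite V \<and> n0 \<le> card V \<and> finite \<Omega> \<and> \<Omega> \<noteq> {} \<and>
    (\<forall>x\<in>\<Omega>. (\<forall>e\<in>[V]\<^bsup>k\<^esup>. x e \<in> edge_states e) \<and> irredundant (\<Union>e\<in>[V]\<^bsup>k\<^esup>. x e)) \<and>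
    (\<forall>x\<in>\<Omega>. \<forall>y\<in>\<Omega>. (\<forall>e\<in>[V]\<^bsup>k\<^esup>. y e = x e) \<longrightarrow> y = x) \<longrightarrow>
    log 2 (real (card \<Omega>)) \<le> (turan_density k (T_pdg k) (log 2 3) + 3 * (\<epsilon> / 3)) * real (card V choose k)" ..
  show ?thesis
  proof (intro exI[of _ n0] allI impI)
    fix n assume n: "n0 \<le> n"
    let ?V = "{1..n}"
    define F where "F = {\<Phi>. \<Phi> \<subseteq> clauses k n \<and> irredundant \<Phi>}"
    define X where "X \<Phi> e = {C \<in> \<Phi>. fst ` C = e}" for \<Phi> :: sat_formula and e
    have union: "(\<Union>e\<in>[?V]\<^bsup>k\<^esup>. X \<Phi> e) = \<Phi>" if "\<Phi> \<in> F" for \<Phi>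
      using that clause_vars unfolding F_def X_def by blast
    have inj: "inj_on X F" by (rule inj_onI) (metis union)
    have finF: "finite F"
      unfolding F_def by (rule finite_subset[of _ "Pow (clauses k n)"]) (auto simp: finite_clauses)
    have "{} \<in> F" by (simp add: F_def irredundant_def)
    then have ne: "X ` F \<noteq> {}" by blast
    have "\<forall>x\<in>X ` F. (\<forall>e\<in>[?V]\<^bsup>k\<^esup>. x e \<in> edge_states e) \<and> irredundant (\<Union>e\<in>[?V]\<^bsup>k\<^esup>. x e)"
    proof
      fix x assume "x \<in> X ` F"
      then obtain \<Phi> where \<Phi>: "\<Phi> \<in> F" "x = X \<Phi>" by blast
      have "x e \<in> edge_states e" for e
        using \<Phi> by (auto simp: X_def F_def edge_states_def clauses_def)
      moreover have "irredundant (\<Union>e\<in>[?V]\<^bsup>k\<^esup>. x e)" using union[OF \<Phi>(1)] \<Phi> by (simp add: F_def)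
      ultimately show "(\<forall>e\<in>[?V]\<^bsup>k\<^esup>. x e \<in> edge_states e) \<and> irredundant (\<Union>e\<in>[?V]\<^bsup>k\<^esup>. x e)" by blast
    qed
    moreover have "\<forall>x\<in>X ` F. \<forall>y\<in>X ` F. (\<forall>e\<in>[?V]\<^bsup>k\<^esup>. y e = x e) \<longrightarrow> y = x"
    proof (intro ballI impI)
      fix x y assume xy: "x \<in> X ` F" "y \<in> X ` F" and eq: "\<forall>e\<in>[?V]\<^bsup>k\<^esup>. y e = x e"
      obtain \<Phi> \<Psi> where P: "\<Phi> \<in> F" "x = X \<Phi>" "\<Psi> \<in> F" "y = X \<Psi>" using xy by blast
      have "(\<Union>e\<in>[?V]\<^bsup>k\<^esup>. X \<Psi> e) = (\<Union>e\<in>[?V]\<^bsup>k\<^esup>. X \<Phi> e)" using eq P by simp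
      then show "y = x" using union[OF P(1)] union[OF P(3)] P by simp
    qed
    ultimately have "log 2 (real (card (X ` F))) \<le> (turan_density k (T_pdg k) (log 2 3) + 3 * (\<epsilon> / 3)) * real (card ?V choose k)"
      using n0[rule_format, of ?V "X ` F"] n finF ne by simp
    then show "log 2 (real (card {\<Phi>. \<Phi> \<subseteq> clauses k n \<and> irredundant \<Phi>})) \<le>
        (turan_density k (T_pdg k) (log 2 3) + \<epsilon>) * real (n choose k)"
      unfolding F_def[symmetric] by (simp add: card_image[OF inj])
  qed
qed

theorem theorem1p16:
  fixes k :: nat
  assumes "k \<ge> 2"
  shows "\<exists>\<epsilon> :: nat \<Rightarrow> real. \<epsilon> \<longlonglongrightarrow> 0 \<and>
           (\<forall>n. real (card (ksat_functions k n)) \<le>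
                2 powr ((turan_density k (T_pdg k) (log 2 3) + \<epsilon> n) * real (n choose k)))"
proof -
  let ?\<pi> = "turan_density k (T_pdg k) (log 2 3)"
  define F where "F n = {\<Phi>. \<Phi> \<subseteq> clauses k n \<and> irredundant \<Phi>}" for n
  have finF: "finite (F n)" for n
    unfolding F_def by (rule finite_subset[of _ "Pow (clauses k n)"]) (auto simp: finite_clauses)
  have "{} \<in> F n" for n by (simp add: F_def irredundant_def)
  then have pos: "0 < real (card (F n))" for n using finF[of n] by (auto simp: card_gt_0_iff)
  define \<epsilon> where "\<epsilon> n = max 0 (log 2 (real (card (F n))) / real (n choose k) - ?\<pi>)" for n
  have "\<epsilon> \<longlonglongrightarrow> 0"
  proof (rule LIMSEQ_I)
    fix \<delta> :: real assume d: "0 < \<delta>"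
    then have "0 < \<delta> / 2" by simp
    from log_card_irredundant_le[OF assms this] obtain n0 where
      n0: "\<And>n. n0 \<le> n \<Longrightarrow> log 2 (real (card (F n))) \<le> (?\<pi> + \<delta> / 2) * real (n choose k)"
      unfolding F_def by blast
    have "norm (\<epsilon> n - 0) < \<delta>" if "max n0 k \<le> n" for n
    proof -
      have "0 < real (n choose k)" using that by (simp add: zero_less_binomial)
      then have "log 2 (real (card (F n))) / real (n choose k) \<le> ?\<pi> + \<delta> / 2"
        using n0[of n] that by (simp add: divide_le_eq)
      then show ?thesis using d by (simp add: \<epsilon>_def)
    qed
    then show "\<exists>N. \<forall>n\<ge>N. norm (\<epsilon> n - 0) < \<delta>" by blast
  qed
  moreover have "real (card (ksat_functions k n)) \<le> 2 powr ((?\<pi> + \<epsilon> n) * real (n choose k))" for n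
  proof -
    have "log 2 (real (card (F n))) \<le> (?\<pi> + \<epsilon> n) * real (n choose k)"
    proof (cases "k \<le> n")
      case True
      then have C: "0 < real (n choose k)" by (simp add: zero_less_binomial)
      have "log 2 (real (card (F n))) / real (n choose k) \<le> ?\<pi> + \<epsilon> n" by (simp add: \<epsilon>_def)
      then show ?thesis using C by (simp add: divide_le_eq)
    next
      \<comment> \<open>For \<open>n < k\<close> the exponent is 0, and the empty formula is the
        only one.\<close>
      case False
      then have "[{1..n}]\<^bsup>k\<^esup> = {}" by (intro nsets_eq_empty) auto
      then have "clauses k n = {}" using clause_vars by blast
      then have "F n = {{}}" by (auto simp: F_def irredundant_def)
      then show ?thesis using False by (simp add: binomial_eq_0)
    qed
    then have "2 powr log 2 (real (card (F n))) \<le> 2 powr ((?\<pi> + \<epsilon> n) * real (n choose k))"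
      by (intro powr_mono) auto
    moreover have "2 powr log 2 (real (card (F n))) = real (card (F n))" using pos[of n] by simp
    moreover have "real (card (ksat_functions k n)) \<le> real (card (F n))"
      using card_ksat_functions_le[of k n] by (simp add: F_def)
    ultimately show ?thesis by linarith
  qed
  ultimately show ?thesis by blast
qed

end
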